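(* Let $k\ge1$ and let $T(\widetilde A)$ be a partially symmetric, bounded stationary G-chain generated by $\widetilde A\in L^\infty_{2k\times 2k}$. Then the entropy rate $\mathfrak S(T(\widetilde A))=\lim_{n\to\infty}\frac{S(T_n(\widetilde A))}{n}$ of the corresponding stationary quantum Gaussian process is $$\mathfrak S\big(T(\widetilde A)\big)=\frac1{2\pi}\int_{-\pi}^{\pi}S\big(\widetilde A(\theta)\big)\,d\theta .$$
   Context: $L^\infty_{2k\times 2k}$ is the set of measurable functions $\widetilde A$ from $[-\pi,\pi]$ to the complex $2k\times 2k$ matrices with essentially bounded entries and $\widetilde A(-\pi)=\widetilde A(\pi)$. The Fourier coefficients of $\widetilde A$ are $A_n=\frac1{2\pi}\int_{-\pi}^{\pi}\widetilde A(\theta)e^{-\imath n\theta}d\theta$, $n\in\mathbb Z$. $l^2_{2k}$ is the Hilbert space of square summable sequences $(x_0,x_1,\dots)$ with $x_i\in\mathbb C^{2k}$. $T(\widetilde A)=[A_{i-j}]_{i,j=0}^\infty$ is the block Toeplitz matrix generated by $\widetilde A$, and $T_n(\widetilde A)=[A_{i-j}]_{i,j=0}^{n-1}$. Let $J_2=\begin{bmatrix}0&1\\-1&0\end{bmatrix}$ and $J_{2m}=J_2\oplus\cdots\oplus J_2$ ($m$ times). A G-matrix is a real positive definite $2m\times 2m$ matrix $B$ with $B+\frac{\imath}{2}J_{2m}\ge0$ (positive semidefinite). A stationary G-chain is an infinite real block Toeplitz matrix $\Sigma=[A_{i-j}]_{i,j=0}^\infty$ with $2k\times 2k$ blocks such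 that for every $n\in\mathbb N$ the truncation $[A_{i-j}]_{i,j=0}^{n-1}$ is a ($2nk\times 2nk$) G-matrix. It is bounded if it is bounded as a linear operator on $l^2_{2k}$, and partially symmetric if every $A_n$ is real and $A_{-n}=A_n$ for all $n\in\mathbb N$. In the bounded partially symmetric case $\widetilde A(\theta)$ is a G-matrix for almost every $\theta$. A real $2m\times 2m$ matrix $M$ is symplectic if $M^TJ_{2m}M=J_{2m}$. By Williamson's theorem, for every real positive definite $2m\times 2m$ matrix $B$ there is a symplectic $M$ with $MBM^T=d_1(B)I_2\oplus\cdots\oplus d_m(B)I_2$, where $0<d_1(B)\le\cdots\le d_m(B)$ are uniquely determined by $B$ (the symplectic eigenvalues of $B$). $B$ is a G-matrix iff all $d_j(B)\ge\frac12$. For a $2m\times 2m$ G-matrix $B$, the von Neumann entropy of the corresponding Gaussian state is $$S(B)=\sum_{j=1}^m\frac{2d_j(B)+1}{2}\,H\!\left(\frac{2d_j(B)-1}{2d_j(B)+1}\right),$$ where $H(t)=-t\log t-(1-t)\log(1-t)$ for $0<t<1$ and $H(0)=H(1)=0$. *)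

theory Defs
  imports "HOL-Analysis.Analysis" "Jordan_Normal_Form.Schur_Decomposition"
begin

text \<open>
  Matrices of varying size are the carrier-based matrices of Jordan_Normal_Form, which shadow the
  type-indexed vectors and matrices of HOL-Analysis. All matrices have type complex mat; a real
  matrix is one whose entries lie in \<open>\<real>\<close>. The order on complex numbers is that of
  Complex_Order: \<open>0 \<le> z\<close> means that \<open>z\<close> is real and nonnegative.
\<close>

no_notation vec_nth (infixl \<open>$\<close> 90)
no_notation inner (infix \<open>\<bullet>\<close> 70)
hide_const (open) Finite_Cartesian_Product.vec Finite_Cartesian_Product.mat
  Finite_Cartesian_Product.row Finite_Cartesian_Product.transpose
hide_type (open) Finite_Cartesian_Product.vec


section \<open>Symplectic matrices, G-matrices and Gaussian entropy\<close>

definition real_mat :: "complex mat \<Rightarrow> bool" where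
  "real_mat B \<longleftrightarrow> elements_mat B \<subseteq> \<real>"

definition pos_semidef :: "nat \<Rightarrow> complex mat \<Rightarrow> bool" where
  "pos_semidef n B \<longleftrightarrow> B \<in> carrier_mat n n \<and> mat_adjoint B = B \<and>
     (\<forall>v \<in> carrier_vec n. 0 \<le> (B *\<^sub>v v) \<bullet>c v)"

definition pos_def :: "nat \<Rightarrow> complex mat \<Rightarrow> bool" where
  "pos_def n B \<longleftrightarrow> B \<in> carrier_mat n n \<and> mat_adjoint B = B \<and>
     (\<forall>v \<in> carrier_vec n. v \<noteq> 0\<^sub>v n \<longrightarrow> 0 < (B *\<^sub>v v) \<bullet>c v)"

definition J2 :: "complex mat" where
  "J2 = mat_of_rows_list 2 [[0, 1], [-1, 0]]"

text \<open>The argument \<open>m\<close> below is the number of modes, so the matrices have size \<open>2m\<close>.\<close>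

definition J_mat :: "nat \<Rightarrow> complex mat" where
  "J_mat m = diag_block_mat (replicate m J2)"

definition G_matrix :: "nat \<Rightarrow> complex mat \<Rightarrow> bool" where
  "G_matrix m B \<longleftrightarrow> real_mat B \<and> pos_def (2 * m) B \<and>
     pos_semidef (2 * m) (B + (\<i> / 2) \<cdot>\<^sub>m J_mat m)"

definition symplectic :: "nat \<Rightarrow> complex mat \<Rightarrow> bool" where
  "symplectic m M \<longleftrightarrow> M \<in> carrier_mat (2 * m) (2 * m) \<and> real_mat M \<and>
     transpose_mat M * J_mat m * M = J_mat m"

definition williamson_form :: "nat \<Rightarrow> complex mat \<Rightarrow> real list \<Rightarrow> bool" where
  "williamson_form m B d \<longleftrightarrow> length d = m \<and> sorted d \<and> (\<forall>x \<in> set d. 0 < x) \<and>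
     (\<exists>M. symplectic m M \<and>
        M * B * transpose_mat M = diag_block_mat (map (\<lambda>x. complex_of_real x \<cdot>\<^sub>m 1\<^sub>m 2) d))"

text \<open>
  Well defined for real positive definite \<open>B\<close> by Williamson's theorem; the list is indexed from 0.
\<close>

definition symplectic_eigenvalues :: "nat \<Rightarrow> complex mat \<Rightarrow> real list" where
  "symplectic_eigenvalues m B = (THE d. williamson_form m B d)"

definition shannon_H :: "real \<Rightarrow> real" where
  "shannon_H t = (if 0 < t \<and> t < 1 then - t * ln t - (1 - t) * ln (1 - t) else 0)"

definition gaussian_entropy :: "nat \<Rightarrow> complex mat \<Rightarrow> real" where
  "gaussian_entropy m B =
     (\<Sum>j<m. let d = symplectic_eigenvalues m B ! j
             in (2 * d + 1) / 2 * shannon_H ((2 * d - 1) / (2 * d + 1)))"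


section \<open>Infinite block matrices as operators\<close>

definition vec_sqnorm :: "complex vec \<Rightarrow> real" where
  "vec_sqnorm v = (\<Sum>r<dim_vec v. (cmod (v $ r))\<^sup>2)"

definition block_l2 :: "nat \<Rightarrow> (nat \<Rightarrow> complex vec) set" where
  "block_l2 N = {x. (\<forall>i. x i \<in> carrier_vec N) \<and> summable (\<lambda>i. vec_sqnorm (x i))}"

definition block_l2_norm :: "(nat \<Rightarrow> complex vec) \<Rightarrow> real" where
  "block_l2_norm x = sqrt (\<Sum>i. vec_sqnorm (x i))"

text \<open>Series of vectors are taken componentwise.\<close>

definition block_apply ::
  "nat \<Rightarrow> (nat \<Rightarrow> nat \<Rightarrow> complex mat) \<Rightarrow> (nat \<Rightarrow> complex vec) \<Rightarrow> nat \<Rightarrow> complex vec" where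
  "block_apply N S x i = vec N (\<lambda>r. \<Sum>j. (S i j *\<^sub>v x j) $ r)"

definition block_bounded :: "nat \<Rightarrow> (nat \<Rightarrow> nat \<Rightarrow> complex mat) \<Rightarrow> bool" where
  "block_bounded N S \<longleftrightarrow>
     (\<exists>C. \<forall>x \<in> block_l2 N.
        (\<forall>i. \<forall>r<N. summable (\<lambda>j. (S i j *\<^sub>v x j) $ r)) \<and>
        block_apply N S x \<in> block_l2 N \<and>
        block_l2_norm (block_apply N S x) \<le> C * block_l2_norm x)"

definition block_trunc :: "nat \<Rightarrow> (nat \<Rightarrow> nat \<Rightarrow> complex mat) \<Rightarrow> nat \<Rightarrow> complex mat" where
  "block_trunc N S n =
     mat (n * N) (n * N) (\<lambda>(p, q). S (p div N) (q div N) $$ (p mod N, q mod N))"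


section \<open>Block Toeplitz matrices and stationary G-chains\<close>

definition block_toeplitz :: "(int \<Rightarrow> complex mat) \<Rightarrow> nat \<Rightarrow> nat \<Rightarrow> complex mat" where
  "block_toeplitz A i j = A (int i - int j)"

definition stationary_G_chain :: "nat \<Rightarrow> (nat \<Rightarrow> nat \<Rightarrow> complex mat) \<Rightarrow> bool" where
  "stationary_G_chain k S \<longleftrightarrow>
     (\<exists>A. (\<forall>n. A n \<in> carrier_mat (2 * k) (2 * k) \<and> real_mat (A n)) \<and> S = block_toeplitz A) \<and>
     (\<forall>n\<ge>1. G_matrix (n * k) (block_trunc (2 * k) S n))"

definition partially_symmetric :: "(int \<Rightarrow> complex mat) \<Rightarrow> bool" where
  "partially_symmetric A \<longleftrightarrow>
     (\<forall>n. real_mat (A n)) \<and> (\<forall>n::nat. A (- int n) = A (int n))"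

definition Linfty_mat :: "nat \<Rightarrow> (real \<Rightarrow> complex mat) \<Rightarrow> bool" where
  "Linfty_mat N a \<longleftrightarrow>
     (\<forall>\<theta> \<in> {-pi..pi}. a \<theta> \<in> carrier_mat N N) \<and>
     (\<forall>p<N. \<forall>q<N.
        (\<lambda>\<theta>. a \<theta> $$ (p, q)) \<in> borel_measurable (lebesgue_on {-pi..pi}) \<and>
        (\<exists>C. AE \<theta> in lebesgue_on {-pi..pi}. cmod (a \<theta> $$ (p, q)) \<le> C)) \<and>
     a (-pi) = a pi"

definition fourier_coeff :: "nat \<Rightarrow> (real \<Rightarrow> complex mat) \<Rightarrow> int \<Rightarrow> complex mat" where
  "fourier_coeff N a n =
     mat N N (\<lambda>(p, q). 1 / (2 * complex_of_real pi) *
       (LINT \<theta>|lebesgue_on {-pi..pi}.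
          a \<theta> $$ (p, q) * exp (- \<i> * of_int n * complex_of_real \<theta>)))"

definition toeplitz_of_symbol ::
  "nat \<Rightarrow> (real \<Rightarrow> complex mat) \<Rightarrow> nat \<Rightarrow> nat \<Rightarrow> complex mat" where
  "toeplitz_of_symbol N a = block_toeplitz (fourier_coeff N a)"

definition entropy_seq :: "nat \<Rightarrow> (nat \<Rightarrow> nat \<Rightarrow> complex mat) \<Rightarrow> nat \<Rightarrow> real" where
  "entropy_seq k S n = gaussian_entropy (n * k) (block_trunc (2 * k) S n) / real n"

definition entropy_rate :: "nat \<Rightarrow> (nat \<Rightarrow> nat \<Rightarrow> complex mat) \<Rightarrow> real" where
  "entropy_rate k S = lim (entropy_seq k S)"

end

(*
  The entropy of a Gaussian state is a continuous function of the squares of the symplectic eigenvalues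
  d_j, and 2 * (sum over j of d_j^(2 l)) is, up to the sign (-1)^l, the trace of (J B)^(2 l). Since the
  d_j of all truncations, and of almost all values of the symbol, lie in one bounded interval,
  Weierstrass approximation reduces the theorem to the convergence of (1/n) tr((J T_n(a))^l) to the mean
  of tr((J a)^l). This is a statement about products of scalar Toeplitz matrices: T_n(f) T_n(g) differs
  from T_n(f g) by a matrix whose squared Hilbert-Schmidt norm is o(n), because it is O(1) when g is a
  trigonometric polynomial and these are dense in L^2.

  The same trace asymptotics show that the symbol is determined by its Fourier coefficients and inherits
  positivity from the truncations, so that its values are almost everywhere real positive definite.
  Williamson's theorem is obtained by minimising a weighted trace over the symplectic group.
*)
theory Submission
  imports Defs
begin

text \<open>The matrix J of n k modes is block diagonal with n equal blocks, so J T_n(a) = T_n(J a)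
  holds exactly, and one block symbol governs the traces of all powers. Since J B has the
  eigenvalues i d_j and -i d_j, only even powers carry information; this is why the entropy is
  approximated in the variable s = d^2. Errors are measured in the Hilbert-Schmidt norm because even
  for trigonometric polynomials the defect of T_n(f) T_n(g) need not vanish in operator norm.
  Normalised traces are blind to errors of squared norm o(n), and multiplication by T_n(g) enlarges
  that norm by at most the essential bound of g. The common interval for the d_j comes from the
  growth of traces of powers: a bound c R^l for all l forces d_j \<le> R whatever c is, so
  prefactors that grow with n do no harm. The symbol is accessible only through its Fourier
  coefficients and up to null sets. Partial symmetry makes it real; strict positivity is extracted
  from the G-matrix inequality in a quantitative form that needs only countably many test
  vectors.\<close>

text \<open>Matrices in the analytic part are functions on \<open>nat \<times> nat\<close>; their size is passed to each operation,
  and entries outside the range are irrelevant.\<close>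

definition fmat_mult :: "nat \<Rightarrow> (nat \<Rightarrow> nat \<Rightarrow> 'a::comm_ring_1) \<Rightarrow> (nat \<Rightarrow> nat \<Rightarrow> 'a) \<Rightarrow> nat \<Rightarrow> nat \<Rightarrow> 'a" where
  "fmat_mult n X Y i j = (\<Sum>k<n. X i k * Y k j)"

section \<open>Fourier coefficients of bounded functions\<close>

abbreviation circ :: "real measure" where "circ \<equiv> lebesgue_on {-pi..pi}"

definition mean :: "(real \<Rightarrow> complex) \<Rightarrow> complex" where
  "mean f = 1 / (2 * complex_of_real pi) * (LINT t|circ. f t)"

definition character :: "int \<Rightarrow> real \<Rightarrow> complex" where
  "character n t = exp (\<i> * of_int n * complex_of_real t)"

definition fourier :: "(real \<Rightarrow> complex) \<Rightarrow> int \<Rightarrow> complex" where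
  "fourier f n = mean (\<lambda>t. f t * character (- n) t)"

definition ess_bounded :: "(real \<Rightarrow> complex) \<Rightarrow> bool" where
  "ess_bounded f \<longleftrightarrow> f \<in> borel_measurable circ \<and> (\<exists>C. AE t in circ. cmod (f t) \<le> C)"

definition mean_sq :: "(real \<Rightarrow> complex) \<Rightarrow> real" where
  "mean_sq f = 1 / (2 * pi) * (LINT t|circ. (cmod (f t))\<^sup>2)"

lemma finite_measure_circ: "finite_measure circ"
  by (rule finite_measure_lebesgue_on) simp

lemma measure_circ: "measure circ (space circ) = 2 * pi"
  by (simp add: measure_restrict_space)

lemma ess_bounded_integrable: "ess_bounded f \<Longrightarrow> integrable circ f"
  unfolding ess_bounded_def using finite_measure.integrable_const_bound[OF finite_measure_circ] by blast

lemma ess_boundedI: "f \<in> borel_measurable circ \<Longrightarrow> (AE t in circ. cmod (f t) \<le> C) \<Longrightarrow> ess_bounded f"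
  unfolding ess_bounded_def by blast

lemma ess_boundedE:
  assumes "ess_bounded f"
  obtains C where "f \<in> borel_measurable circ" "AE t in circ. cmod (f t) \<le> C" "C > 0"
proof -
  from assms obtain C where C: "f \<in> borel_measurable circ" "AE t in circ. cmod (f t) \<le> C"
    unfolding ess_bounded_def by blast
  from C(2) have "AE t in circ. cmod (f t) \<le> \<bar>C\<bar> + 1"
    by eventually_elim linarith
  then show ?thesis using C(1) that[of "\<bar>C\<bar> + 1"] by auto
qed

lemma ess_bounded_const [simp]: "ess_bounded (\<lambda>t. c)"
  by (rule ess_boundedI[where C = "cmod c"]) auto

lemma character_cis: "character n t = cis (of_int n * t)"
  unfolding character_def cis_conv_exp by (simp add: mult.assoc)

lemma norm_character [simp]: "cmod (character n t) = 1"
  by (simp add: character_cis)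

lemma character_mult: "character m t * character n t = character (m + n) t"
  by (simp add: character_cis cis_mult ring_distribs)

lemma character_0 [simp]: "character 0 t = 1"
  by (simp add: character_cis)

lemma cnj_character [simp]: "cnj (character n t) = character (- n) t"
  by (simp add: character_cis cis_cnj)

lemma character_diff: "character (m - n) t = character m t * cnj (character n t)"
  by (simp add: character_mult)

lemma continuous_on_character [continuous_intros]: "continuous_on S (character n)"
  unfolding character_def by (intro continuous_intros)

lemma measurable_circ_continuous:
  "continuous_on {-pi..pi} (f :: real \<Rightarrow> complex) \<Longrightarrow> f \<in> borel_measurable circ"
  by (rule continuous_imp_measurable_on_sets_lebesgue) auto

lemma ess_bounded_character [simp]: "ess_bounded (character n)"
  by (rule ess_boundedI[where C = 1]) (auto intro: measurable_circ_continuous continuous_intros)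

lemma ess_bounded_add [intro]:
  assumes "ess_bounded f" "ess_bounded g" shows "ess_bounded (\<lambda>t. f t + g t)"
proof -
  obtain C where C: "f \<in> borel_measurable circ" "AE t in circ. cmod (f t) \<le> C"
    using ess_boundedE[OF assms(1)] .
  obtain D where D: "g \<in> borel_measurable circ" "AE t in circ. cmod (g t) \<le> D"
    using ess_boundedE[OF assms(2)] .
  show ?thesis
  proof (rule ess_boundedI)
    show "AE t in circ. cmod (f t + g t) \<le> C + D"
      using C(2) D(2) by eventually_elim (meson add_mono norm_triangle_le)
  qed (use C D in measurable)
qed

lemma ess_bounded_mult [intro]:
  assumes "ess_bounded f" "ess_bounded g" shows "ess_bounded (\<lambda>t. f t * g t)"
proof -
  obtain C where C: "f \<in> borel_measurable circ" "AE t in circ. cmod (f t) \<le> C" "C > 0"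
    using ess_boundedE[OF assms(1)] .
  obtain D where D: "g \<in> borel_measurable circ" "AE t in circ. cmod (g t) \<le> D"
    using ess_boundedE[OF assms(2)] .
  show ?thesis
  proof (rule ess_boundedI)
    show "AE t in circ. cmod (f t * g t) \<le> C * D"
      using C(2) D(2) by eventually_elim (use C(3) in \<open>auto simp: norm_mult intro!: mult_mono\<close>)
  qed (use C D in measurable)
qed

lemma ess_bounded_uminus [intro]: "ess_bounded f \<Longrightarrow> ess_bounded (\<lambda>t. - f t)"
  using ess_bounded_mult[of "\<lambda>t. -1" f] by simp

lemma ess_bounded_diff [intro]: "ess_bounded f \<Longrightarrow> ess_bounded g \<Longrightarrow> ess_bounded (\<lambda>t. f t - g t)"
  using ess_bounded_add[of f "\<lambda>t. - g t"] by auto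

lemma ess_bounded_cnj [intro]: "ess_bounded f \<Longrightarrow> ess_bounded (\<lambda>t. cnj (f t))"
  unfolding ess_bounded_def using borel_measurable_continuous_onI[of cnj] measurable_compose[of f circ borel cnj borel]
  by (auto intro: continuous_intros)

lemma ess_bounded_sum [intro]: "(\<And>i. i \<in> I \<Longrightarrow> ess_bounded (f i)) \<Longrightarrow> ess_bounded (\<lambda>t. \<Sum>i\<in>I. f i t)"
  by (induction I rule: infinite_finite_induct) auto

lemma mean_add: "ess_bounded f \<Longrightarrow> ess_bounded g \<Longrightarrow> mean (\<lambda>t. f t + g t) = mean f + mean g"
  unfolding mean_def by (simp add: ess_bounded_integrable ring_distribs)

lemma mean_cmult: "mean (\<lambda>t. c * f t) = c * mean f"
  unfolding mean_def by simp

lemma mean_diff: "ess_bounded f \<Longrightarrow> ess_bounded g \<Longrightarrow> mean (\<lambda>t. f t - g t) = mean f - mean g"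
  using mean_add[of f "\<lambda>t. - g t"] mean_cmult[of "-1" g] by auto

lemma mean_sum:
  "(\<And>i. i \<in> I \<Longrightarrow> ess_bounded (f i)) \<Longrightarrow> mean (\<lambda>t. \<Sum>i\<in>I. f i t) = (\<Sum>i\<in>I. mean (f i))"
  unfolding mean_def by (simp add: ess_bounded_integrable sum_distrib_left)

lemma mean_cnj: "mean (\<lambda>t. cnj (f t)) = cnj (mean f)"
  unfolding mean_def by simp

lemma mean_character: "mean (character n) = (if n = 0 then 1 else 0)"
proof (cases "n = 0")
  case True
  have "(LINT t|circ. (1::complex)) = of_real (2 * pi)"
    using measure_circ by (simp add: scaleR_conv_of_real)
  then show ?thesis using True by (simp add: mean_def character_def)
next
  case False
  let ?F = "\<lambda>t::real. character n t / (\<i> * of_int n)"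
  have "(character n has_integral (?F pi - ?F (-pi))) {-pi..pi}"
  proof (rule fundamental_theorem_of_calculus)
    fix t :: real
    have "((\<lambda>z. exp (\<i> * of_int n * z) / (\<i> * of_int n)) has_field_derivative
        exp (\<i> * of_int n * complex_of_real t)) (at (complex_of_real t))"
      using False by (auto intro!: derivative_eq_intros)
    from has_vector_derivative_real_field[OF this]
    show "(?F has_vector_derivative character n t) (at t within {-pi..pi})"
      unfolding character_def by (rule has_vector_derivative_at_within)
  qed simp
  moreover have "?F pi = ?F (-pi)"
  proof -
    have "character n pi = character n (- pi)"
      using sin_npi_int[of n] by (simp add: character_cis complex_eq_iff mult.commute)
    then show ?thesis by simp
  qed
  ultimately have "integral {-pi..pi} (character n) = 0"
    by (simp add: integral_unique)
  then show ?thesis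
    using False lebesgue_integral_eq_integral[OF ess_bounded_integrable[OF ess_bounded_character[of n]]] by (simp add: mean_def)
qed

lemma fourier_add: "ess_bounded f \<Longrightarrow> ess_bounded g \<Longrightarrow> fourier (\<lambda>t. f t + g t) n = fourier f n + fourier g n"
  unfolding fourier_def using mean_add[of "\<lambda>t. f t * character (- n) t" "\<lambda>t. g t * character (- n) t"]
  by (simp add: ring_distribs ess_bounded_mult)

lemma fourier_cmult: "fourier (\<lambda>t. c * f t) n = c * fourier f n"
  unfolding fourier_def using mean_cmult[of c "\<lambda>t. f t * character (- n) t"] by (simp add: mult.assoc)

lemma fourier_diff: "ess_bounded f \<Longrightarrow> ess_bounded g \<Longrightarrow> fourier (\<lambda>t. f t - g t) n = fourier f n - fourier g n"
  using fourier_add[of f "\<lambda>t. - g t"] fourier_cmult[of "-1" g] by auto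

lemma fourier_sum:
  "(\<And>i. i \<in> I \<Longrightarrow> ess_bounded (f i)) \<Longrightarrow> fourier (\<lambda>t. \<Sum>i\<in>I. f i t) n = (\<Sum>i\<in>I. fourier (f i) n)"
  unfolding fourier_def using mean_sum[of I "\<lambda>i t. f i t * character (- n) t"]
  by (simp add: sum_distrib_right ess_bounded_mult)

lemma fourier_mult_character: "fourier (\<lambda>t. f t * character k t) n = fourier f (n - k)"
  unfolding fourier_def by (simp add: mult.assoc character_mult)

lemma fourier_character: "fourier (character k) n = (if n = k then 1 else 0)"
  unfolding fourier_def character_mult mean_character by auto

lemma fourier_cnj: "fourier (\<lambda>t. cnj (f t)) n = cnj (fourier f (- n))"
  unfolding fourier_def mean_cnj[symmetric] by simp

lemma mean_sq_nonneg: "mean_sq f \<ge> 0"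
  unfolding mean_sq_def by simp

lemma of_real_mean_sq: "complex_of_real (mean_sq f) = mean (\<lambda>t. f t * cnj (f t))"
  unfolding mean_sq_def mean_def
  by (simp add: complex_norm_square[symmetric] of_real_power[symmetric] del: of_real_power)

lemma ess_bounded_integrable_sq: "ess_bounded f \<Longrightarrow> integrable circ (\<lambda>t. (cmod (f t))\<^sup>2)"
  using ess_bounded_integrable[OF ess_bounded_mult[OF _ ess_bounded_cnj], of f f] integrable_Re
  by (fastforce simp: complex_norm_square[symmetric])

lemma mean_sq_mult_le:
  assumes "ess_bounded f" "ess_bounded g" "AE t in circ. cmod (f t) \<le> C"
  shows "mean_sq (\<lambda>t. f t * g t) \<le> C\<^sup>2 * mean_sq g"
proof -
  have "(LINT t|circ. (cmod (f t * g t))\<^sup>2) \<le> (LINT t|circ. C\<^sup>2 * (cmod (g t))\<^sup>2)"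
  proof (rule integral_mono_AE)
    show "AE t in circ. (cmod (f t * g t))\<^sup>2 \<le> C\<^sup>2 * (cmod (g t))\<^sup>2"
      using assms(3)
      by eventually_elim (auto simp: norm_mult power_mult_distrib intro!: mult_right_mono power_mono)
  qed (use assms in \<open>auto intro!: ess_bounded_integrable_sq integrable_mult_right\<close>)
  then show ?thesis
    unfolding mean_sq_def by (simp add: divide_right_mono)
qed

lemma mean_sq_add_le:
  assumes "ess_bounded f" "ess_bounded g"
  shows "mean_sq (\<lambda>t. f t + g t) \<le> 2 * mean_sq f + 2 * mean_sq g"
proof -
  have "(LINT t|circ. (cmod (f t + g t))\<^sup>2) \<le> (LINT t|circ. 2 * (cmod (f t))\<^sup>2 + 2 * (cmod (g t))\<^sup>2)"
  proof (rule integral_mono)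
    show "(cmod (f t + g t))\<^sup>2 \<le> 2 * (cmod (f t))\<^sup>2 + 2 * (cmod (g t))\<^sup>2" for t
    proof -
      have "(cmod (f t + g t))\<^sup>2 \<le> (cmod (f t) + cmod (g t))\<^sup>2"
        by (rule power_mono[OF norm_triangle_ineq]) simp
      then show ?thesis
        using sum_squares_bound[of "cmod (f t)" "cmod (g t)"] by (simp add: power2_sum)
    qed
  qed (use assms in \<open>auto intro!: ess_bounded_integrable_sq integrable_add integrable_mult_right\<close>)
  also have "\<dots> = 2 * (LINT t|circ. (cmod (f t))\<^sup>2) + 2 * (LINT t|circ. (cmod (g t))\<^sup>2)"
    using assms by (subst Bochner_Integration.integral_add) (auto intro!: ess_bounded_integrable_sq)
  finally show ?thesis
    unfolding mean_sq_def by (simp add: field_simps)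
qed

text \<open>Orthonormality of the characters: in the double sum only the diagonal terms
  survive.\<close>

lemma mean_sq_sum_character:
  assumes "finite I"
  shows "mean_sq (\<lambda>t. \<Sum>n\<in>I. c n * character n t) = (\<Sum>n\<in>I. (cmod (c n))\<^sup>2)"
proof -
  have "complex_of_real (mean_sq (\<lambda>t. \<Sum>n\<in>I. c n * character n t))
      = mean (\<lambda>t. \<Sum>n\<in>I. \<Sum>m\<in>I. c n * cnj (c m) * character (n - m) t)"
    unfolding of_real_mean_sq
    by (simp add: sum_product character_diff mult_ac del: cnj_character)
  also have "\<dots> = (\<Sum>n\<in>I. \<Sum>m\<in>I. c n * cnj (c m) * mean (character (n - m)))"
  proof -
    have "mean (\<lambda>t. \<Sum>m\<in>I. c n * cnj (c m) * character (n - m) t)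
        = (\<Sum>m\<in>I. c n * cnj (c m) * mean (character (n - m)))" for n
      by (subst mean_sum) (auto simp only: mean_cmult intro!: ess_bounded_mult ess_bounded_const ess_bounded_character)
    then show ?thesis
      by (subst mean_sum) (auto intro!: ess_bounded_sum ess_bounded_mult ess_bounded_const ess_bounded_character)
  qed
  also have "\<dots> = (\<Sum>n\<in>I. c n * cnj (c n))"
  proof (rule sum.cong[OF refl])
    fix n assume "n \<in> I"
    have "(\<Sum>m\<in>I. c n * cnj (c m) * mean (character (n - m))) = (\<Sum>m\<in>I. if n = m then c n * cnj (c m) else 0)"
      by (rule sum.cong) (auto simp: mean_character)
    then show "(\<Sum>m\<in>I. c n * cnj (c m) * mean (character (n - m))) = c n * cnj (c n)"
      using assms \<open>n \<in> I\<close> by simp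
  qed
  also have "\<dots> = complex_of_real (\<Sum>n\<in>I. (cmod (c n))\<^sup>2)"
    by (simp add: complex_norm_square[symmetric])
  finally show ?thesis by (simp only: of_real_eq_iff)
qed

text \<open>The squared distance from \<open>g\<close> to its partial Fourier sum over
  \<open>I\<close> equals \<open>mean_sq g - S\<close>, and a squared distance is
  nonnegative.\<close>

lemma bessel:
  assumes "ess_bounded g" "finite I"
  shows "(\<Sum>n\<in>I. (cmod (fourier g n))\<^sup>2) \<le> mean_sq g"
proof -
  define P where "P = (\<lambda>t. \<Sum>n\<in>I. fourier g n * character n t)"
  have bP: "ess_bounded P" unfolding P_def by (intro ess_bounded_sum ess_bounded_mult) auto
  define S where "S = (\<Sum>n\<in>I. (cmod (fourier g n))\<^sup>2)"
  have S: "complex_of_real S = (\<Sum>n\<in>I. cnj (fourier g n) * fourier g n)"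
    unfolding S_def by (simp add: complex_norm_square mult.commute del: of_real_power)
  have gP: "mean (\<lambda>t. g t * cnj (P t)) = of_real S"
  proof -
    have "mean (\<lambda>t. g t * cnj (P t)) = mean (\<lambda>t. \<Sum>n\<in>I. cnj (fourier g n) * (g t * character (- n) t))"
      by (simp add: P_def sum_distrib_left mult_ac)
    also have "\<dots> = (\<Sum>n\<in>I. cnj (fourier g n) * fourier g n)"
      by (subst mean_sum) (auto intro!: ess_bounded_mult assms simp: mean_cmult fourier_def)
    finally show ?thesis using S by simp
  qed
  have Pg: "mean (\<lambda>t. P t * cnj (g t)) = of_real S"
    using mean_cnj[of "\<lambda>t. g t * cnj (P t)"] gP by (simp add: mult.commute)
  have b: "ess_bounded (\<lambda>t. g t * cnj (g t))" "ess_bounded (\<lambda>t. g t * cnj (P t))"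
    "ess_bounded (\<lambda>t. P t * cnj (g t))" "ess_bounded (\<lambda>t. P t * cnj (P t))"
    by (intro ess_bounded_mult ess_bounded_cnj assms bP)+
  have "complex_of_real (mean_sq (\<lambda>t. g t - P t))
     = mean (\<lambda>t. ((g t * cnj (g t)) - (g t * cnj (P t))) - ((P t * cnj (g t)) - (P t * cnj (P t))))"
    unfolding of_real_mean_sq by (simp add: algebra_simps)
  also have "\<dots> = (of_real (mean_sq g) - of_real S) - (of_real S - of_real (mean_sq P))"
    by (simp only: mean_diff[OF ess_bounded_diff[OF b(1,2)] ess_bounded_diff[OF b(3,4)]] mean_diff[OF b(1,2)]
      mean_diff[OF b(3,4)] gP Pg of_real_mean_sq)
  also have "mean_sq P = S"
    unfolding P_def S_def by (rule mean_sq_sum_character[OF assms(2)])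
  finally have "complex_of_real (mean_sq (\<lambda>t. g t - P t)) = complex_of_real (mean_sq g - S)" by simp
  then have "mean_sq (\<lambda>t. g t - P t) = mean_sq g - S" by (simp only: of_real_eq_iff)
  with mean_sq_nonneg[of "\<lambda>t. g t - P t"] show ?thesis unfolding S_def by simp
qed

lemma bessel_reindex:
  fixes n :: nat
  assumes "ess_bounded g" "inj_on \<phi> {..<n}"
  shows "(\<Sum>j<n. (cmod (fourier g (\<phi> j)))\<^sup>2) \<le> mean_sq g"
  using bessel[OF assms(1), of "\<phi> ` {..<n}"] assms(2) by (simp add: sum.reindex)

text \<open>The matrix applied to \<open>x\<close> lists Fourier coefficients of the product of
  \<open>g\<close> with the trigonometric polynomial \<open>X\<close> whose coefficients are
  \<open>x\<close>. Bessel bounds the list, and Parseval evaluates \<open>mean_sq X\<close>. The two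
  injections let the same bound serve for multiplication by a Toeplitz matrix from the left and from
  the right.\<close>

lemma fourier_matrix_bound:
  assumes g: "ess_bounded g" "AE t in circ. cmod (g t) \<le> C"
    and \<phi>: "inj_on \<phi> {..<n::nat}" and \<psi>: "inj_on \<psi> {..<n}"
  shows "(\<Sum>j<n. (cmod (\<Sum>i<n. x i * fourier g (\<phi> j + \<psi> i)))\<^sup>2) \<le> C\<^sup>2 * (\<Sum>i<n. (cmod (x i))\<^sup>2)"
proof -
  define X where "X = (\<lambda>t. \<Sum>i<n. x i * character (- \<psi> i) t)"
  have bX: "ess_bounded X" unfolding X_def by (intro ess_bounded_sum ess_bounded_mult) auto
  have *: "(\<Sum>i<n. x i * fourier g (\<phi> j + \<psi> i)) = fourier (\<lambda>t. g t * X t) (\<phi> j)" for j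
  proof -
    have "fourier (\<lambda>t. g t * X t) (\<phi> j) = fourier (\<lambda>t. \<Sum>i<n. x i * (g t * character (- \<psi> i) t)) (\<phi> j)"
      by (simp add: X_def sum_distrib_left mult_ac)
    also have "\<dots> = (\<Sum>i<n. x i * fourier g (\<phi> j + \<psi> i))"
      by (subst fourier_sum) (auto intro!: ess_bounded_mult g simp: fourier_cmult fourier_mult_character)
    finally show ?thesis by simp
  qed
  have "(\<Sum>j<n. (cmod (\<Sum>i<n. x i * fourier g (\<phi> j + \<psi> i)))\<^sup>2) \<le> mean_sq (\<lambda>t. g t * X t)"
    unfolding * by (rule bessel_reindex[OF _ \<phi>]) (intro ess_bounded_mult g bX)
  also have "\<dots> \<le> C\<^sup>2 * mean_sq X"
    by (rule mean_sq_mult_le[OF g(1) bX g(2)])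
  also have "mean_sq X = (\<Sum>i<n. (cmod (x i))\<^sup>2)"
  proof -
    have inj: "inj_on (\<lambda>i. - \<psi> i) {..<n}" using \<psi> by (auto simp: inj_on_def)
    \<comment> \<open>The coefficients are relabelled by their frequencies, because the Parseval
      formula sums over a set of integers.\<close>
    define y where "y = x \<circ> the_inv_into {..<n} (\<lambda>i. - \<psi> i)"
    have y: "y (- \<psi> i) = x i" if "i < n" for i
      using the_inv_into_f_f[OF inj, of i] that by (simp add: y_def)
    have "X = (\<lambda>t. \<Sum>m\<in>(\<lambda>i. - \<psi> i) ` {..<n}. y m * character m t)"
      unfolding X_def sum.reindex[OF inj] by (auto simp: y)
    then have "mean_sq X = (\<Sum>m\<in>(\<lambda>i. - \<psi> i) ` {..<n}. (cmod (y m))\<^sup>2)"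
      by (simp add: mean_sq_sum_character)
    then show ?thesis unfolding sum.reindex[OF inj] by (simp add: y)
  qed
  finally show ?thesis .
qed

section \<open>Trigonometric polynomials and their density in mean square\<close>

inductive trig_poly :: "(real \<Rightarrow> complex) \<Rightarrow> bool" where
  trig_poly_character: "trig_poly (\<lambda>t. character n t)"
| trig_poly_add: "trig_poly f \<Longrightarrow> trig_poly g \<Longrightarrow> trig_poly (\<lambda>t. f t + g t)"
| trig_poly_cmult: "trig_poly f \<Longrightarrow> trig_poly (\<lambda>t. c * f t)"

lemma trig_poly_ess_bounded: "trig_poly f \<Longrightarrow> ess_bounded f"
  by (induction rule: trig_poly.induct) auto

lemma trig_poly_const: "trig_poly (\<lambda>t. c)"
  using trig_poly_cmult[OF trig_poly_character[of 0], of c] by simp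

lemma trig_poly_mult_character: "trig_poly f \<Longrightarrow> trig_poly (\<lambda>t. f t * character n t)"
proof (induction rule: trig_poly.induct)
  case (trig_poly_character m) then show ?case using trig_poly.trig_poly_character[of "m + n"] by (simp add: character_mult)
next
  case (trig_poly_add f g) then show ?case
    using trig_poly.trig_poly_add[OF trig_poly_add.IH] by (simp add: ring_distribs)
next
  case (trig_poly_cmult f c) then show ?case
    using trig_poly.trig_poly_cmult[OF trig_poly_cmult.IH, of c] by (simp add: mult_ac)
qed

lemma trig_poly_mult: "trig_poly g \<Longrightarrow> trig_poly f \<Longrightarrow> trig_poly (\<lambda>t. f t * g t)"
proof (induction rule: trig_poly.induct)
  case (trig_poly_character n) then show ?case by (rule trig_poly_mult_character)
next
  case (trig_poly_add g h) then show ?case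
    using trig_poly.trig_poly_add[of "\<lambda>t. f t * g t" "\<lambda>t. f t * h t"] by (simp add: ring_distribs)
next
  case (trig_poly_cmult g c) then show ?case
    using trig_poly.trig_poly_cmult[of "\<lambda>t. f t * g t" c] by (simp add: mult_ac)
qed

text \<open>A linear functional of the plane, restricted to the circle, is a combination of
  \<open>cos\<close> and \<open>sin\<close>, hence of two characters; closure under sums and
  products does the rest. This turns the polynomials of Stone-Weierstrass on the circle into
  trigonometric ones.\<close>

lemma trig_poly_real_polynomial:
  "real_polynomial_function p \<Longrightarrow> trig_poly (\<lambda>t. complex_of_real (p (cis t)))"
proof (induction rule: real_polynomial_function.induct)
  case (linear f)
  interpret f: bounded_linear f by fact
  have "f (cis t) = cos t * f 1 + sin t * f \<i>" for t
  proof -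
    have "cis t = cos t *\<^sub>R 1 + sin t *\<^sub>R \<i>" by (simp add: complex_eq_iff)
    then show ?thesis by (simp only: f.add f.scaleR) simp
  qed
  moreover have "complex_of_real (cos t) = 1/2 * character 1 t + 1/2 * character (-1) t"
    "complex_of_real (sin t) = - \<i>/2 * character 1 t + \<i>/2 * character (-1) t" for t
    by (auto simp: character_cis complex_eq_iff)
  moreover have "trig_poly (\<lambda>t. (1/2 * character 1 t + 1/2 * character (-1) t) * of_real (f 1)
      + (- \<i>/2 * character 1 t + \<i>/2 * character (-1) t) * of_real (f \<i>))"
    by (intro trig_poly_add trig_poly_mult[OF trig_poly_const] trig_poly_cmult trig_poly_character)
  ultimately show ?case by simp
next
  case (mult f g) then show ?case using trig_poly_mult[OF mult.IH(2,1)] by simp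
next
  case (add f g) then show ?case using trig_poly_add[OF add.IH] by simp
qed (rule trig_poly_const)

lemma clip_le: "C * w / max C w \<le> C" if "C > 0" "w \<ge> 0" for C w :: real
proof -
  have "max C w > 0" using that by auto
  moreover have "C * w \<le> C * max C w" using that by (intro mult_left_mono) auto
  ultimately show ?thesis by (simp only: divide_le_eq) simp
qed

text \<open>The factor \<open>min 1 (n |z + 1|)\<close> removes the jump of the principal argument at \<open>-1\<close>.\<close>

lemma continuous_on_clip_circle:
  fixes G :: "real \<Rightarrow> complex" and C :: real and n :: nat
  assumes G: "continuous_on UNIV G" and C: "C > 0"
  defines "F \<equiv> \<lambda>z. G (Arg z) * of_real (C / max C (cmod (G (Arg z)))) * of_real (min 1 (real n * cmod (z + 1)))"
  shows "continuous_on (sphere 0 1) F"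
proof -
  have bound: "cmod (F z) \<le> C * (real n * cmod (z + 1))" for z
  proof -
    define w where "w = cmod (G (Arg z))"
    have 1: "w * (C / max C w) \<le> C" using clip_le[OF C, of w] by (simp add: w_def mult.commute)
    have 2: "cmod (F z) = w * (C / max C w) * min 1 (real n * cmod (z + 1))"
      using C unfolding F_def norm_mult w_def by (simp add: norm_divide less_max_iff_disj)
    have "cmod (F z) \<le> C * min 1 (real n * cmod (z + 1))"
      unfolding 2 by (rule mult_right_mono[OF 1]) simp
    also have "\<dots> \<le> C * (real n * cmod (z + 1))" using C by (intro mult_left_mono) auto
    finally show ?thesis .
  qed
  have "continuous (at z within sphere 0 1) F" if z: "z \<in> sphere 0 1" for z
  proof (cases "z = -1")
    case False
    have "z \<notin> \<real>\<^sub>\<le>\<^sub>0"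
    proof
      assume "z \<in> \<real>\<^sub>\<le>\<^sub>0"
      then obtain r where "z = of_real r" "r \<le> 0" by (auto simp: nonpos_Reals_def)
      with z False show False by auto
    qed
    then have A: "isCont Arg z" by (rule continuous_at_Arg)
    have GA: "isCont (\<lambda>z. G (Arg z)) z"
      by (rule isCont_o2[OF A]) (use G in \<open>simp add: continuous_on_eq_continuous_at\<close>)
    have "isCont F z"
      unfolding F_def using GA C by (intro continuous_intros) (auto simp: max_def)
    then show ?thesis using continuous_at_imp_continuous_at_within by blast
  next
    case True
    have "(F \<longlongrightarrow> 0) (at z)"
    proof (rule Lim_null_comparison)
      show "\<forall>\<^sub>F x in at z. cmod (F x) \<le> C * (real n * cmod (x + 1))" using bound by simp
      have "((\<lambda>x. C * (real n * cmod (x + 1))) \<longlongrightarrow> C * (real n * cmod (z + 1))) (at z)"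
        by (intro tendsto_intros)
      then show "((\<lambda>x. C * (real n * cmod (x + 1))) \<longlongrightarrow> 0) (at z)" using True by simp
    qed
    moreover have "F z = 0" using bound[of z] True by simp
    ultimately have "isCont F z" by (simp add: isCont_def)
    then show ?thesis using continuous_at_imp_continuous_at_within by blast
  qed
  then show ?thesis by (simp add: continuous_on_eq_continuous_within)
qed

text \<open>Measurability supplies continuous functions on the line that converge to
  \<open>g\<close> almost everywhere. Clipping them at height \<open>C\<close> and damping them near
  -1 makes them continuous on the circle and uniformly bounded, so dominated convergence gives
  convergence in mean square. One of them is then approximated uniformly by
  Stone-Weierstrass.\<close>

lemma trig_poly_dense:
  assumes g: "ess_bounded g" and e: "e > 0"
  obtains h where "trig_poly h" "mean_sq (\<lambda>t. g t - h t) < e"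
proof -
  obtain C where C: "g \<in> borel_measurable circ" "AE t in circ. cmod (g t) \<le> C" "C > 0"
    using ess_boundedE[OF g] .
  have "g measurable_on {-pi..pi}"
    using C(1) by (simp add: measurable_on_iff_borel_measurable)
  then obtain N G where NG: "negligible N \<and> (\<forall>n. continuous_on UNIV (G n)) \<and>
      (\<forall>x. x \<notin> N \<longrightarrow> (\<lambda>n. G n x) \<longlonglongrightarrow> (if x \<in> {-pi..pi} then g x else 0))"
    unfolding measurable_on_def by (elim exE) (rule that)
  have N: "negligible N" and G: "\<And>n. continuous_on UNIV (G n :: real \<Rightarrow> complex)"
    and lim: "\<And>x. x \<notin> N \<Longrightarrow> (\<lambda>n. G n x) \<longlonglongrightarrow> (if x \<in> {-pi..pi} then g x else 0)"
    using NG by simp_all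
  define F where "F = (\<lambda>n z. G n (Arg z) * of_real (C / max C (cmod (G n (Arg z))))
      * of_real (min 1 (real n * cmod (z + 1))))"
  have contF: "continuous_on (sphere 0 1) (F n)" for n
    unfolding F_def by (rule continuous_on_clip_circle[OF G C(3)])
  have Fb: "cmod (F n z) \<le> C" for n z
  proof -
    define w where "w = cmod (G n (Arg z))"
    have 1: "w * (C / max C w) \<le> C" using clip_le[OF C(3), of w] by (simp add: w_def mult.commute)
    have 2: "cmod (F n z) = w * (C / max C w) * min 1 (real n * cmod (z + 1))"
      using C unfolding F_def norm_mult w_def by (simp add: norm_divide less_max_iff_disj)
    have "cmod (F n z) \<le> C * min 1 (real n * cmod (z + 1))"
      unfolding 2 by (rule mult_right_mono[OF 1]) simp
    also have "\<dots> \<le> C * 1" using C by (intro mult_left_mono) auto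
    finally show ?thesis by simp
  qed
  have cisF: "continuous_on {-pi..pi} (\<lambda>t. F n (cis t))" for n
    by (rule continuous_on_compose2[OF contF, of _ cis]) (auto intro!: continuous_intros)
  have bF: "ess_bounded (\<lambda>t. F n (cis t))" for n
    by (rule ess_boundedI[where C = C]) (auto intro: measurable_circ_continuous cisF Fb)
  \<comment> \<open>At both endpoints \<open>cis t\<close> is -1, where the damping factor vanishes
    for every \<open>n\<close>; they join the exceptional null set.\<close>
  have AEN: "AE t in circ. t \<notin> N \<and> t \<noteq> pi \<and> t \<noteq> -pi"
  proof -
    have "negligible (N \<union> {pi, -pi})" using N by simp
    then have "N \<union> {pi, -pi} \<in> null_sets lebesgue" by (simp add: negligible_iff_null_sets)
    then have "AE t in lebesgue. t \<notin> N \<union> {pi, -pi}" by (rule AE_not_in)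
    then have "AE t in lebesgue. t \<in> {-pi..pi} \<longrightarrow> t \<notin> N \<and> t \<noteq> pi \<and> t \<noteq> -pi"
      by (rule eventually_mono) blast
    then show ?thesis by (subst AE_restrict_space_iff) auto
  qed
  have "(\<lambda>n. LINT t|circ. (cmod (g t - F n (cis t)))\<^sup>2) \<longlonglongrightarrow> (LINT t|circ. (0::real))"
  proof (rule integral_dominated_convergence[where w = "\<lambda>t. (2 * C)\<^sup>2"])
    show "(\<lambda>t. (cmod (g t - F n (cis t)))\<^sup>2) \<in> borel_measurable circ" for n
      using ess_bounded_integrable_sq[OF ess_bounded_diff[OF g bF]] by (rule borel_measurable_integrable)
    show "integrable circ (\<lambda>t. (2 * C)\<^sup>2)"
      using finite_measure.integrable_const[OF finite_measure_circ] by blast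
    show "AE t in circ. norm ((cmod (g t - F n (cis t)))\<^sup>2) \<le> (2 * C)\<^sup>2" for n
      using C(2)
    proof eventually_elim
      fix t assume "cmod (g t) \<le> C"
      then have "cmod (g t - F n (cis t)) \<le> 2 * C"
        using Fb[of n "cis t"] norm_triangle_ineq4[of "g t" "F n (cis t)"] by linarith
      then have "(cmod (g t - F n (cis t)))\<^sup>2 \<le> (2 * C)\<^sup>2" by (intro power_mono) auto
      then show "norm ((cmod (g t - F n (cis t)))\<^sup>2) \<le> (2 * C)\<^sup>2" by simp
    qed
    show "AE t in circ. (\<lambda>n. (cmod (g t - F n (cis t)))\<^sup>2) \<longlonglongrightarrow> 0"
      using C(2) AEN AE_space
    proof eventually_elim
      fix t assume t: "cmod (g t) \<le> C" "t \<notin> N \<and> t \<noteq> pi \<and> t \<noteq> - pi" "t \<in> space circ"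
      then have ti: "-pi < t" "t < pi" by auto
      then have arg: "Arg (cis t) = t" by (intro Arg_cis) auto
      have G: "(\<lambda>n. G n t) \<longlonglongrightarrow> g t" using lim[of t] t ti by auto
      have ne: "cmod (cis t + 1) > 0"
      proof -
        have "cis t \<noteq> -1"
        proof
          assume "cis t = -1"
          then have "Arg (cis t) = pi" by (simp add: Arg_def)
          with arg ti show False by simp
        qed
        then show ?thesis by (metis add_eq_0_iff2 zero_less_norm_iff)
      qed
      have "\<forall>\<^sub>F n in sequentially. 1 / cmod (cis t + 1) \<le> real n"
        by real_asymp
      then have "\<forall>\<^sub>F n in sequentially. min 1 (real n * cmod (cis t + 1)) = 1"
        by eventually_elim (use ne in \<open>auto simp: field_simps\<close>)
      then have m: "(\<lambda>n. min 1 (real n * cmod (cis t + 1))) \<longlonglongrightarrow> 1"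
        by (rule tendsto_eventually)
      have "(\<lambda>n. F n (cis t)) \<longlonglongrightarrow> g t * of_real (C / max C (cmod (g t))) * of_real 1"
        unfolding F_def arg using C(3) by (intro tendsto_intros G m) (auto simp: max_def)
      moreover have "max C (cmod (g t)) = C" using t(1) by simp
      ultimately have "(\<lambda>n. F n (cis t)) \<longlonglongrightarrow> g t" using C(3) by simp
      then have "(\<lambda>n. (cmod (g t - F n (cis t)))\<^sup>2) \<longlonglongrightarrow> (cmod (g t - g t))\<^sup>2"
        by (intro tendsto_intros)
      then show "(\<lambda>n. (cmod (g t - F n (cis t)))\<^sup>2) \<longlonglongrightarrow> 0" by simp
    qed
  qed auto
  then have "(\<lambda>n. mean_sq (\<lambda>t. g t - F n (cis t))) \<longlonglongrightarrow> 0"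
    unfolding mean_sq_def using tendsto_mult_right_zero[of _ sequentially "1 / (2 * pi)"] by simp
  \<comment> \<open>\<open>mean_sq_add_le\<close> doubles each of the two errors, so a quarter of
    \<open>e\<close> for each suffices; this one is strict.\<close>
  then have "\<forall>\<^sub>F n in sequentially. mean_sq (\<lambda>t. g t - F n (cis t)) < e / 4"
    using e by (intro order_tendstoD) auto
  then obtain n where n: "mean_sq (\<lambda>t. g t - F n (cis t)) < e / 4"
    by (meson eventually_sequentially order_refl)
  obtain p where p: "polynomial_function p" "\<And>z. z \<in> sphere 0 1 \<Longrightarrow> cmod (F n z - p z) < sqrt (e / 4)"
    using Stone_Weierstrass_polynomial_function[OF compact_sphere contF[of n], of "sqrt (e/4)"] e by auto
  define h where "h = (\<lambda>t. complex_of_real (Re (p (cis t))) + \<i> * complex_of_real (Im (p (cis t))))"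
  have h: "h t = p (cis t)" for t unfolding h_def by (simp add: complex_eq_iff)
  have "real_polynomial_function (Re \<circ> p)" "real_polynomial_function (Im \<circ> p)"
    using p(1) bounded_linear_Re bounded_linear_Im unfolding polynomial_function_def by auto
  then have th: "trig_poly h" unfolding h_def
    by (auto intro!: trig_poly_add trig_poly_cmult dest!: trig_poly_real_polynomial)
  have bFh: "ess_bounded (\<lambda>t. F n (cis t) - h t)" by (intro ess_bounded_diff bF trig_poly_ess_bounded th)
  have "(LINT t|circ. (cmod (F n (cis t) - h t))\<^sup>2) \<le> (LINT t|circ. e / 4)"
  proof (rule integral_mono)
    show "(cmod (F n (cis t) - h t))\<^sup>2 \<le> e / 4" for t
    proof -
      have "cmod (F n (cis t) - h t) \<le> sqrt (e / 4)" using p(2)[of "cis t"] h[of t] by auto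
      then have "(cmod (F n (cis t) - h t))\<^sup>2 \<le> (sqrt (e / 4))\<^sup>2" by (intro power_mono) auto
      then show ?thesis using e by simp
    qed
  qed (use bFh finite_measure.integrable_const[OF finite_measure_circ] in \<open>auto intro!: ess_bounded_integrable_sq\<close>)
  also have "\<dots> = 2 * pi * (e / 4)" using measure_circ by simp
  finally have "mean_sq (\<lambda>t. F n (cis t) - h t) \<le> e / 4"
    unfolding mean_sq_def by (simp add: field_simps)
  moreover have "mean_sq (\<lambda>t. g t - h t) \<le> 2 * mean_sq (\<lambda>t. g t - F n (cis t)) + 2 * mean_sq (\<lambda>t. F n (cis t) - h t)"
    using mean_sq_add_le[OF ess_bounded_diff[OF g bF[of n]] bFh] by simp
  ultimately have "mean_sq (\<lambda>t. g t - h t) < e" using n by linarith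
  with th show ?thesis by (rule that)
qed

section \<open>Truncated Toeplitz matrices\<close>

definition toeplitz :: "(real \<Rightarrow> complex) \<Rightarrow> nat \<Rightarrow> nat \<Rightarrow> complex" where
  "toeplitz f i j = fourier f (int i - int j)"

definition frob_sq :: "nat \<Rightarrow> (nat \<Rightarrow> nat \<Rightarrow> complex) \<Rightarrow> real" where
  "frob_sq n X = (\<Sum>i<n. \<Sum>j<n. (cmod (X i j))\<^sup>2)"

text \<open>The error is o(n) in squared Hilbert-Schmidt norm: weak enough to allow mean-square
  approximation of the symbol, strong enough to fix the limit of normalised traces.\<close>

definition toeplitz_asym :: "(nat \<Rightarrow> nat \<Rightarrow> nat \<Rightarrow> complex) \<Rightarrow> (real \<Rightarrow> complex) \<Rightarrow> bool" where
  "toeplitz_asym X f \<longleftrightarrow> (\<lambda>n. frob_sq n (\<lambda>i j. X n i j - toeplitz f i j) / real n) \<longlonglongrightarrow> 0"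

lemma frob_sq_nonneg: "frob_sq n X \<ge> 0"
  unfolding frob_sq_def by (intro sum_nonneg) auto

lemma frob_sq_cong: "(\<And>i j. i < n \<Longrightarrow> j < n \<Longrightarrow> X i j = Y i j) \<Longrightarrow> frob_sq n X = frob_sq n Y"
  unfolding frob_sq_def by simp

lemma frob_sq_add_le: "frob_sq n (\<lambda>i j. X i j + Y i j) \<le> 2 * frob_sq n X + 2 * frob_sq n Y"
proof -
  have "(cmod (a + b))\<^sup>2 \<le> 2 * (cmod a)\<^sup>2 + 2 * (cmod b)\<^sup>2" for a b
  proof -
    have "(cmod (a + b))\<^sup>2 \<le> (cmod a + cmod b)\<^sup>2"
      by (rule power_mono[OF norm_triangle_ineq]) simp
    then show ?thesis
      using sum_squares_bound[of "cmod a" "cmod b"] by (simp add: power2_sum)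
  qed
  then have "frob_sq n (\<lambda>i j. X i j + Y i j) \<le> (\<Sum>i<n. \<Sum>j<n. 2 * (cmod (X i j))\<^sup>2 + 2 * (cmod (Y i j))\<^sup>2)"
    unfolding frob_sq_def by (intro sum_mono)
  then show ?thesis by (simp add: frob_sq_def sum.distrib sum_distrib_left)
qed

lemma frob_sq_cmult: "frob_sq n (\<lambda>i j. c * X i j) = (cmod c)\<^sup>2 * frob_sq n X"
  unfolding frob_sq_def by (simp add: norm_mult power_mult_distrib sum_distrib_left)

lemma frob_sq_swap: "frob_sq n X = (\<Sum>j<n. \<Sum>i<n. (cmod (X i j))\<^sup>2)"
  unfolding frob_sq_def by (rule sum.swap)

lemma toeplitz_row: "ess_bounded f \<Longrightarrow> (\<Sum>j<n. (cmod (toeplitz f i j))\<^sup>2) \<le> mean_sq f"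
  unfolding toeplitz_def by (rule bessel_reindex) (auto simp: inj_on_def)

lemma toeplitz_col: "ess_bounded f \<Longrightarrow> (\<Sum>i<n. (cmod (toeplitz f i j))\<^sup>2) \<le> mean_sq f"
  unfolding toeplitz_def by (rule bessel_reindex) (auto simp: inj_on_def)

lemma frob_sq_toeplitz: "ess_bounded f \<Longrightarrow> frob_sq n (toeplitz f) \<le> real n * mean_sq f"
  unfolding frob_sq_def using sum_mono[of "{..<n}" "\<lambda>i. \<Sum>j<n. (cmod (toeplitz f i j))\<^sup>2" "\<lambda>i. mean_sq f"]
  by (simp add: toeplitz_row)

text \<open>This replaces a bound on the operator norm of a truncated Toeplitz matrix: each row of
  \<open>X\<close> is treated by \<open>fourier_matrix_bound\<close>. The mirror image below works
  column by column.\<close>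

lemma frob_sq_fmat_mult_toeplitz_right:
  assumes g: "ess_bounded g" "AE t in circ. cmod (g t) \<le> C"
  shows "frob_sq n (fmat_mult n X (toeplitz g)) \<le> C\<^sup>2 * frob_sq n X"
  unfolding frob_sq_def sum_distrib_left
proof (rule sum_mono, simp only: sum_distrib_left[symmetric])
  fix i
  show "(\<Sum>j<n. (cmod (fmat_mult n X (toeplitz g) i j))\<^sup>2) \<le> C\<^sup>2 * (\<Sum>j<n. (cmod (X i j))\<^sup>2)"
    using fourier_matrix_bound[OF g, of "\<lambda>j. - int j" n "\<lambda>i. int i" "X i"]
    by (simp add: fmat_mult_def toeplitz_def inj_on_def)
qed

lemma frob_sq_fmat_mult_toeplitz_left:
  assumes g: "ess_bounded g" "AE t in circ. cmod (g t) \<le> C"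
  shows "frob_sq n (fmat_mult n (toeplitz g) X) \<le> C\<^sup>2 * frob_sq n X"
  unfolding frob_sq_swap sum_distrib_left
proof (rule sum_mono, simp only: sum_distrib_left[symmetric])
  fix j
  show "(\<Sum>i<n. (cmod (fmat_mult n (toeplitz g) X i j))\<^sup>2) \<le> C\<^sup>2 * (\<Sum>i<n. (cmod (X i j))\<^sup>2)"
    using fourier_matrix_bound[OF g, of "\<lambda>i. int i" n "\<lambda>j. - int j" "\<lambda>i. X i j"]
    by (simp add: fmat_mult_def toeplitz_def inj_on_def mult.commute)
qed

section \<open>Asymptotic multiplicativity\<close>

lemma toeplitz_add: "ess_bounded f \<Longrightarrow> ess_bounded g \<Longrightarrow> toeplitz (\<lambda>t. f t + g t) i j = toeplitz f i j + toeplitz g i j"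
  unfolding toeplitz_def by (rule fourier_add)

lemma toeplitz_diff: "ess_bounded f \<Longrightarrow> ess_bounded g \<Longrightarrow> toeplitz (\<lambda>t. f t - g t) i j = toeplitz f i j - toeplitz g i j"
  unfolding toeplitz_def by (rule fourier_diff)

lemma toeplitz_cmult: "toeplitz (\<lambda>t. c * f t) i j = c * toeplitz f i j"
  unfolding toeplitz_def by (rule fourier_cmult)

lemma fmat_mult_diff_left: "fmat_mult n (\<lambda>i j. Y i j - Z i j) X i j = fmat_mult n Y X i j - fmat_mult n Z X i j"
  by (simp add: fmat_mult_def left_diff_distrib sum_subtractf)

text \<open>The Toeplitz matrix of a character is a shift: column \<open>j\<close> of the product is
  column \<open>j + k\<close> of \<open>toeplitz f\<close>, which is the desired column whenever
  \<open>j + k\<close> lies in range. At most |k| columns are cut off, and each costs at most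
  \<open>mean_sq f\<close> by Bessel.\<close>

lemma toeplitz_commutator_character:
  assumes f: "ess_bounded f"
  shows "frob_sq n (\<lambda>i j. fmat_mult n (toeplitz f) (toeplitz (character k)) i j - toeplitz (\<lambda>t. f t * character k t) i j)
    \<le> real (nat \<bar>k\<bar>) * mean_sq f"
proof -
  define bad where "bad = {j\<in>{..<n}. \<not> (0 \<le> int j + k \<and> int j + k < int n)}"
  have entry: "fmat_mult n (toeplitz f) (toeplitz (character k)) i j - toeplitz (\<lambda>t. f t * character k t) i j
      = (if j \<in> bad then - toeplitz (\<lambda>t. f t * character k t) i j else 0)" if "j < n" for i j
  proof (cases "j \<in> bad")
    case True
    have "fmat_mult n (toeplitz f) (toeplitz (character k)) i j = 0"
      unfolding fmat_mult_def by (rule sum.neutral) (use True in \<open>auto simp: bad_def toeplitz_def fourier_character\<close>)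
    then show ?thesis using True by simp
  next
    case False
    then have r: "0 \<le> int j + k" "int j + k < int n" using that by (auto simp: bad_def)
    define l where "l = nat (int j + k)"
    have l: "l < n" "int l = int j + k" using r by (auto simp: l_def)
    have "fmat_mult n (toeplitz f) (toeplitz (character k)) i j = (\<Sum>m<n. if m = l then toeplitz f i l else 0)"
      unfolding fmat_mult_def by (rule sum.cong) (use l in \<open>auto simp: toeplitz_def fourier_character\<close>)
    also have "\<dots> = toeplitz f i l" using l by simp
    also have "\<dots> = toeplitz (\<lambda>t. f t * character k t) i j"
      unfolding toeplitz_def fourier_mult_character using l by (simp add: algebra_simps)
    finally show ?thesis using False by simp
  qed
  have card: "card bad \<le> nat \<bar>k\<bar>"
  proof (cases "k \<ge> 0")
    case True
    then have "bad \<subseteq> {n - nat k..<n}" unfolding bad_def by auto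
    then have "card bad \<le> card {n - nat k..<n}" by (intro card_mono) auto
    then show ?thesis using True by simp
  next
    case False
    then have "bad \<subseteq> {..<nat (- k)}" unfolding bad_def by auto
    then have "card bad \<le> card {..<nat (- k)}" by (intro card_mono) auto
    then show ?thesis using False by simp
  qed
  have "frob_sq n (\<lambda>i j. fmat_mult n (toeplitz f) (toeplitz (character k)) i j - toeplitz (\<lambda>t. f t * character k t) i j)
      = frob_sq n (\<lambda>i j. if j \<in> bad then - toeplitz (\<lambda>t. f t * character k t) i j else 0)"
    by (rule frob_sq_cong) (rule entry)
  also have "\<dots> = (\<Sum>j<n. if j \<in> bad then \<Sum>i<n. (cmod (toeplitz (\<lambda>t. f t * character k t) i j))\<^sup>2 else 0)"
    unfolding frob_sq_swap by (rule sum.cong) auto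
  also have "\<dots> \<le> (\<Sum>j<n. if j \<in> bad then mean_sq (\<lambda>t. f t * character k t) else 0)"
    by (intro sum_mono) (auto intro!: toeplitz_col ess_bounded_mult f)
  also have "\<dots> = real (card bad) * mean_sq (\<lambda>t. f t * character k t)"
  proof -
    have "{..<n} \<inter> bad = bad" by (auto simp: bad_def)
    then show ?thesis by (simp add: sum.If_cases)
  qed
  also have "mean_sq (\<lambda>t. f t * character k t) = mean_sq f" by (simp add: mean_sq_def norm_mult)
  also have "real (card bad) * mean_sq f \<le> real (nat \<bar>k\<bar>) * mean_sq f"
    using card mean_sq_nonneg by (intro mult_right_mono) auto
  finally show ?thesis .
qed

text \<open>\<open>K\<close> is chosen before \<open>n\<close>. A uniform bound is stable under sums
  and scalar multiples, which is why the inductive definition of \<open>trig_poly\<close> has just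
  these rules; closure under products is derived instead.\<close>

lemma toeplitz_commutator_trig_poly:
  assumes "trig_poly h" and f: "ess_bounded f"
  shows "\<exists>K. \<forall>n. frob_sq n (\<lambda>i j. fmat_mult n (toeplitz f) (toeplitz h) i j - toeplitz (\<lambda>t. f t * h t) i j) \<le> K"
  using assms(1)
proof (induction rule: trig_poly.induct)
  case (trig_poly_character n) then show ?case using toeplitz_commutator_character[OF f] by blast
next
  case (trig_poly_add g h)
  note b = trig_poly_ess_bounded[OF trig_poly_add.hyps(1)] trig_poly_ess_bounded[OF trig_poly_add.hyps(2)]
  from trig_poly_add.IH obtain K L where
    K: "\<And>n. frob_sq n (\<lambda>i j. fmat_mult n (toeplitz f) (toeplitz g) i j - toeplitz (\<lambda>t. f t * g t) i j) \<le> K" and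
    L: "\<And>n. frob_sq n (\<lambda>i j. fmat_mult n (toeplitz f) (toeplitz h) i j - toeplitz (\<lambda>t. f t * h t) i j) \<le> L" by blast
  have "frob_sq n (\<lambda>i j. fmat_mult n (toeplitz f) (toeplitz (\<lambda>t. g t + h t)) i j - toeplitz (\<lambda>t. f t * (g t + h t)) i j)
    \<le> 2 * K + 2 * L" for n
  proof -
    have "fmat_mult n (toeplitz f) (toeplitz (\<lambda>t. g t + h t)) i j - toeplitz (\<lambda>t. f t * (g t + h t)) i j
      = (fmat_mult n (toeplitz f) (toeplitz g) i j - toeplitz (\<lambda>t. f t * g t) i j)
        + (fmat_mult n (toeplitz f) (toeplitz h) i j - toeplitz (\<lambda>t. f t * h t) i j)" for i j
      using toeplitz_add[OF ess_bounded_mult[OF f b(1)] ess_bounded_mult[OF f b(2)]] toeplitz_add[OF b]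
      by (simp add: fmat_mult_def ring_distribs sum.distrib)
    then show ?thesis
      using frob_sq_add_le[of n "\<lambda>i j. fmat_mult n (toeplitz f) (toeplitz g) i j - toeplitz (\<lambda>t. f t * g t) i j"
          "\<lambda>i j. fmat_mult n (toeplitz f) (toeplitz h) i j - toeplitz (\<lambda>t. f t * h t) i j"] K[of n] L[of n] by simp
  qed
  then show ?case by blast
next
  case (trig_poly_cmult h c)
  then obtain L where
    L: "\<And>n. frob_sq n (\<lambda>i j. fmat_mult n (toeplitz f) (toeplitz h) i j - toeplitz (\<lambda>t. f t * h t) i j) \<le> L" by blast
  have "frob_sq n (\<lambda>i j. fmat_mult n (toeplitz f) (toeplitz (\<lambda>t. c * h t)) i j - toeplitz (\<lambda>t. f t * (c * h t)) i j)
    \<le> (cmod c)\<^sup>2 * L" for n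
  proof -
    have "fmat_mult n (toeplitz f) (toeplitz (\<lambda>t. c * h t)) i j - toeplitz (\<lambda>t. f t * (c * h t)) i j
      = c * (fmat_mult n (toeplitz f) (toeplitz h) i j - toeplitz (\<lambda>t. f t * h t) i j)" for i j
      using toeplitz_cmult[of c "\<lambda>t. f t * h t"] toeplitz_cmult[of c h]
      by (simp add: fmat_mult_def right_diff_distrib sum_distrib_left mult_ac)
    then show ?thesis using L[of n] by (simp add: frob_sq_cmult mult_left_mono)
  qed
  then show ?case by blast
qed

lemma toeplitz_asym_self: "toeplitz_asym (\<lambda>n. toeplitz f) f"
  by (simp add: toeplitz_asym_def frob_sq_def)

text \<open>With a trigonometric polynomial \<open>h\<close> close to \<open>g\<close>, the defect
  splits into that of \<open>f\<close> and \<open>h\<close>, which is bounded in \<open>n\<close>,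
  and the two terms T_n(f) T_n(g - h) and T_n(f (g - h)), each at most
  \<open>C\<^sup>2 * n * mean_sq (g - h)\<close>.\<close>

lemma toeplitz_asym_toeplitz_mult:
  assumes f: "ess_bounded f" and g: "ess_bounded g"
  shows "toeplitz_asym (\<lambda>n. fmat_mult n (toeplitz f) (toeplitz g)) (\<lambda>t. f t * g t)"
  unfolding toeplitz_asym_def
proof (rule LIMSEQ_I)
  fix r :: real assume r: "r > 0"
  obtain C where C: "AE t in circ. cmod (f t) \<le> C" "C > 0" using ess_boundedE[OF f] .
  \<comment> \<open>Two uses of \<open>frob_sq_add_le\<close> give the error terms total weight 8,
    hence 2/3 of \<open>r * n\<close>; the choice of \<open>n0\<close> leaves at most 1/6 for the
    term \<open>2 * K\<close>.\<close>
  define e where "e = r / (12 * C\<^sup>2)"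
  have e: "e > 0" using r C by (simp add: e_def)
  obtain h where h: "trig_poly h" "mean_sq (\<lambda>t. g t - h t) < e" using trig_poly_dense[OF g e] .
  note bh = trig_poly_ess_bounded[OF h(1)]
  note bgh = ess_bounded_diff[OF g bh]
  obtain K where K: "\<And>n. frob_sq n (\<lambda>i j. fmat_mult n (toeplitz f) (toeplitz h) i j - toeplitz (\<lambda>t. f t * h t) i j) \<le> K"
    using toeplitz_commutator_trig_poly[OF h(1) f] by blast
  have K0: "K \<ge> 0" using K[of 0] by (simp add: frob_sq_def)
  obtain n0 where n0: "real n0 > 12 * K / r" using reals_Archimedean2 by blast
  show "\<exists>n0. \<forall>n\<ge>n0. norm (frob_sq n (\<lambda>i j. fmat_mult n (toeplitz f) (toeplitz g) i j - toeplitz (\<lambda>t. f t * g t) i j) / real n - 0) < r"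
  proof (intro exI[of _ "Suc n0"] allI impI)
    fix n assume n: "n \<ge> Suc n0"
    define A where "A = fmat_mult n (toeplitz f) (toeplitz (\<lambda>t. g t - h t))"
    define B where "B = (\<lambda>i j. fmat_mult n (toeplitz f) (toeplitz h) i j - toeplitz (\<lambda>t. f t * h t) i j)"
    define D where "D = toeplitz (\<lambda>t. f t * (g t - h t))"
    have eq: "fmat_mult n (toeplitz f) (toeplitz g) i j - toeplitz (\<lambda>t. f t * g t) i j = (A i j + (-1) * D i j) + B i j" for i j
      using toeplitz_diff[OF g bh] toeplitz_diff[OF ess_bounded_mult[OF f g] ess_bounded_mult[OF f bh]]
      by (simp add: A_def B_def D_def fmat_mult_def right_diff_distrib sum_subtractf)
    have "frob_sq n A \<le> C\<^sup>2 * frob_sq n (toeplitz (\<lambda>t. g t - h t))"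
      unfolding A_def by (rule frob_sq_fmat_mult_toeplitz_left[OF f C(1)])
    also have "\<dots> \<le> C\<^sup>2 * (real n * mean_sq (\<lambda>t. g t - h t))"
      by (intro mult_left_mono frob_sq_toeplitz bgh) simp
    finally have hA: "frob_sq n A \<le> C\<^sup>2 * (real n * mean_sq (\<lambda>t. g t - h t))" .
    have "frob_sq n D \<le> real n * mean_sq (\<lambda>t. f t * (g t - h t))"
      unfolding D_def by (intro frob_sq_toeplitz ess_bounded_mult f bgh)
    also have "\<dots> \<le> real n * (C\<^sup>2 * mean_sq (\<lambda>t. g t - h t))"
      by (intro mult_left_mono mean_sq_mult_le f bgh C) simp
    finally have hD: "frob_sq n D \<le> C\<^sup>2 * (real n * mean_sq (\<lambda>t. g t - h t))" by (simp add: mult_ac)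
    have "frob_sq n (\<lambda>i j. fmat_mult n (toeplitz f) (toeplitz g) i j - toeplitz (\<lambda>t. f t * g t) i j)
        \<le> 2 * frob_sq n (\<lambda>i j. A i j + (-1) * D i j) + 2 * frob_sq n B"
      unfolding eq by (rule frob_sq_add_le)
    also have "frob_sq n (\<lambda>i j. A i j + (-1) * D i j) \<le> 2 * frob_sq n A + 2 * frob_sq n D"
      using frob_sq_add_le[of n A "\<lambda>i j. (-1) * D i j"] by (simp only: frob_sq_cmult) simp
    finally have "frob_sq n (\<lambda>i j. fmat_mult n (toeplitz f) (toeplitz g) i j - toeplitz (\<lambda>t. f t * g t) i j)
        \<le> 2 * (2 * frob_sq n A + 2 * frob_sq n D) + 2 * frob_sq n B" by simp
    then have "frob_sq n (\<lambda>i j. fmat_mult n (toeplitz f) (toeplitz g) i j - toeplitz (\<lambda>t. f t * g t) i j)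
        \<le> 8 * (C\<^sup>2 * (real n * mean_sq (\<lambda>t. g t - h t))) + 2 * K"
    proof -
      assume "frob_sq n (\<lambda>i j. fmat_mult n (toeplitz f) (toeplitz g) i j - toeplitz (\<lambda>t. f t * g t) i j)
        \<le> 2 * (2 * frob_sq n A + 2 * frob_sq n D) + 2 * frob_sq n B"
      also have "\<dots> \<le> 2 * (2 * (C\<^sup>2 * (real n * mean_sq (\<lambda>t. g t - h t)))
          + 2 * (C\<^sup>2 * (real n * mean_sq (\<lambda>t. g t - h t)))) + 2 * K"
        using K[of n] unfolding B_def[symmetric] by (intro add_mono mult_left_mono hA hD) auto
      finally show ?thesis by (simp add: mult_ac)
    qed
    also have "\<dots> \<le> 8 * (C\<^sup>2 * (real n * e)) + 2 * K"
      using h(2) by (intro add_mono mult_left_mono) auto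
    also have "\<dots> = real n * (2 / 3 * r) + 2 * K" using C by (simp add: e_def field_simps)
    finally have "frob_sq n (\<lambda>i j. fmat_mult n (toeplitz f) (toeplitz g) i j - toeplitz (\<lambda>t. f t * g t) i j)
        \<le> real n * (2 / 3 * r) + 2 * K" .
    moreover have "2 * K \<le> real n * r / 6"
    proof -
      have "real n > 12 * K / r" using n n0 by linarith
      then show ?thesis using r by (simp add: divide_less_eq)
    qed
    moreover have "0 < real n * r" using n r by simp
    ultimately have "frob_sq n (\<lambda>i j. fmat_mult n (toeplitz f) (toeplitz g) i j - toeplitz (\<lambda>t. f t * g t) i j) < r * real n"
      by (simp add: algebra_simps)
    then show "norm (frob_sq n (\<lambda>i j. fmat_mult n (toeplitz f) (toeplitz g) i j - toeplitz (\<lambda>t. f t * g t) i j) / real n - 0) < r"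
      using n frob_sq_nonneg by (simp add: divide_less_eq)
  qed
qed

lemma toeplitz_asym_add:
  assumes "toeplitz_asym X f" "toeplitz_asym Y g" "ess_bounded f" "ess_bounded g"
  shows "toeplitz_asym (\<lambda>n i j. X n i j + Y n i j) (\<lambda>t. f t + g t)"
  unfolding toeplitz_asym_def
proof (rule tendsto_sandwich[OF _ _ tendsto_const])
  have "(\<lambda>n. 2 * (frob_sq n (\<lambda>i j. X n i j - toeplitz f i j) / real n)
      + 2 * (frob_sq n (\<lambda>i j. Y n i j - toeplitz g i j) / real n)) \<longlonglongrightarrow> 2 * 0 + 2 * 0"
    using assms(1,2) unfolding toeplitz_asym_def by (intro tendsto_intros)
  then show "(\<lambda>n. 2 * (frob_sq n (\<lambda>i j. X n i j - toeplitz f i j) / real n)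
      + 2 * (frob_sq n (\<lambda>i j. Y n i j - toeplitz g i j) / real n)) \<longlonglongrightarrow> 0" by simp
  show "\<forall>\<^sub>F n in sequentially. frob_sq n (\<lambda>i j. X n i j + Y n i j - toeplitz (\<lambda>t. f t + g t) i j) / real n
      \<le> 2 * (frob_sq n (\<lambda>i j. X n i j - toeplitz f i j) / real n) + 2 * (frob_sq n (\<lambda>i j. Y n i j - toeplitz g i j) / real n)"
  proof (rule always_eventually, rule allI)
    fix n
    have "frob_sq n (\<lambda>i j. X n i j + Y n i j - toeplitz (\<lambda>t. f t + g t) i j)
        = frob_sq n (\<lambda>i j. (X n i j - toeplitz f i j) + (Y n i j - toeplitz g i j))"
      by (simp add: toeplitz_add assms algebra_simps)
    also have "\<dots> \<le> 2 * frob_sq n (\<lambda>i j. X n i j - toeplitz f i j) + 2 * frob_sq n (\<lambda>i j. Y n i j - toeplitz g i j)"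
      by (rule frob_sq_add_le)
    finally show "frob_sq n (\<lambda>i j. X n i j + Y n i j - toeplitz (\<lambda>t. f t + g t) i j) / real n
      \<le> 2 * (frob_sq n (\<lambda>i j. X n i j - toeplitz f i j) / real n) + 2 * (frob_sq n (\<lambda>i j. Y n i j - toeplitz g i j) / real n)"
      by (simp add: add_divide_distrib[symmetric] divide_right_mono)
  qed
qed (auto simp: frob_sq_nonneg)

lemma toeplitz_asym_cmult:
  assumes "toeplitz_asym X f"
  shows "toeplitz_asym (\<lambda>n i j. c * X n i j) (\<lambda>t. c * f t)"
proof -
  have "frob_sq n (\<lambda>i j. c * X n i j - toeplitz (\<lambda>t. c * f t) i j) = (cmod c)\<^sup>2 * frob_sq n (\<lambda>i j. X n i j - toeplitz f i j)" for n
    unfolding toeplitz_cmult right_diff_distrib[symmetric] frob_sq_cmult ..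
  then show ?thesis
    using tendsto_mult_right_zero[OF assms[unfolded toeplitz_asym_def], of "(cmod c)\<^sup>2"]
    by (simp add: toeplitz_asym_def)
qed

lemma toeplitz_asym_sum:
  assumes "\<And>q. q \<in> I \<Longrightarrow> toeplitz_asym (X q) (f q)" "\<And>q. q \<in> I \<Longrightarrow> ess_bounded (f q)"
  shows "toeplitz_asym (\<lambda>n i j. \<Sum>q\<in>I. X q n i j) (\<lambda>t. \<Sum>q\<in>I. f q t)"
  using assms
proof (induction I rule: infinite_finite_induct)
  case (insert q I)
  have "toeplitz_asym (\<lambda>n i j. X q n i j + (\<Sum>p\<in>I. X p n i j)) (\<lambda>t. f q t + (\<Sum>p\<in>I. f p t))"
    by (rule toeplitz_asym_add) (use insert in \<open>auto intro!: ess_bounded_sum\<close>)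
  then show ?case using insert.hyps by simp
qed (use toeplitz_asym_cmult[OF toeplitz_asym_self, of 0 "\<lambda>t. 0"] in auto)

text \<open>Only the right factor has to be a Toeplitz matrix. The difference of \<open>X n\<close>
  and T_n(f) is enlarged by at most \<open>C\<^sup>2\<close>, so no norm bound on \<open>X n\<close>
  enters, and products of any length are built by repeated multiplication on the right.\<close>

lemma toeplitz_asym_mult:
  assumes X: "toeplitz_asym X f" and f: "ess_bounded f" and g: "ess_bounded g"
  shows "toeplitz_asym (\<lambda>n. fmat_mult n (X n) (toeplitz g)) (\<lambda>t. f t * g t)"
proof -
  obtain C where C: "AE t in circ. cmod (g t) \<le> C" "C > 0" using ess_boundedE[OF g] .
  define E where "E n = frob_sq n (\<lambda>i j. X n i j - toeplitz f i j) / real n" for n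
  define D where "D n = frob_sq n (\<lambda>i j. fmat_mult n (toeplitz f) (toeplitz g) i j - toeplitz (\<lambda>t. f t * g t) i j) / real n" for n
  show ?thesis
    unfolding toeplitz_asym_def
  proof (rule tendsto_sandwich[OF _ _ tendsto_const])
    have "(\<lambda>n. 2 * (C\<^sup>2 * E n) + 2 * D n) \<longlonglongrightarrow> 2 * (C\<^sup>2 * 0) + 2 * 0"
      using X toeplitz_asym_toeplitz_mult[OF f g] unfolding toeplitz_asym_def E_def D_def by (intro tendsto_intros)
    then show "(\<lambda>n. 2 * (C\<^sup>2 * E n) + 2 * D n) \<longlonglongrightarrow> 0" by simp
    show "\<forall>\<^sub>F n in sequentially. frob_sq n (\<lambda>i j. fmat_mult n (X n) (toeplitz g) i j - toeplitz (\<lambda>t. f t * g t) i j) / real n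
        \<le> 2 * (C\<^sup>2 * E n) + 2 * D n"
    proof (rule always_eventually, rule allI)
      fix n
      have "frob_sq n (\<lambda>i j. fmat_mult n (X n) (toeplitz g) i j - toeplitz (\<lambda>t. f t * g t) i j)
          = frob_sq n (\<lambda>i j. fmat_mult n (\<lambda>i j. X n i j - toeplitz f i j) (toeplitz g) i j
              + (fmat_mult n (toeplitz f) (toeplitz g) i j - toeplitz (\<lambda>t. f t * g t) i j))"
        by (simp add: fmat_mult_diff_left)
      also have "\<dots> \<le> 2 * frob_sq n (fmat_mult n (\<lambda>i j. X n i j - toeplitz f i j) (toeplitz g))
              + 2 * frob_sq n (\<lambda>i j. fmat_mult n (toeplitz f) (toeplitz g) i j - toeplitz (\<lambda>t. f t * g t) i j)"
        by (rule frob_sq_add_le)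
      also have "\<dots> \<le> 2 * (C\<^sup>2 * frob_sq n (\<lambda>i j. X n i j - toeplitz f i j))
              + 2 * frob_sq n (\<lambda>i j. fmat_mult n (toeplitz f) (toeplitz g) i j - toeplitz (\<lambda>t. f t * g t) i j)"
        using frob_sq_fmat_mult_toeplitz_right[OF g C(1)] by simp
      finally show "frob_sq n (\<lambda>i j. fmat_mult n (X n) (toeplitz g) i j - toeplitz (\<lambda>t. f t * g t) i j) / real n
        \<le> 2 * (C\<^sup>2 * E n) + 2 * D n"
        unfolding E_def D_def by (simp add: add_divide_distrib[symmetric] divide_right_mono)
    qed
  qed (auto simp: frob_sq_nonneg)
qed

text \<open>Every diagonal entry of T_n(f) is the mean of \<open>f\<close>. By Cauchy-Schwarz the
  trace of the remainder is at most sqrt n times its Hilbert-Schmidt norm, which is o(n).\<close>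

lemma toeplitz_asym_trace:
  assumes X: "toeplitz_asym X f"
  shows "(\<lambda>n. (\<Sum>i<n. X n i i) / of_nat n) \<longlonglongrightarrow> mean f"
proof (rule LIM_zero_cancel, rule Lim_null_comparison)
  define E where "E n = frob_sq n (\<lambda>i j. X n i j - toeplitz f i j) / real n" for n
  have "E \<longlonglongrightarrow> 0" using X unfolding toeplitz_asym_def E_def .
  then have "(\<lambda>n. sqrt (E n)) \<longlonglongrightarrow> sqrt 0" by (intro tendsto_intros)
  then show "(\<lambda>n. sqrt (E n)) \<longlonglongrightarrow> 0" by simp
  show "\<forall>\<^sub>F n in sequentially. norm ((\<Sum>i<n. X n i i) / of_nat n - mean f) \<le> sqrt (E n)"
    using eventually_gt_at_top[of 0]
  proof eventually_elim
    fix n :: nat assume n: "n > 0"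
    have a: "mean f = toeplitz f i i" for i by (simp add: toeplitz_def fourier_def)
    have "(\<Sum>i<n. X n i i) / of_nat n - mean f = (\<Sum>i<n. X n i i - toeplitz f i i) / of_nat n"
      using n by (simp add: sum_subtractf a[symmetric] diff_divide_distrib)
    moreover have "norm (\<Sum>i<n. X n i i - toeplitz f i i) \<le> (\<Sum>i<n. 1 * cmod (X n i i - toeplitz f i i))"
      using norm_sum by simp
    moreover have "(\<Sum>i<n. 1 * cmod (X n i i - toeplitz f i i))\<^sup>2
        \<le> (\<Sum>i<n. 1\<^sup>2) * (\<Sum>i<n. (cmod (X n i i - toeplitz f i i))\<^sup>2)"
      by (rule Cauchy_Schwarz_ineq_sum)
    moreover have "(\<Sum>i<n. (cmod (X n i i - toeplitz f i i))\<^sup>2) \<le> frob_sq n (\<lambda>i j. X n i j - toeplitz f i j)"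
      unfolding frob_sq_def
    proof (rule sum_mono)
      fix i assume "i \<in> {..<n}"
      then show "(cmod (X n i i - toeplitz f i i))\<^sup>2 \<le> (\<Sum>j<n. (cmod (X n i j - toeplitz f i j))\<^sup>2)"
        by (intro member_le_sum) auto
    qed
    ultimately have "(norm ((\<Sum>i<n. X n i i) / of_nat n - mean f))\<^sup>2 \<le> E n"
    proof -
      assume eq: "(\<Sum>i<n. X n i i) / of_nat n - mean f = (\<Sum>i<n. X n i i - toeplitz f i i) / of_nat n"
        and 1: "norm (\<Sum>i<n. X n i i - toeplitz f i i) \<le> (\<Sum>i<n. 1 * cmod (X n i i - toeplitz f i i))"
        and 2: "(\<Sum>i<n. 1 * cmod (X n i i - toeplitz f i i))\<^sup>2
            \<le> (\<Sum>i<n. 1\<^sup>2) * (\<Sum>i<n. (cmod (X n i i - toeplitz f i i))\<^sup>2)"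
        and 3: "(\<Sum>i<n. (cmod (X n i i - toeplitz f i i))\<^sup>2) \<le> frob_sq n (\<lambda>i j. X n i j - toeplitz f i j)"
      have "(norm (\<Sum>i<n. X n i i - toeplitz f i i))\<^sup>2 \<le> (\<Sum>i<n. 1 * cmod (X n i i - toeplitz f i i))\<^sup>2"
        by (intro power_mono 1) simp
      also note 2
      also have "(\<Sum>i<n. 1\<^sup>2) * (\<Sum>i<n. (cmod (X n i i - toeplitz f i i))\<^sup>2)
          \<le> real n * frob_sq n (\<lambda>i j. X n i j - toeplitz f i j)"
        using 3 by (simp add: mult_left_mono)
      finally have "(norm (\<Sum>i<n. X n i i - toeplitz f i i))\<^sup>2 / (real n)\<^sup>2
          \<le> real n * frob_sq n (\<lambda>i j. X n i j - toeplitz f i j) / (real n)\<^sup>2"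
        by (rule divide_right_mono) simp
      then show ?thesis
        unfolding eq E_def using n by (simp add: norm_divide power_divide power2_eq_square)
    qed
    then show "norm ((\<Sum>i<n. X n i i) / of_nat n - mean f) \<le> sqrt (E n)"
      by (simp add: real_le_rsqrt)
  qed
qed

text \<open>All truncations of \<open>f\<close> vanish, so the normalised traces of T_n(f) T_n(cnj
  f) are 0; their limit is the mean of |f|^2.\<close>

lemma fourier_zero_imp_AE_zero:
  assumes f: "ess_bounded f" and z: "\<And>n. fourier f n = 0"
  shows "AE t in circ. f t = 0"
proof -
  have "toeplitz_asym (\<lambda>n. fmat_mult n (toeplitz f) (toeplitz (\<lambda>t. cnj (f t)))) (\<lambda>t. f t * cnj (f t))"
    by (intro toeplitz_asym_toeplitz_mult f ess_bounded_cnj)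
  from toeplitz_asym_trace[OF this] have "(\<lambda>n. 0) \<longlonglongrightarrow> mean (\<lambda>t. f t * cnj (f t))"
    by (simp add: fmat_mult_def toeplitz_def z)
  then have "mean (\<lambda>t. f t * cnj (f t)) = 0" using LIMSEQ_unique tendsto_const by metis
  then have "mean_sq f = 0" unfolding of_real_mean_sq[symmetric] by simp
  then have "(LINT t|circ. (cmod (f t))\<^sup>2) = 0" by (simp add: mean_sq_def)
  then have "AE t in circ. (cmod (f t))\<^sup>2 = 0"
    using integral_nonneg_eq_0_iff_AE[OF ess_bounded_integrable_sq[OF f]] by simp
  then show ?thesis by simp
qed

lemma fourier_eq_imp_AE_eq:
  assumes "ess_bounded f" "ess_bounded g" "\<And>n. fourier f n = fourier g n"
  shows "AE t in circ. f t = g t"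
  using fourier_zero_imp_AE_zero[of "\<lambda>t. f t - g t"] assms by (auto simp: fourier_diff)

text \<open>The trace of \<open>T(h) T(g) T(h)\<close>, with \<open>h\<close> the indicator function of \<open>Re g < 0\<close>, is nonnegative.\<close>

lemma toeplitz_nonneg_imp_AE_nonneg:
  assumes g: "ess_bounded g"
    and pos: "\<And>n x. 0 \<le> Re (\<Sum>i<n. \<Sum>j<n. cnj (x i) * toeplitz g i j * x j)"
  shows "AE t in circ. 0 \<le> Re (g t)"
proof -
  define h where "h = (\<lambda>t. if Re (g t) < 0 then 1 else 0 :: complex)"
  have gm: "g \<in> borel_measurable circ" using g by (simp add: ess_bounded_def)
  have h: "ess_bounded h"
    unfolding h_def by (rule ess_boundedI[where C = 1]) (use gm in \<open>auto intro!: measurable_If\<close>)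
  have ch: "cnj (h t) = h t" for t by (simp add: h_def)
  have toeplitz_h: "cnj (toeplitz h i j) = toeplitz h j i" for i j
    using fourier_cnj[of h "int j - int i"] by (simp add: toeplitz_def ch)
  have A: "toeplitz_asym (\<lambda>n. fmat_mult n (fmat_mult n (toeplitz h) (toeplitz g)) (toeplitz h)) (\<lambda>t. h t * g t * h t)"
    by (intro toeplitz_asym_mult toeplitz_asym_toeplitz_mult h g ess_bounded_mult)
  have "Re (\<Sum>i<n. fmat_mult n (fmat_mult n (toeplitz h) (toeplitz g)) (toeplitz h) i i) \<ge> 0" for n
  proof -
    have "fmat_mult n (fmat_mult n (toeplitz h) (toeplitz g)) (toeplitz h) l l
       = (\<Sum>i<n. \<Sum>j<n. cnj (toeplitz h i l) * toeplitz g i j * toeplitz h j l)" for l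
      unfolding fmat_mult_def toeplitz_h sum_distrib_right by (rule sum.swap)
    then have "0 \<le> Re (fmat_mult n (fmat_mult n (toeplitz h) (toeplitz g)) (toeplitz h) l l)" for l
      using pos[where n = n and x = "\<lambda>i. toeplitz h i l"] by simp
    then show ?thesis unfolding Re_sum by (intro sum_nonneg)
  qed
  then have "0 \<le> Re ((\<Sum>i<n. fmat_mult n (fmat_mult n (toeplitz h) (toeplitz g)) (toeplitz h) i i) / of_nat n)" for n
    by (simp add: Re_divide_of_nat)
  with tendsto_Re[OF toeplitz_asym_trace[OF A]] have "0 \<le> Re (mean (\<lambda>t. h t * g t * h t))"
    by (meson LIMSEQ_le_const)
  moreover have b: "ess_bounded (\<lambda>t. h t * g t * h t)" by (intro ess_bounded_mult h g)
  define u where "u t = Re (h t * g t * h t)" for t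
  have "Re (LINT t|circ. h t * g t * h t) = (LINT t|circ. u t)"
    unfolding u_def using integral_Re[OF ess_bounded_integrable[OF b]] by (rule sym)
  ultimately have "0 \<le> (LINT t|circ. u t)"
    using pi_gt_zero by (auto simp: mean_def Re_divide_of_real zero_le_divide_iff)
  have np: "u t \<le> 0" for t by (simp add: u_def h_def)
  have iu: "integrable circ u"
    unfolding u_def by (rule integrable_Re[OF ess_bounded_integrable[OF b]])
  have "(LINT t|circ. - u t) = 0"
    using \<open>0 \<le> (LINT t|circ. u t)\<close> np integral_nonneg_AE[where M = circ and f = "\<lambda>t. - u t"] by simp
  then have "AE t in circ. - u t = 0"
    using integral_nonneg_eq_0_iff_AE[where M = circ and f = "\<lambda>t. - u t"] np iu by simp
  then show ?thesis by eventually_elim (auto simp: u_def h_def split: if_splits)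
qed

section \<open>Williamson's theorem\<close>

definition mode_sign :: "nat \<Rightarrow> 'a::comm_ring_1" where
  "mode_sign p = (if even p then 1 else -1)"

text \<open>Mode r consists of the coordinates 2r and 2r + 1; J exchanges them up to sign.\<close>

definition partner :: "nat \<Rightarrow> nat" where
  "partner p = (if even p then p + 1 else p - 1)"

definition Jf :: "nat \<Rightarrow> nat \<Rightarrow> 'a::comm_ring_1" where
  "Jf p q = (if q = partner p then mode_sign p else 0)"

definition bil :: "nat \<Rightarrow> (nat \<Rightarrow> nat \<Rightarrow> 'a::comm_ring_1) \<Rightarrow> (nat \<Rightarrow> 'a) \<Rightarrow> (nat \<Rightarrow> 'a) \<Rightarrow> 'a" where
  "bil N B u v = (\<Sum>k<N. \<Sum>l<N. u k * B k l * v l)"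

lemma partner_partner [simp]: "partner (partner p) = p"
  by (auto simp: partner_def)

lemma partner_div2 [simp]: "partner p div 2 = p div 2"
  by (auto simp: partner_def elim!: oddE)

lemma partner_less [simp]: "partner p < 2 * m \<longleftrightarrow> p < 2 * m"
  by (metis partner_div2 less_mult_imp_div_less div_less_iff_less_mult mult.commute zero_less_numeral)

lemma mode_sign_partner [simp]: "mode_sign (partner p) = - (mode_sign p)"
  by (auto simp: mode_sign_def partner_def)

lemma mode_sign_sq [simp]: "mode_sign p * mode_sign p = 1"
  by (simp add: mode_sign_def)

lemma partner_neq [simp]: "partner p \<noteq> p" "p \<noteq> partner p"
  by (auto simp: partner_def elim!: oddE)

lemma same_mode: "p div 2 = q div 2 \<longleftrightarrow> q = p \<or> q = partner p"
  by (auto simp: partner_def elim!: oddE evenE)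

lemma partner_eq_iff: "p = partner q \<longleftrightarrow> q = partner p"
  by (metis partner_partner)

lemma sum_modes: "(\<Sum>i<2 * m. h (i div 2)) = 2 * (\<Sum>r<m. h r :: 'a::comm_semiring_1)" for m :: nat
  by (induction m) (auto simp: mult_2 mult_2_right distrib_left ac_simps)

lemma bil_add_left: "bil N B (\<lambda>k. u k + v k) w = bil N B u w + bil N B v w"
  by (simp add: bil_def ring_distribs sum.distrib)

lemma bil_add_right: "bil N B w (\<lambda>k. u k + v k) = bil N B w u + bil N B w v"
  by (simp add: bil_def ring_distribs sum.distrib)

lemma bil_cmult_left: "bil N B (\<lambda>k. c * u k) w = c * bil N B u w"
  by (simp add: bil_def sum_distrib_left mult_ac)

lemma bil_cmult_right: "bil N B w (\<lambda>k. c * u k) = c * bil N B w u"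
  by (simp add: bil_def sum_distrib_left mult_ac)

lemma bil_sum_right: "bil N B w (\<lambda>k. \<Sum>l\<in>I. u l k) = (\<Sum>l\<in>I. bil N B w (u l))"
proof (induction I rule: infinite_finite_induct)
  case (insert x I)
  then show ?case using bil_add_right[of N B w "u x" "\<lambda>k. \<Sum>l\<in>I. u l k"] by simp
qed (simp_all add: bil_def)

lemma bil_cong:
  "(\<And>k. k < N \<Longrightarrow> u k = u' k) \<Longrightarrow> (\<And>k. k < N \<Longrightarrow> v k = v' k) \<Longrightarrow> bil N B u v = bil N B u' v'"
  by (simp add: bil_def)

lemma bil_sym:
  assumes "\<And>k l. k < N \<Longrightarrow> l < N \<Longrightarrow> B k l = B l k"
  shows "bil N B u v = bil N B v u"
proof -
  have "bil N B u v = (\<Sum>l<N. \<Sum>k<N. u k * B k l * v l)" unfolding bil_def by (rule sum.swap)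
  also have "\<dots> = bil N B v u" unfolding bil_def
    by (intro sum.cong) (auto simp: assms mult_ac)
  finally show ?thesis .
qed

lemma bil_J: "bil (2 * m) Jf u v = (\<Sum>k<2 * m. u k * mode_sign k * v (partner k))"
  unfolding bil_def
proof (rule sum.cong)
  fix k assume "k \<in> {..<2 * m}"
  then have "partner k < 2 * m" by simp
  have "(\<Sum>l<2 * m. u k * Jf k l * v l) = (\<Sum>l<2 * m. if l = partner k then u k * mode_sign k * v l else 0)"
    by (rule sum.cong) (auto simp: Jf_def)
  then show "(\<Sum>l<2 * m. u k * Jf k l * v l) = u k * mode_sign k * v (partner k)"
    using \<open>partner k < 2 * m\<close> by simp
qed simp

lemma sum_partner: "(\<Sum>k<2 * m. h (partner k)) = (\<Sum>k<2 * m. h k)"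
  by (rule sum.reindex_bij_witness[of _ partner partner]) auto

lemma bil_J_antisym: "bil (2 * m) Jf u v = - bil (2 * m) Jf v u"
proof -
  have "bil (2 * m) Jf u v = (\<Sum>k<2 * m. u (partner k) * mode_sign (partner k) * v (partner (partner k)))"
    unfolding bil_J by (rule sum_partner[symmetric])
  also have "\<dots> = - bil (2 * m) Jf v u"
    unfolding bil_J sum_negf[symmetric] by (simp add: mult_ac)
  finally show ?thesis .
qed

lemma bil_J_self: "bil (2 * m) Jf u u = (0::real)"
  using bil_J_antisym[of m u u] by simp

section \<open>Minimising a weighted trace over the symplectic group\<close>

lemma compact_Pi_UNIV:
  fixes S :: "'i \<Rightarrow> 'a::topological_space set"
  assumes "\<And>i. compact (S i)"
  shows "compact {x. \<forall>i. x i \<in> S i}"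
proof -
  have "compactin (product_topology (\<lambda>i. euclidean) UNIV) (PiE UNIV S)"
    unfolding compactin_PiE using assms by simp
  moreover have "PiE UNIV S = {x. \<forall>i. x i \<in> S i}" by auto
  ultimately show ?thesis by (simp add: euclidean_product_topology)
qed

lemma bil_coercive:
  fixes B :: "nat \<Rightarrow> nat \<Rightarrow> real"
  assumes N: "N > 0"
    and pd: "\<And>u. (\<exists>k<N. u k \<noteq> 0) \<Longrightarrow> 0 < bil N B u u"
  obtains e where "e > 0" "\<And>u. e * (\<Sum>k<N. (u k)\<^sup>2) \<le> bil N B u u"
proof -
  \<comment> \<open>Vectors are functions on all of \<open>nat\<close>; pinning the coordinates
    beyond \<open>N\<close> to 0 makes the unit sphere compact in the product topology.\<close>
  define S :: "nat \<Rightarrow> real set" where "S = (\<lambda>k. if k < N then {-1..1} else {0})"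
  define K where "K = {u. \<forall>k. u k \<in> S k} \<inter> {u. (\<Sum>k<N. (u k)\<^sup>2) = 1}"
  have "closed {u :: nat \<Rightarrow> real. (\<Sum>k<N. (u k)\<^sup>2) = 1}"
    by (intro closed_Collect_eq continuous_intros continuous_on_product_coordinates)
  moreover have "compact {u. \<forall>k. u k \<in> S k}" by (rule compact_Pi_UNIV) (simp add: S_def)
  ultimately have K: "compact K" unfolding K_def by (intro compact_Int_closed)
  have cont: "continuous_on K (\<lambda>u. bil N B u u)"
    unfolding bil_def
    by (rule continuous_on_subset[OF _ subset_UNIV]) (intro continuous_intros continuous_on_product_coordinates)
  have "(\<lambda>k. if k = 0 then 1 else 0) \<in> K"
  proof -
    have "(\<Sum>k<N. (if k = 0 then 1 else 0 :: real)\<^sup>2) = (\<Sum>k<N. if k = 0 then 1 else 0)"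
      by (rule sum.cong) auto
    then show ?thesis using N by (auto simp: K_def S_def)
  qed
  then have "K \<noteq> {}" by blast
  from continuous_attains_inf[OF K this cont] obtain u0 where
    u0: "u0 \<in> K" "\<And>u. u \<in> K \<Longrightarrow> bil N B u0 u0 \<le> bil N B u u" by blast
  have "\<exists>k<N. u0 k \<noteq> 0"
  proof (rule ccontr)
    assume "\<not> (\<exists>k<N. u0 k \<noteq> 0)"
    then have "(\<Sum>k<N. (u0 k)\<^sup>2) = 0" by simp
    then show False using u0(1) by (simp add: K_def)
  qed
  then have pos: "0 < bil N B u0 u0" by (rule pd)
  show ?thesis
  proof (rule that[OF pos])
    fix u :: "nat \<Rightarrow> real"
    define s where "s = (\<Sum>k<N. (u k)\<^sup>2)"
    have s0: "s \<ge> 0" unfolding s_def by (intro sum_nonneg) auto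
    show "bil N B u0 u0 * (\<Sum>k<N. (u k)\<^sup>2) \<le> bil N B u u"
    proof (cases "s = 0")
      case True
      have "0 \<le> bil N B u u"
      proof (cases "\<exists>k<N. u k \<noteq> 0")
        case True then show ?thesis using pd by (simp add: less_imp_le)
      next
        case False then show ?thesis by (simp add: bil_def)
      qed
      then show ?thesis using True by (simp add: s_def)
    next
      case False
      then have sp: "s > 0" using s0 by simp
      define v where "v = (\<lambda>k. if k < N then 1 / sqrt s * u k else 0)"
      have v1: "(\<Sum>k<N. (v k)\<^sup>2) = 1"
      proof -
        have "(\<Sum>k<N. (v k)\<^sup>2) = (\<Sum>k<N. 1 / s * (u k)\<^sup>2)"
          by (rule sum.cong) (use s0 in \<open>auto simp: v_def power_divide\<close>)
        then show ?thesis using sp by (simp only: sum_distrib_left[symmetric] s_def[symmetric]) simp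
      qed
      have vk: "\<bar>v k\<bar> \<le> 1" if "k < N" for k
      proof -
        have "(v k)\<^sup>2 \<le> (\<Sum>k<N. (v k)\<^sup>2)" using that by (intro member_le_sum) auto
        then show ?thesis using v1 by (simp add: abs_square_le_1)
      qed
      have v0: "v k = 0" if "\<not> k < N" for k using that by (simp add: v_def)
      have "v k \<in> S k" for k
        using vk[of k] v0[of k] by (auto simp: S_def abs_le_iff minus_le_iff)
      then have "v \<in> K" using v1 by (auto simp: K_def)
      then have "bil N B u0 u0 \<le> bil N B v v" by (rule u0(2))
      also have "bil N B v v = bil N B (\<lambda>k. 1 / sqrt s * u k) (\<lambda>k. 1 / sqrt s * u k)"
        by (rule bil_cong) (auto simp: v_def)
      also have "\<dots> = 1 / s * bil N B u u"
        unfolding bil_cmult_left bil_cmult_right using s0 by simp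
      finally show ?thesis using sp unfolding s_def[symmetric] by (simp add: field_simps)
    qed
  qed
qed

text \<open>With the \<open>x i\<close> as rows of M this is M J M^T = J, the transpose of the usual
  condition. Rows are convenient because M B M^T is then the Gram matrix of
  \<open>bil N B\<close>.\<close>

definition symplectic_rows :: "nat \<Rightarrow> (nat \<Rightarrow> nat \<Rightarrow> real) set" where
  "symplectic_rows N = {x. \<forall>i<N. \<forall>j<N. bil N Jf (x i) (x j) = Jf i j}"

definition mode_weight :: "nat \<Rightarrow> nat \<Rightarrow> real" where
  "mode_weight N i = real (N - i div 2)"

text \<open>The weights are constant on modes and strictly decreasing between modes, so that a minimiser of
  this function over the symplectic group diagonalises \<open>B\<close> with increasing diagonal.\<close>

definition wtrace :: "nat \<Rightarrow> (nat \<Rightarrow> nat \<Rightarrow> real) \<Rightarrow> (nat \<Rightarrow> nat \<Rightarrow> real) \<Rightarrow> real" where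
  "wtrace N B x = (\<Sum>i<N. mode_weight N i * bil N B (x i) (x i))"

lemma mode_weight_ge_1: "i < N \<Longrightarrow> mode_weight N i \<ge> 1"
  unfolding mode_weight_def by (cases N) auto

text \<open>The symplectic group is closed but not bounded. Coercivity of \<open>B\<close> and
  weights of at least 1 bound the entries of every element whose weighted trace does not exceed that
  of the identity, so the minimum over a compact box is a minimum over the group.\<close>

lemma wtrace_attains_min:
  fixes B :: "nat \<Rightarrow> nat \<Rightarrow> real"
  assumes N: "N = 2 * m" "N > 0"
    and pd: "\<And>u. (\<exists>k<N. u k \<noteq> 0) \<Longrightarrow> 0 < bil N B u u"
  obtains x where "x \<in> symplectic_rows N" "\<And>y. y \<in> symplectic_rows N \<Longrightarrow> wtrace N B x \<le> wtrace N B y"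
proof -
  obtain e where e: "e > 0" "\<And>u. e * (\<Sum>k<N. (u k)\<^sup>2) \<le> bil N B u u"
    using bil_coercive[OF N(2) pd] by blast
  have nn: "0 \<le> bil N B u u" for u
  proof -
    have "0 \<le> e * (\<Sum>k<N. (u k)\<^sup>2)" using e(1) by (intro mult_nonneg_nonneg sum_nonneg) auto
    then show ?thesis using e(2) order_trans by blast
  qed
  define one :: "nat \<Rightarrow> nat \<Rightarrow> real" where "one = (\<lambda>i j. if i < N \<and> j = i then 1 else 0)"
  define R where "R = sqrt (wtrace N B one / e)"
  define S :: "nat \<Rightarrow> nat \<Rightarrow> real set" where "S = (\<lambda>i j. if i < N \<and> j < N then {-R..R} else {0})"
  define K where "K = {x. \<forall>i. x i \<in> {u. \<forall>j. u j \<in> S i j}} \<inter> symplectic_rows N"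
  have coord: "continuous_on UNIV (\<lambda>x :: nat \<Rightarrow> nat \<Rightarrow> real. x i j)" for i j
    by (rule continuous_on_product_then_coordinatewise) simp
  have "closed (\<Inter>i\<in>{..<N}. \<Inter>j\<in>{..<N}. {x :: nat \<Rightarrow> nat \<Rightarrow> real. bil N Jf (x i) (x j) = Jf i j})"
    unfolding bil_def by (intro closed_INT ballI closed_Collect_eq continuous_intros coord)
  moreover have "symplectic_rows N = (\<Inter>i\<in>{..<N}. \<Inter>j\<in>{..<N}. {x. bil N Jf (x i) (x j) = Jf i j})"
    by (auto simp: symplectic_rows_def)
  ultimately have "closed (symplectic_rows N)" by (simp only:)
  moreover have "compact {x. \<forall>i. x i \<in> {u. \<forall>j. u j \<in> S i j}}"
    by (intro compact_Pi_UNIV) (simp add: S_def)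
  ultimately have K: "compact K" unfolding K_def by (intro compact_Int_closed)
  have cont: "continuous_on K (wtrace N B)"
    unfolding wtrace_def bil_def
    by (rule continuous_on_subset[OF _ subset_UNIV]) (intro continuous_intros coord)
  have box: "\<bar>y i j\<bar> \<le> R" if "wtrace N B y \<le> wtrace N B one" "i < N" "j < N" for y i j
  proof -
    have "e * (y i j)\<^sup>2 \<le> e * (\<Sum>k<N. (y i k)\<^sup>2)"
      using e(1) that by (intro mult_left_mono member_le_sum) auto
    also have "\<dots> \<le> bil N B (y i) (y i)" by (rule e(2))
    also have "\<dots> \<le> mode_weight N i * bil N B (y i) (y i)"
      using mode_weight_ge_1[OF that(2)] nn[of "y i"] by (simp add: mult_le_cancel_right1)
    also have "\<dots> \<le> wtrace N B y"
      unfolding wtrace_def using that by (intro member_le_sum) (auto simp: nn mode_weight_def)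
    also have "\<dots> \<le> wtrace N B one" by fact
    finally have "(y i j)\<^sup>2 \<le> wtrace N B one / e" using e(1) by (simp add: field_simps)
    then show ?thesis unfolding R_def using real_le_rsqrt by (metis abs_le_square_iff real_sqrt_abs real_sqrt_le_iff)
  qed
  have one: "one \<in> symplectic_rows N"
    unfolding symplectic_rows_def mem_Collect_eq
  proof (intro allI impI)
    fix i j assume "i < N" "j < N"
    then have "bil N Jf (one i) (one j) = (\<Sum>k<N. if k = i then mode_sign i * one j (partner i) else 0)"
      unfolding N bil_J by (intro sum.cong) (auto simp: one_def N)
    also have "\<dots> = mode_sign i * one j (partner i)" using \<open>i < N\<close> by simp
    also have "\<dots> = Jf i j" using \<open>j < N\<close> by (auto simp: one_def Jf_def)
    finally show "bil N Jf (one i) (one j) = Jf i j" .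
  qed
  have one0: "one i j = 0" if "\<not> (i < N \<and> j < N)" for i j using that by (auto simp: one_def)
  have "one i j \<in> S i j" for i j
    using box[of one i j] one0[of i j] by (auto simp: S_def abs_le_iff minus_le_iff)
  then have "one \<in> K" using one by (simp add: K_def)
  then have "K \<noteq> {}" by blast
  from continuous_attains_inf[OF K this cont] obtain x where
    x: "x \<in> K" "\<And>y. y \<in> K \<Longrightarrow> wtrace N B x \<le> wtrace N B y" by blast
  show ?thesis
  proof (rule that)
    show "x \<in> symplectic_rows N" using x(1) by (simp add: K_def)
    fix y assume y: "y \<in> symplectic_rows N"
    show "wtrace N B x \<le> wtrace N B y"
    proof (cases "wtrace N B y \<le> wtrace N B one")
      case True
      \<comment> \<open>Clearing the entries beyond \<open>N\<close> puts the competitor into the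
        compact set and changes neither form.\<close>
      define z where "z = (\<lambda>i j. if i < N \<and> j < N then y i j else 0)"
      have "bil N C (z i) (z j) = bil N C (y i) (y j)" if "i < N" "j < N" for i j C
        by (rule bil_cong) (use that in \<open>auto simp: z_def\<close>)
      then have "z \<in> symplectic_rows N" "wtrace N B z = wtrace N B y"
        using y by (auto simp: symplectic_rows_def wtrace_def)
      moreover from this have "z \<in> K"
        using box[OF True] unfolding K_def by (auto simp: S_def z_def abs_le_iff minus_le_iff)
      ultimately show ?thesis using x(2) by metis
    next
      case False
      then show ?thesis using x(2)[OF \<open>one \<in> K\<close>] by simp
    qed
  qed
qed

lemma linear_term_zero:
  fixes a b :: real
  assumes "\<And>t. 0 \<le> t * a + t\<^sup>2 * b"
  shows "a = 0"
proof (rule ccontr)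
  assume "a \<noteq> 0"
  \<comment> \<open>At t = -a/q the expression equals a^2 (b - q) / q^2, which is negative once q
    exceeds b.\<close>
  define q where "q = 1 + \<bar>b\<bar>"
  define t where "t = - a / q"
  have p: "q > 0" "b < q" by (auto simp: q_def)
  have "t * a + t\<^sup>2 * b = a\<^sup>2 * (b - q) / q\<^sup>2"
    using p unfolding t_def by (simp add: field_simps power2_eq_square)
  moreover have "a\<^sup>2 * (b - q) < 0" using \<open>a \<noteq> 0\<close> p by (intro mult_pos_neg) auto
  ultimately have "t * a + t\<^sup>2 * b < 0" using p by (simp add: divide_less_0_iff)
  with assms[of t] show False by simp
qed

text \<open>The new matrix is (I + t J u u^T) x, with a = J u and w = u^T x. Since \<open>w\<close>
  pairs with row \<open>i\<close> to give \<open>a i\<close> up to sign, the two terms linear in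
  \<open>t\<close> cancel by antisymmetry, and the quadratic one contains the pairing of
  \<open>w\<close> with itself.\<close>

lemma transvection_symplectic_rows:
  assumes N: "N = 2 * m" and x: "x \<in> symplectic_rows N"
    and a: "\<And>i. a i = mode_sign i * u (partner i)" and w: "\<And>k. w k = (\<Sum>l<N. u l * x l k)"
  shows "(\<lambda>i k. x i k + t * a i * w k) \<in> symplectic_rows N"
proof -
  have xJ: "bil N Jf (x i) (x j) = Jf i j" if "i < N" "j < N" for i j
    using x that by (simp add: symplectic_rows_def)
  have w': "w = (\<lambda>k. \<Sum>l<N. u l * x l k)" using w by auto
  have xw: "bil N Jf (x i) w = a i" if "i < N" for i
  proof -
    have "bil N Jf (x i) w = (\<Sum>l<N. u l * Jf i l)"
      unfolding w' bil_sum_right bil_cmult_right by (intro sum.cong) (use that xJ in auto)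
    also have "\<dots> = (\<Sum>l<N. if l = partner i then u l * mode_sign i else 0)"
      by (intro sum.cong) (auto simp: Jf_def)
    also have "\<dots> = a i" using that by (simp add: N a)
    finally show ?thesis .
  qed
  have wx: "bil N Jf w (x i) = - a i" if "i < N" for i
    using xw[OF that] bil_J_antisym[of m w "x i"] by (simp add: N)
  have ww: "bil N Jf w w = 0" by (simp add: N bil_J_self)
  show ?thesis
    unfolding symplectic_rows_def mem_Collect_eq
    by (simp add: bil_add_left bil_add_right bil_cmult_left bil_cmult_right xJ xw wx ww)
qed

text \<open>The derivative of the weighted trace along the symplectic transvections \<open>I + t J u u\<^sup>T\<close>.\<close>

lemma minimiser_stationary:
  fixes B :: "nat \<Rightarrow> nat \<Rightarrow> real"
  assumes N: "N = 2 * m" and x: "x \<in> symplectic_rows N"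
    and sym: "\<And>k l. k < N \<Longrightarrow> l < N \<Longrightarrow> B k l = B l k"
    and min: "\<And>y. y \<in> symplectic_rows N \<Longrightarrow> wtrace N B x \<le> wtrace N B y"
  shows "(\<Sum>i<N. \<Sum>l<N. u i * (mode_weight N i * mode_sign i * bil N B (x (partner i)) (x l)) * u l) = 0"
proof -
  define a where "a i = mode_sign i * u (partner i)" for i
  define w where "w k = (\<Sum>l<N. u l * x l k)" for k
  define L where "L = 2 * (\<Sum>i<N. mode_weight N i * a i * bil N B (x i) w)"
  define Q where "Q = (\<Sum>i<N. mode_weight N i * (a i)\<^sup>2 * bil N B w w)"
  have "0 \<le> t * L + t\<^sup>2 * Q" for t
  proof -
    have "(\<lambda>i k. x i k + t * a i * w k) \<in> symplectic_rows N"
      by (rule transvection_symplectic_rows[OF N x a_def w_def])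
    from min[OF this] have "wtrace N B x \<le> wtrace N B (\<lambda>i k. x i k + t * a i * w k)" .
    also have "\<dots> = wtrace N B x + t * L + t\<^sup>2 * Q"
    proof -
      have "mode_weight N i * bil N B (\<lambda>k. x i k + t * a i * w k) (\<lambda>k. x i k + t * a i * w k)
         = mode_weight N i * bil N B (x i) (x i) + t * (2 * (mode_weight N i * a i * bil N B (x i) w))
           + t\<^sup>2 * (mode_weight N i * (a i)\<^sup>2 * bil N B w w)" for i
        using bil_sym[of N B w "x i", OF sym]
        by (simp add: bil_add_left bil_add_right bil_cmult_left bil_cmult_right algebra_simps power2_eq_square)
      then show ?thesis
        by (simp add: wtrace_def L_def Q_def sum.distrib sum_distrib_left)
    qed
    finally show ?thesis by simp
  qed
  then have "L = 0" by (rule linear_term_zero)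
  have w': "w = (\<lambda>k. \<Sum>l<N. u l * x l k)" by (auto simp: w_def)
  from \<open>L = 0\<close> have "0 = (\<Sum>i<N. mode_weight N i * a i * bil N B (x i) w)" by (simp add: L_def)
  also have "\<dots> = (\<Sum>i<N. mode_weight N (partner i) * a (partner i) * bil N B (x (partner i)) w)"
    unfolding N by (rule sum_partner[symmetric])
  also have "\<dots> = (\<Sum>i<N. - (\<Sum>l<N. u i * (mode_weight N i * mode_sign i * bil N B (x (partner i)) (x l)) * u l))"
    unfolding w' bil_sum_right bil_cmult_right
    by (intro sum.cong) (auto simp: a_def mode_weight_def sum_distrib_left sum_negf mult_ac)
  finally show ?thesis by (simp add: sum_negf)
qed

text \<open>Polarisation; a vanishing quadratic form controls only the symmetric part of its
  matrix.\<close>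

lemma quadratic_form_zero:
  fixes Z :: "nat \<Rightarrow> nat \<Rightarrow> real"
  assumes Q: "\<And>u. (\<Sum>i<N. \<Sum>l<N. u i * Z i l * u l) = 0" and pq: "p < N" "q < N"
  shows "Z p q + Z q p = 0"
proof -
  define d :: "nat \<Rightarrow> nat \<Rightarrow> real" where "d = (\<lambda>p i. if i = p then 1 else 0)"
  have dd: "bil N Z (d p) (d q) = Z p q" if "p < N" "q < N" for p q
  proof -
    have "bil N Z (d p) (d q) = (\<Sum>k<N. \<Sum>l<N. if l = q then (if k = p then Z k l else 0) else 0)"
      unfolding bil_def d_def by (intro sum.cong) auto
    then show ?thesis using that by simp
  qed
  have Q': "bil N Z u u = 0" for u using Q[of u] by (simp add: bil_def)
  have "0 = bil N Z (\<lambda>k. d p k + d q k) (\<lambda>k. d p k + d q k)" by (simp add: Q')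
  also have "\<dots> = Z p q + Z q p"
    unfolding bil_add_left bil_add_right using dd[OF pq] dd[OF pq(2,1)] Q'[of "d p"] Q'[of "d q"] by simp
  finally show ?thesis by simp
qed

text \<open>Let G be the Gram matrix of the rows and W the diagonal matrix of weights. Stationarity
  along all transvections says that W J G is antisymmetric. Within one mode this gives equal
  diagonal entries and a zero off-diagonal entry. Between two modes it gives two relations between
  \<open>b p q\<close> and \<open>b (partner p) (partner q)\<close>; eliminating the latter leaves
  the difference of the squared weights times \<open>b p q\<close> equal to 0, and distinct modes
  have distinct weights.\<close>

lemma minimiser_diagonal:
  fixes B :: "nat \<Rightarrow> nat \<Rightarrow> real"
  assumes N: "N = 2 * m" and x: "x \<in> symplectic_rows N"
    and sym: "\<And>k l. k < N \<Longrightarrow> l < N \<Longrightarrow> B k l = B l k"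
    and min: "\<And>y. y \<in> symplectic_rows N \<Longrightarrow> wtrace N B x \<le> wtrace N B y"
    and pq: "p < N" "q < N"
  shows "bil N B (x p) (x q) = (if p = q then bil N B (x (2 * (p div 2))) (x (2 * (p div 2))) else 0)"
proof -
  define b where "b p q = bil N B (x p) (x q)" for p q
  have bs: "b p q = b q p" for p q unfolding b_def by (rule bil_sym) (rule sym)
  have wtp: "mode_weight N (partner p) = mode_weight N p" for p by (simp add: mode_weight_def)
  have star: "mode_weight N p * mode_sign p * b (partner p) q + mode_weight N q * mode_sign q * b (partner q) p = 0"
    if "p < N" "q < N" for p q
    using quadratic_form_zero[where Z = "\<lambda>i l. mode_weight N i * mode_sign i * b (partner i) l", OF _ that]
      minimiser_stationary[OF N x sym min] unfolding b_def by blast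
  have pn: "partner r < N" if "r < N" for r using that by (simp add: N)
  have sgnz: "mode_sign r \<noteq> (0::real)" for r by (simp add: mode_sign_def)
  have wpos: "mode_weight N r > 0" if "r < N" for r using mode_weight_ge_1[OF that] by linarith
  have diag: "b (partner p) (partner p) = b p p"
    using star[OF pq(1) pn[OF pq(1)]] wpos[OF pq(1)] sgnz[of p] by (simp add: wtp)
  have "b p q = 0" if "p \<noteq> q"
  proof (cases "q = partner p")
    case True
    have "b (partner p) p = 0"
      using star[OF pq(1) pq(1)] wpos[OF pq(1)] sgnz[of p] by simp
    then show ?thesis using True bs by simp
  next
    case False
    then have ne: "p div 2 \<noteq> q div 2" using that same_mode by metis
    have lt: "p div 2 < N" "q div 2 < N" using pq by auto
    have 1: "mode_weight N q * mode_sign q * b (partner p) (partner q) = mode_weight N p * mode_sign p * b p q"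
      using star[OF pn[OF pq(1)] pq(2)] bs by (simp add: wtp)
    have 2: "mode_weight N p * mode_sign p * b (partner p) (partner q) = mode_weight N q * mode_sign q * b p q"
      using star[OF pq(1) pn[OF pq(2)]] bs by (simp add: wtp)
    have "mode_weight N p * mode_sign p * (mode_weight N p * mode_sign p * b p q) = mode_weight N p * mode_sign p * (mode_weight N q * mode_sign q * b (partner p) (partner q))"
      by (simp only: 1)
    also have "\<dots> = mode_weight N q * mode_sign q * (mode_weight N p * mode_sign p * b (partner p) (partner q))" by (simp only: mult_ac)
    also have "\<dots> = mode_weight N q * mode_sign q * (mode_weight N q * mode_sign q * b p q)" by (simp only: 2)
    finally have "(mode_weight N p)\<^sup>2 * (mode_sign p * mode_sign p) * b p q = (mode_weight N q)\<^sup>2 * (mode_sign q * mode_sign q) * b p q"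
      by (simp only: power2_eq_square mult_ac)
    then have "(mode_weight N p)\<^sup>2 * b p q = (mode_weight N q)\<^sup>2 * b p q" by simp
    moreover have "(mode_weight N p)\<^sup>2 \<noteq> (mode_weight N q)\<^sup>2"
      using ne lt by (auto simp: mode_weight_def power2_eq_iff)
    ultimately show ?thesis by simp
  qed
  moreover have "b p p = b (2 * (p div 2)) (2 * (p div 2))"
  proof (cases "even p")
    case False
    then have "partner p = 2 * (p div 2)" by (auto simp: partner_def elim!: oddE)
    then show ?thesis using diag by simp
  qed simp
  ultimately show ?thesis unfolding b_def by auto
qed

text \<open>Exchange argument: interchanging the modes \<open>a\<close> and \<open>b\<close> keeps
  parity, hence commutes with \<open>partner\<close> and preserves J. The weighted trace changes by
  twice the difference of the two weights times \<open>d b - d a\<close>, and the mode with the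
  smaller index has the larger weight.\<close>

lemma minimiser_sorted:
  fixes B :: "nat \<Rightarrow> nat \<Rightarrow> real"
  assumes N: "N = 2 * m" and x: "x \<in> symplectic_rows N"
    and diag: "\<And>i. i < N \<Longrightarrow> bil N B (x i) (x i) = d (i div 2)"
    and min: "\<And>y. y \<in> symplectic_rows N \<Longrightarrow> wtrace N B x \<le> wtrace N B y"
    and ab: "a < b" "b < m"
  shows "d a \<le> d b"
proof -
  define \<mu> where "\<mu> r = (if r = a then b else if r = b then a else r)" for r
  define \<pi> where "\<pi> i = 2 * \<mu> (i div 2) + i mod 2" for i
  have \<pi>_div: "\<pi> i div 2 = \<mu> (i div 2)" for i by (simp add: \<pi>_def)
  have \<mu>\<mu>: "\<mu> (\<mu> r) = r" for r by (auto simp: \<mu>_def)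
  have \<pi>\<pi>: "\<pi> (\<pi> i) = i" for i by (simp add: \<pi>_def \<mu>\<mu>)
  have \<pi>_less: "\<pi> i < N" if "i < N" for i
  proof -
    have "i div 2 < m" using that N by auto
    then have "\<mu> (i div 2) < m" using ab by (auto simp: \<mu>_def)
    then show ?thesis unfolding N \<pi>_def by linarith
  qed
  have par: "even (\<pi> i) = even i" for i by (simp add: \<pi>_def)
  have \<pi>_partner: "\<pi> (partner i) = partner (\<pi> i)" for i
  proof (cases "even i")
    case True then show ?thesis using par[of i] by (auto simp: partner_def \<pi>_def elim!: evenE)
  next
    case False then show ?thesis using par[of i] by (auto simp: partner_def \<pi>_def elim!: oddE)
  qed
  have J\<pi>: "Jf (\<pi> i) (\<pi> j) = (Jf i j :: real)" for i j
  proof -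
    have "\<pi> j = partner (\<pi> i) \<longleftrightarrow> j = partner i" by (metis \<pi>_partner \<pi>\<pi>)
    moreover have "mode_sign (\<pi> i) = (mode_sign i :: real)" by (simp add: mode_sign_def par)
    ultimately show ?thesis by (simp add: Jf_def)
  qed
  have "(\<lambda>i. x (\<pi> i)) \<in> symplectic_rows N"
    using x \<pi>_less by (simp add: symplectic_rows_def J\<pi>)
  from min[OF this] have "wtrace N B x \<le> wtrace N B (\<lambda>i. x (\<pi> i))" .
  moreover have "wtrace N B x = 2 * (\<Sum>r<m. real (N - r) * d r)"
  proof -
    have "wtrace N B x = (\<Sum>i<2 * m. real (N - i div 2) * d (i div 2))"
      unfolding wtrace_def mode_weight_def by (intro sum.cong) (auto simp: diag[unfolded N] N)
    then show ?thesis using sum_modes[of "\<lambda>r. real (N - r) * d r" m] by simp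
  qed
  moreover have "wtrace N B (\<lambda>i. x (\<pi> i)) = 2 * (\<Sum>r<m. real (N - r) * d (\<mu> r))"
  proof -
    have "wtrace N B (\<lambda>i. x (\<pi> i)) = (\<Sum>i<2 * m. real (N - i div 2) * d (\<mu> (i div 2)))"
      unfolding wtrace_def mode_weight_def using N
      by (intro sum.cong) (auto simp: diag[OF \<pi>_less, unfolded N] \<pi>_div N)
    then show ?thesis using sum_modes[of "\<lambda>r. real (N - r) * d (\<mu> r)" m] by simp
  qed
  ultimately have "0 \<le> (\<Sum>r<m. real (N - r) * (d (\<mu> r) - d r))"
    by (simp add: right_diff_distrib sum_subtractf)
  also have "\<dots> = (\<Sum>r\<in>{a, b}. real (N - r) * (d (\<mu> r) - d r))"
    using ab by (intro sum.mono_neutral_right) (auto simp: \<mu>_def)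
  also have "\<dots> = (real (N - a) - real (N - b)) * (d b - d a)"
    using ab by (simp add: \<mu>_def algebra_simps)
  finally have "0 \<le> (real (N - a) - real (N - b)) * (d b - d a)" .
  moreover have "real (N - a) - real (N - b) > 0" using ab N by auto
  ultimately show ?thesis unfolding zero_le_mult_iff by linarith
qed

lemma williamson_exists:
  fixes B :: "nat \<Rightarrow> nat \<Rightarrow> real"
  assumes N: "N = 2 * m" "N > 0"
    and sym: "\<And>k l. k < N \<Longrightarrow> l < N \<Longrightarrow> B k l = B l k"
    and pd: "\<And>u. (\<exists>k<N. u k \<noteq> 0) \<Longrightarrow> 0 < bil N B u u"
  obtains x d where "x \<in> symplectic_rows N"
    "\<And>p q. p < N \<Longrightarrow> q < N \<Longrightarrow> bil N B (x p) (x q) = (if p = q then d (p div 2) else 0)"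
    "\<And>r. r < m \<Longrightarrow> 0 < d r" "\<And>r s. r \<le> s \<Longrightarrow> s < m \<Longrightarrow> d r \<le> d s"
proof -
  obtain x where x: "x \<in> symplectic_rows N" "\<And>y. y \<in> symplectic_rows N \<Longrightarrow> wtrace N B x \<le> wtrace N B y"
    using wtrace_attains_min[OF N pd] by blast
  define d where "d r = bil N B (x (2 * r)) (x (2 * r))" for r
  have D: "bil N B (x p) (x q) = (if p = q then d (p div 2) else 0)" if "p < N" "q < N" for p q
    unfolding d_def by (rule minimiser_diagonal[OF N(1) x(1) sym x(2) that])
  have "0 < d r" if "r < m" for r
    unfolding d_def
  \<comment> \<open>A zero row could not pair to 1 with its partner row under J.\<close>
  proof (rule pd, rule ccontr)
    assume "\<not> (\<exists>k<N. x (2 * r) k \<noteq> 0)"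
    then have "bil N Jf (x (2 * r)) (x (partner (2 * r))) = 0" by (simp add: bil_def)
    moreover have "bil N Jf (x (2 * r)) (x (partner (2 * r))) = Jf (2 * r) (partner (2 * r))"
      using x(1) that by (simp add: symplectic_rows_def N)
    ultimately show False by (simp add: Jf_def mode_sign_def)
  qed
  moreover have "d r \<le> d s" if "r \<le> s" "s < m" for r s
    using minimiser_sorted[OF N(1) x(1) _ x(2), of d r s] D that by (cases "r = s") auto
  ultimately show ?thesis using that[OF x(1) D] by blast
qed

section \<open>Passage to carrier-based matrices and traces of powers\<close>

fun fmat_pow :: "nat \<Rightarrow> (nat \<Rightarrow> nat \<Rightarrow> 'a::comm_ring_1) \<Rightarrow> nat \<Rightarrow> nat \<Rightarrow> nat \<Rightarrow> 'a" where
  "fmat_pow n X 0 = (\<lambda>i j. if i = j then 1 else 0)"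
| "fmat_pow n X (Suc l) = fmat_mult n (fmat_pow n X l) X"

definition fmat_trace :: "nat \<Rightarrow> (nat \<Rightarrow> nat \<Rightarrow> 'a::comm_ring_1) \<Rightarrow> 'a" where
  "fmat_trace n X = (\<Sum>i<n. X i i)"

lemma mult_mat_index:
  assumes "A \<in> carrier_mat n k" "B \<in> carrier_mat k m" "i < n" "j < m"
  shows "(A * B) $$ (i, j) = (\<Sum>l<k. A $$ (i, l) * B $$ (l, j))"
  using assms by (simp add: scalar_prod_def lessThan_atLeast0)

lemma pow_mat_index:
  assumes "A \<in> carrier_mat n n" "i < n" "j < n"
  shows "(A ^\<^sub>m l) $$ (i, j) = fmat_pow n (\<lambda>i j. A $$ (i, j)) l i j"
  using assms(2,3)
proof (induction l arbitrary: i j)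
  case 0 then show ?case using assms(1) by auto
next
  case (Suc l)
  have "A ^\<^sub>m l \<in> carrier_mat n n" using assms(1) by simp
  from mult_mat_index[OF this assms(1) Suc.prems] show ?case
    using Suc by (simp add: fmat_mult_def)
qed

lemma diag_block_mat_2x2:
  assumes "\<forall>A\<in>set As. A \<in> carrier_mat 2 2"
  shows "diag_block_mat As \<in> carrier_mat (2 * length As) (2 * length As) \<and>
    (\<forall>p<2 * length As. \<forall>q<2 * length As. diag_block_mat As $$ (p, q) =
      (if p div 2 = q div 2 then (As ! (p div 2)) $$ (p mod 2, q mod 2) else 0))"
  using assms
proof (induction As)
  case (Cons A As)
  define B where "B = diag_block_mat As"
  have B: "B \<in> carrier_mat (2 * length As) (2 * length As)"
    and Bi: "\<And>p q. p < 2 * length As \<Longrightarrow> q < 2 * length As \<Longrightarrow> B $$ (p, q) =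
      (if p div 2 = q div 2 then (As ! (p div 2)) $$ (p mod 2, q mod 2) else 0)"
    using Cons unfolding B_def by auto
  have A: "A \<in> carrier_mat 2 2" using Cons by simp
  have eq: "diag_block_mat (A # As) =
      four_block_mat A (0\<^sub>m 2 (2 * length As)) (0\<^sub>m (2 * length As) 2) B"
    using A B by (simp add: B_def[symmetric] Let_def)
  have shift: "p div 2 = Suc ((p - 2) div 2)" "p mod 2 = (p - 2) mod 2" if "\<not> p < 2" for p :: nat
    using that by (simp_all add: le_div_geq le_mod_geq)
  show ?case
  proof (intro conjI allI impI)
    show "diag_block_mat (A # As) \<in> carrier_mat (2 * length (A # As)) (2 * length (A # As))"
      unfolding eq using A B by auto
    fix p q assume pq: "p < 2 * length (A # As)" "q < 2 * length (A # As)"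
    have e: "diag_block_mat (A # As) $$ (p, q) = (if p < 2 then if q < 2 then A $$ (p, q) else 0
      else if q < 2 then 0 else B $$ (p - 2, q - 2))"
      unfolding eq using A B pq by auto
    show "diag_block_mat (A # As) $$ (p, q) =
      (if p div 2 = q div 2 then ((A # As) ! (p div 2)) $$ (p mod 2, q mod 2) else 0)"
    proof (cases "p < 2")
      case True
      then show ?thesis unfolding e by (cases "q < 2") (auto simp: shift)
    next
      case False
      then show ?thesis unfolding e
        by (cases "q < 2") (use pq in \<open>auto simp: shift Bi\<close>)
    qed
  qed
qed simp

lemma mod2_partner:
  "p div 2 = q div 2 \<Longrightarrow> p mod 2 = q mod 2 \<longleftrightarrow> p = (q::nat)"
  by (metis div_mult_mod_eq)

lemma J_mat_carrier: "J_mat m \<in> carrier_mat (2 * m) (2 * m)"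
  and J_mat_index: "p < 2 * m \<Longrightarrow> q < 2 * m \<Longrightarrow> J_mat m $$ (p, q) = Jf p q"
proof -
  have J2: "J2 \<in> carrier_mat 2 2" unfolding J2_def by (auto simp: mat_of_rows_list_def)
  have J2i: "J2 $$ (r, s) = (if r = s then 0 else if r = 0 then 1 else -1)" if "r < 2" "s < 2" for r s
    using that unfolding J2_def mat_of_rows_list_def by (auto simp: less_2_cases_iff)
  have *: "\<forall>A\<in>set (replicate m J2). A \<in> carrier_mat 2 2" using J2 by auto
  show "J_mat m \<in> carrier_mat (2 * m) (2 * m)"
    using diag_block_mat_2x2[OF *] by (simp add: J_mat_def)
  assume pq: "p < 2 * m" "q < 2 * m"
  have "J_mat m $$ (p, q) = (if p div 2 = q div 2 then J2 $$ (p mod 2, q mod 2) else 0)"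
    using diag_block_mat_2x2[OF *] pq by (simp add: J_mat_def less_mult_imp_div_less mult.commute)
  also have "\<dots> = Jf p q"
  proof (cases "p div 2 = q div 2")
    case True
    then consider "q = p" | "q = partner p" using same_mode by blast
    then show ?thesis
    proof cases
      case 1 then show ?thesis by (simp add: J2i Jf_def)
    next
      case 2
      have "partner p mod 2 \<noteq> p mod 2" using mod2_partner[of "partner p" p] by simp
      then show ?thesis using 2 by (auto simp: J2i Jf_def mode_sign_def)
    qed
  next
    case False
    then have "q \<noteq> partner p" using same_mode by metis
    then show ?thesis using False by (simp add: Jf_def)
  qed
  finally show "J_mat m $$ (p, q) = Jf p q" .
qed

abbreviation williamson_diag :: "real list \<Rightarrow> complex mat" where
  "williamson_diag d \<equiv> diag_block_mat (map (\<lambda>x. complex_of_real x \<cdot>\<^sub>m 1\<^sub>m 2) d)"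

lemma williamson_diag_carrier: "williamson_diag d \<in> carrier_mat (2 * length d) (2 * length d)"
  and williamson_diag_index: "p < 2 * length d \<Longrightarrow> q < 2 * length d \<Longrightarrow>
    williamson_diag d $$ (p, q) = (if p = q then of_real (d ! (p div 2)) else 0)"
proof -
  let ?As = "map (\<lambda>x. complex_of_real x \<cdot>\<^sub>m 1\<^sub>m 2) d"
  have *: "\<forall>A\<in>set ?As. A \<in> carrier_mat 2 2" by auto
  show "williamson_diag d \<in> carrier_mat (2 * length d) (2 * length d)"
    using diag_block_mat_2x2[OF *] by simp
  assume pq: "p < 2 * length d" "q < 2 * length d"
  then have "p div 2 < length d" by auto
  then show "williamson_diag d $$ (p, q) = (if p = q then of_real (d ! (p div 2)) else 0)"
    using diag_block_mat_2x2[OF *] pq by (auto simp: mod2_partner)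
qed

lemma mat_adjoint_index:
  "i < dim_col A \<Longrightarrow> j < dim_row A \<Longrightarrow> mat_adjoint A $$ (i, j) = cnj (A $$ (j, i))" for A :: "complex mat"
  unfolding mat_adjoint_def by (simp add: mat_of_rows_def conjugate_complex_def)

lemma real_mat_index:
  assumes "real_mat B" "i < dim_row B" "j < dim_col B"
  shows "B $$ (i, j) = complex_of_real (Re (B $$ (i, j)))"
proof -
  have "B $$ (i, j) \<in> elements_mat B" using assms by (intro elements_matI) auto
  then show ?thesis using assms(1) unfolding real_mat_def by (metis Reals_cases Re_complex_of_real subsetD)
qed

lemma real_matI:
  "(\<And>i j. i < dim_row B \<Longrightarrow> j < dim_col B \<Longrightarrow> B $$ (i, j) \<in> \<real>) \<Longrightarrow> real_mat B"
  unfolding real_mat_def by (auto dest!: elements_matD)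

lemma quadratic_form_vec:
  assumes "B \<in> carrier_mat n n" "v \<in> carrier_vec n"
  shows "(B *\<^sub>v v) \<bullet>c v = (\<Sum>i<n. \<Sum>j<n. cnj (v $ i) * B $$ (i, j) * v $ j)"
  using assms by (simp add: scalar_prod_def lessThan_atLeast0 sum_distrib_right sum_distrib_left
      conjugate_complex_def mult_ac)

text \<open>The transpose of J, which is also its inverse.\<close>

definition J_tr :: "nat \<Rightarrow> complex mat" where
  "J_tr m = mat (2 * m) (2 * m) (\<lambda>(p, q). - Jf p q)"

lemma J_tr_carrier: "J_tr m \<in> carrier_mat (2 * m) (2 * m)"
  by (simp add: J_tr_def)

lemma Jf_Jf: "p < 2 * m \<Longrightarrow> q < 2 * m \<Longrightarrow> (\<Sum>l<2 * m. Jf p l * Jf l q) = (if p = q then -1 else 0 :: complex)"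
proof -
  assume "p < 2 * m" "q < 2 * m"
  have "(\<Sum>l<2 * m. Jf p l * Jf l q) = (\<Sum>l<2 * m. if l = partner p then mode_sign p * Jf l q else 0 :: complex)"
    by (rule sum.cong) (auto simp: Jf_def)
  then show ?thesis using \<open>p < 2 * m\<close> by (auto simp: Jf_def)
qed

lemma J_mat_J_tr: "J_mat m * J_tr m = 1\<^sub>m (2 * m)"
proof (rule eq_matI)
  fix i j assume ij: "i < dim_row (1\<^sub>m (2 * m))" "j < dim_col (1\<^sub>m (2 * m))"
  then have "(J_mat m * J_tr m) $$ (i, j) = (\<Sum>l<2 * m. - (Jf i l * Jf l j))"
    by (subst mult_mat_index[OF J_mat_carrier J_tr_carrier]) (auto simp: J_mat_index J_tr_def)
  then show "(J_mat m * J_tr m) $$ (i, j) = 1\<^sub>m (2 * m) $$ (i, j)"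
    using ij by (simp add: sum_negf Jf_Jf)
qed (use J_mat_carrier J_tr_carrier in auto)

lemma J_tr_J_mat: "J_tr m * J_mat m = 1\<^sub>m (2 * m)"
  by (rule mat_mult_left_right_inverse[OF J_mat_carrier J_tr_carrier J_mat_J_tr])

text \<open>M^T J M = J rearranges to M^T (J M J^(-1)) = I, and a one-sided inverse of a square
  matrix is two-sided.\<close>

lemma symplectic_inverse:
  assumes M: "M \<in> carrier_mat (2 * m) (2 * m)" and eq: "transpose_mat M * J_mat m * M = J_mat m"
  shows "transpose_mat M * (J_mat m * M * J_tr m) = 1\<^sub>m (2 * m)"
    and "(J_mat m * M * J_tr m) * transpose_mat M = 1\<^sub>m (2 * m)"
proof -
  note c [simp] = J_mat_carrier[of m] J_tr_carrier[of m] M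
  note a [simp] = assoc_mult_mat[where ?n\<^sub>1.0 = "2*m" and ?n\<^sub>2.0 = "2*m" and ?n\<^sub>3.0 = "2*m" and ?n\<^sub>4.0 = "2*m"]
  note p [simp] = mult_carrier_mat[where nr = "2*m" and n = "2*m" and nc = "2*m"]
  have t [simp]: "transpose_mat M \<in> carrier_mat (2 * m) (2 * m)" using M by simp
  show 1: "transpose_mat M * (J_mat m * M * J_tr m) = 1\<^sub>m (2 * m)"
  proof -
    have "transpose_mat M * (J_mat m * M * J_tr m) = (transpose_mat M * J_mat m * M) * J_tr m"
      by simp
    then show ?thesis by (simp only: eq J_mat_J_tr)
  qed
  show "(J_mat m * M * J_tr m) * transpose_mat M = 1\<^sub>m (2 * m)"
    by (rule mat_mult_left_right_inverse[OF t _ 1]) simp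
qed

text \<open>Bridges the two conventions: the minimiser satisfies the condition on rows, while
  \<open>symplectic\<close> is stated for columns. The inverse found for M, multiplied by J^(-1)
  from the left, gives the claim for J^(-1) = -J.\<close>

lemma symplectic_transpose:
  assumes M: "M \<in> carrier_mat (2 * m) (2 * m)" and eq: "M * J_mat m * transpose_mat M = J_mat m"
  shows "transpose_mat M * J_mat m * M = J_mat m"
proof -
  note c [simp] = J_mat_carrier[of m] J_tr_carrier[of m] M
  note a [simp] = assoc_mult_mat[where ?n\<^sub>1.0 = "2*m" and ?n\<^sub>2.0 = "2*m" and ?n\<^sub>3.0 = "2*m" and ?n\<^sub>4.0 = "2*m"]
  note p [simp] = mult_carrier_mat[where nr = "2*m" and n = "2*m" and nc = "2*m"]
  have t [simp]: "transpose_mat M \<in> carrier_mat (2 * m) (2 * m)" using M by simp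
  have "(J_mat m * transpose_mat M * J_tr m) * M = 1\<^sub>m (2 * m)"
    using symplectic_inverse(2)[of "transpose_mat M" m] eq M by simp
  then have "J_tr m * ((J_mat m * transpose_mat M * J_tr m) * M) = J_tr m"
    using right_mult_one_mat[OF J_tr_carrier] by (simp del: a)
  moreover have "J_tr m * ((J_mat m * transpose_mat M * J_tr m) * M)
      = (J_tr m * J_mat m) * (transpose_mat M * J_tr m * M)" by simp
  ultimately have *: "transpose_mat M * J_tr m * M = J_tr m"
    by (simp only: J_tr_J_mat left_mult_one_mat[OF p[OF p[OF t J_tr_carrier] M]])
  have "J_mat m = (-1) \<cdot>\<^sub>m J_tr m"
    by (rule eq_matI) (auto simp: J_mat_index J_tr_def carrier_matD[OF J_mat_carrier])
  then show ?thesis using * M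
    by (simp add: mult_smult_distrib[of _ "2*m" "2*m" _ "2*m"] mult_smult_assoc_mat[of _ "2*m" "2*m" _ "2*m"] del: a)
qed

definition mat_tr :: "complex mat \<Rightarrow> complex" where
  "mat_tr A = (\<Sum>i<dim_row A. A $$ (i, i))"

lemma mat_tr_comm:
  assumes "A \<in> carrier_mat n n" "B \<in> carrier_mat n n"
  shows "mat_tr (A * B) = mat_tr (B * A)"
proof -
  have "mat_tr (A * B) = (\<Sum>i<n. \<Sum>l<n. A $$ (i, l) * B $$ (l, i))"
    using assms by (simp add: mat_tr_def mult_mat_index del: index_mult_mat(1))
  also have "\<dots> = (\<Sum>l<n. \<Sum>i<n. A $$ (i, l) * B $$ (l, i))" by (rule sum.swap)
  also have "\<dots> = mat_tr (B * A)"
    using assms by (simp add: mat_tr_def mult_mat_index mult.commute del: index_mult_mat(1))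
  finally show ?thesis .
qed

lemma mat_tr_similar_pow:
  assumes "similar_mat_wit A B P Q" "A \<in> carrier_mat n n"
  shows "mat_tr (A ^\<^sub>m k) = mat_tr (B ^\<^sub>m k)"
proof -
  have d: "n = dim_row A" using assms by simp
  note w = similar_mat_witD[OF d assms(1)]
  have "mat_tr (A ^\<^sub>m k) = mat_tr (P * (B ^\<^sub>m k * Q))"
    using similar_mat_wit_pow_id[OF assms(1), of k] w by (simp add: assoc_mult_mat[of _ n n _ n _ n])
  also have "\<dots> = mat_tr ((B ^\<^sub>m k * Q) * P)"
    using w by (intro mat_tr_comm[of _ n]) auto
  also have "(B ^\<^sub>m k * Q) * P = B ^\<^sub>m k"
    using w by (simp add: assoc_mult_mat[of _ n n _ n _ n])
  finally show ?thesis .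
qed

text \<open>The diagonal matrix is constant on each mode and therefore commutes with J, so the
  square of the product is the diagonal matrix of the -d^2.\<close>

lemma fmat_pow_J_diag:
  fixes d :: "nat \<Rightarrow> complex"
  shows "p < 2 * m \<Longrightarrow> q < 2 * m \<Longrightarrow>
    fmat_pow (2 * m) (\<lambda>p q. Jf p q * d (q div 2)) (2 * l) p q = (if p = q then (-1) ^ l * d (p div 2) ^ (2 * l) else 0)"
proof (induction l arbitrary: p q)
  case (Suc l)
  define X where "X = (\<lambda>p q. Jf p q * d (q div 2))"
  have step: "fmat_mult (2 * m) Y X p q = - (Y p (partner q) * mode_sign q * d (q div 2))" if "q < 2 * m" for Y p q
  proof -
    have "fmat_mult (2 * m) Y X p q = (\<Sum>l<2 * m. if l = partner q then - (Y p l * mode_sign q * d (q div 2)) else 0)"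
      unfolding fmat_mult_def by (rule sum.cong) (auto simp: X_def Jf_def partner_eq_iff)
    then show ?thesis using that by simp
  qed
  have mode_sign_left: "mode_sign q * (mode_sign q * z) = z" for q and z :: complex
    by (simp add: mult.assoc[symmetric])
  have "fmat_pow (2 * m) X (2 * Suc l) p q = fmat_mult (2 * m) (fmat_mult (2 * m) (fmat_pow (2 * m) X (2 * l)) X) X p q"
    by simp
  also have "\<dots> = - (fmat_pow (2 * m) X (2 * l) p q * d (q div 2) ^ 2)"
    unfolding step[OF Suc.prems(2)] step[OF partner_less[THEN iffD2, OF Suc.prems(2)]]
    by (simp add: power2_eq_square mult_ac mode_sign_left[of q])
  finally show ?case
    using Suc.IH[OF Suc.prems] unfolding X_def by (auto simp: power_mult_distrib power2_eq_square)
qed simp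

text \<open>B and its Williamson form D are only congruent, but J B and J D are similar: with M^T as
  conjugating matrix and Q = J M J^(-1) as its inverse, M^T (J D) Q = (M^T J M) B = J B. The
  symplectic eigenvalues thus become spectral data of J B.\<close>

lemma williamson_trace:
  assumes W: "williamson_form m B d" and B: "B \<in> carrier_mat (2 * m) (2 * m)"
  shows "fmat_trace (2 * m) (fmat_pow (2 * m) (fmat_mult (2 * m) Jf (\<lambda>i j. B $$ (i, j))) (2 * l))
    = of_real ((-1) ^ l * 2 * (\<Sum>j<m. (d ! j) ^ (2 * l)))"
proof -
  define N where "N = 2 * m"
  define D where "D = williamson_diag d"
  from W obtain M where len: "length d = m" and M: "M \<in> carrier_mat N N"
    and eq: "transpose_mat M * J_mat m * M = J_mat m" and D': "M * B * transpose_mat M = D"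
    unfolding williamson_form_def symplectic_def D_def N_def by blast
  have D: "D \<in> carrier_mat N N" using williamson_diag_carrier[of d] by (simp add: D_def len N_def)
  have B: "B \<in> carrier_mat N N" using B by (simp add: N_def)
  have J: "J_mat m \<in> carrier_mat N N" "J_tr m \<in> carrier_mat N N"
    using J_mat_carrier[of m] J_tr_carrier[of m] by (simp_all add: N_def)
  have t: "transpose_mat M \<in> carrier_mat N N" using M by simp
  define Q where "Q = J_mat m * M * J_tr m"
  have Q: "Q \<in> carrier_mat N N" unfolding Q_def using J M by simp
  have PQ: "transpose_mat M * Q = 1\<^sub>m N" "Q * transpose_mat M = 1\<^sub>m N"
    using symplectic_inverse[OF M[unfolded N_def] eq] by (simp_all add: Q_def N_def)
  note a = assoc_mult_mat[of _ N N _ N _ N]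
  have "transpose_mat M * (J_mat m * D) * Q = (transpose_mat M * J_mat m * M) * (B * (transpose_mat M * Q))"
    unfolding D'[symmetric] using J M B t Q by (simp add: a)
  also have "\<dots> = J_mat m * B" using B by (simp add: eq PQ)
  finally have "similar_mat_wit (J_mat m * B) (J_mat m * D) (transpose_mat M) Q"
    using J M B D t Q PQ by (intro similar_mat_witI[of _ _ N]) auto
  from mat_tr_similar_pow[OF this, of N "2 * l"] J B
  have tr: "mat_tr ((J_mat m * B) ^\<^sub>m (2 * l)) = mat_tr ((J_mat m * D) ^\<^sub>m (2 * l))" by simp
  have ix: "fmat_pow N X k i j = fmat_pow N Y k i j"
    if "\<And>i j. i < N \<Longrightarrow> j < N \<Longrightarrow> X i j = Y i j" "i < N" "j < N" for X Y :: "nat \<Rightarrow> nat \<Rightarrow> complex" and k i j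
    using that(2,3)
  proof (induction k arbitrary: i j)
    case (Suc k) then show ?case using that(1) by (simp add: fmat_mult_def)
  qed simp
  have "fmat_trace N (fmat_pow N (fmat_mult N Jf (\<lambda>i j. B $$ (i, j))) (2 * l)) = mat_tr ((J_mat m * B) ^\<^sub>m (2 * l))"
  proof -
    have "(J_mat m * B) $$ (i, j) = fmat_mult N Jf (\<lambda>i j. B $$ (i, j)) i j" if "i < N" "j < N" for i j
      using mult_mat_index[OF J(1) B that] that J_mat_index[of i m] by (simp add: fmat_mult_def N_def)
    from ix[OF this] show ?thesis
      using J B by (simp add: fmat_trace_def mat_tr_def pow_mat_index[of _ N])
  qed
  also note tr
  also have "mat_tr ((J_mat m * D) ^\<^sub>m (2 * l)) = (\<Sum>i<N. (-1) ^ l * of_real (d ! (i div 2)) ^ (2 * l))"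
  proof -
    have "(J_mat m * D) $$ (i, j) = Jf i j * of_real (d ! (j div 2))" if ij: "i < N" "j < N" for i j
    proof -
      have "(J_mat m * D) $$ (i, j) = (\<Sum>k<N. if k = j then Jf i j * of_real (d ! (j div 2)) else 0)"
        unfolding mult_mat_index[OF J(1) D ij]
        by (rule sum.cong) (use ij in \<open>auto simp: N_def J_mat_index D_def williamson_diag_index len\<close>)
      then show ?thesis using ij by simp
    qed
    note e = ix[OF this]
    have "(J_mat m * D) ^\<^sub>m (2 * l) \<in> carrier_mat N N" using J D by (intro pow_carrier_mat mult_carrier_mat)
    then have "mat_tr ((J_mat m * D) ^\<^sub>m (2 * l)) = (\<Sum>i<N. ((J_mat m * D) ^\<^sub>m (2 * l)) $$ (i, i))"
      by (simp add: mat_tr_def carrier_matD(1)[OF J(1)])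
    also have "\<dots> = (\<Sum>i<N. (-1) ^ l * of_real (d ! (i div 2)) ^ (2 * l))"
    proof (rule sum.cong[OF refl])
      fix i assume "i \<in> {..<N}"
      then have i: "i < N" by simp
      have "((J_mat m * D) ^\<^sub>m (2 * l)) $$ (i, i) = fmat_pow N (\<lambda>i j. (J_mat m * D) $$ (i, j)) (2 * l) i i"
        using J D i by (intro pow_mat_index) auto
      also have "\<dots> = fmat_pow N (\<lambda>i j. Jf i j * of_real (d ! (j div 2))) (2 * l) i i"
        by (rule e[OF _ _ i i])
      also have "\<dots> = (-1) ^ l * of_real (d ! (i div 2)) ^ (2 * l)"
        using fmat_pow_J_diag[of i m i "\<lambda>r. of_real (d ! r)" l] i by (simp add: N_def)
      finally show "((J_mat m * D) ^\<^sub>m (2 * l)) $$ (i, i) = (-1) ^ l * of_real (d ! (i div 2)) ^ (2 * l)" .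
    qed
    finally show ?thesis .
  qed
  also have "\<dots> = of_real ((-1) ^ l * 2 * (\<Sum>j<m. (d ! j) ^ (2 * l)))"
    unfolding N_def using sum_modes[of "\<lambda>r. (-1) ^ l * complex_of_real (d ! r) ^ (2 * l)" m]
    by (simp add: sum_distrib_left mult_ac)
  finally show ?thesis by (simp add: N_def)
qed

section \<open>Uniqueness and existence of the Williamson form\<close>

lemma poly_sum_eq:
  fixes d e :: "real list"
  assumes "length d = m" "length e = m"
    and ps: "\<And>l. (\<Sum>j<m. (d ! j) ^ (2 * l)) = (\<Sum>j<m. (e ! j) ^ (2 * l))"
  shows "(\<Sum>j<m. poly p ((d ! j)\<^sup>2)) = (\<Sum>j<m. poly p ((e ! j)\<^sup>2))"
proof -
  have "(\<Sum>j<m. poly p ((f j)\<^sup>2)) = (\<Sum>i\<le>degree p. coeff p i * (\<Sum>j<m. f j ^ (2 * i)))" for f :: "nat \<Rightarrow> real"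
    unfolding poly_altdef sum_distrib_left power_mult[symmetric] by (rule sum.swap)
  then show ?thesis by (simp add: ps)
qed

text \<open>Equal power sums give equal sums of every polynomial in the squares. A polynomial
  vanishing at the squares of all occurring values except \<open>v\<close> counts the multiplicity
  of \<open>v\<close> in each list; positivity guarantees that distinct entries have distinct
  squares.\<close>

lemma power_sums_determine_list:
  fixes d e :: "real list"
  assumes len: "length d = m" "length e = m" and srt: "sorted d" "sorted e"
    and pos: "\<forall>x\<in>set d. 0 < x" "\<forall>x\<in>set e. 0 < x"
    and ps: "\<And>l. (\<Sum>j<m. (d ! j) ^ (2 * l)) = (\<Sum>j<m. (e ! j) ^ (2 * l))"
  shows "d = e"
proof -
  define V where "V = set d \<union> set e"
  have "count (mset d) v = count (mset e) v" for v
  proof (cases "v \<in> V")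
    case False then show ?thesis by (simp add: V_def count_eq_zero_iff[THEN iffD2])
  next
    case True
    define p where "p = (\<Prod>w\<in>V - {v}. [:- (w\<^sup>2), 1:])"
    have pv: "poly p (v\<^sup>2) \<noteq> 0"
    proof -
      have "v\<^sup>2 \<noteq> w\<^sup>2" if "w \<in> V - {v}" for w
      proof -
        have "0 < v" "0 < w" "w \<noteq> v" using True that pos by (auto simp: V_def)
        then show ?thesis by (simp add: power2_eq_iff)
      qed
      then show ?thesis unfolding p_def poly_prod by (auto simp: V_def)
    qed
    have pw: "poly p (w\<^sup>2) = (if w = v then poly p (v\<^sup>2) else 0)" if "w \<in> V" for w
      using that unfolding p_def poly_prod by (auto simp: V_def)
    have cnt: "(\<Sum>j<m. poly p ((f ! j)\<^sup>2)) = real (count (mset f) v) * poly p (v\<^sup>2)"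
      if "length f = m" "set f \<subseteq> V" for f
    proof -
      have "(\<Sum>j<m. poly p ((f ! j)\<^sup>2)) = (\<Sum>j<m. if v = f ! j then poly p (v\<^sup>2) else 0)"
        by (intro sum.cong) (use pw that in \<open>auto dest: nth_mem\<close>)
      also have "\<dots> = (\<Sum>j\<in>{j\<in>{..<m}. v = f ! j}. poly p (v\<^sup>2))"
        by (rule sum.inter_filter[symmetric]) simp
      also have "\<dots> = real (card {j\<in>{..<m}. v = f ! j}) * poly p (v\<^sup>2)"
        by (rule sum_constant)
      also have "card {j\<in>{..<m}. v = f ! j} = count (mset f) v"
        using that by (simp add: count_mset count_list_eq_length_filter length_filter_conv_card)
      finally show ?thesis .
    qed
    show ?thesis
      using poly_sum_eq[OF len ps, of p] cnt[OF len(1)] cnt[OF len(2)] pv by (simp add: V_def)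
  qed
  then have "mset d = mset e" by (rule multiset_eqI)
  then show ?thesis using srt by (metis properties_for_sort sorted_sort_id)
qed

lemma williamson_form_unique:
  assumes "williamson_form m B d" "williamson_form m B e" "B \<in> carrier_mat (2 * m) (2 * m)"
  shows "d = e"
proof (rule power_sums_determine_list)
  fix l
  have "complex_of_real ((-1) ^ l * 2 * (\<Sum>j<m. (d ! j) ^ (2 * l))) = of_real ((-1) ^ l * 2 * (\<Sum>j<m. (e ! j) ^ (2 * l)))"
    using williamson_trace[OF assms(1,3), of l] williamson_trace[OF assms(2,3), of l] by simp
  then show "(\<Sum>j<m. (d ! j) ^ (2 * l)) = (\<Sum>j<m. (e ! j) ^ (2 * l))"
    by (simp only: of_real_eq_iff) simp
qed (use assms in \<open>auto simp: williamson_form_def\<close>)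

lemma williamson_form_exists:
  assumes m: "m \<ge> 1" and re: "real_mat B" and pd: "pos_def (2 * m) B"
  shows "\<exists>d. williamson_form m B d"
proof -
  define N where "N = 2 * m"
  have B: "B \<in> carrier_mat N N" and adj: "mat_adjoint B = B"
    and pos: "\<And>v. v \<in> carrier_vec N \<Longrightarrow> v \<noteq> 0\<^sub>v N \<Longrightarrow> 0 < (B *\<^sub>v v) \<bullet>c v"
    using pd by (auto simp: pos_def_def N_def)
  define b where "b i j = Re (B $$ (i, j))" for i j
  have Bb: "B $$ (i, j) = of_real (b i j)" if "i < N" "j < N" for i j
    using real_mat_index[OF re] B that by (simp add: b_def)
  have bsym: "b i j = b j i" if "i < N" "j < N" for i j
    using mat_adjoint_index[of i B j] B that by (simp add: b_def adj)
  have bpd: "0 < bil N b u u" if "\<exists>k<N. u k \<noteq> 0" for u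
  proof -
    define v where "v = Matrix.vec N (\<lambda>i. complex_of_real (u i))"
    have v: "v \<in> carrier_vec N" by (simp add: v_def)
    have "v \<noteq> 0\<^sub>v N"
    proof
      assume "v = 0\<^sub>v N"
      then have "\<And>k. k < N \<Longrightarrow> v $ k = 0" by simp
      then show False using that by (auto simp: v_def)
    qed
    from pos[OF v this] have "0 < (\<Sum>i<N. \<Sum>j<N. cnj (v $ i) * B $$ (i, j) * v $ j)"
      by (simp only: quadratic_form_vec[OF B v])
    also have "\<dots> = complex_of_real (bil N b u u)"
      by (simp add: bil_def v_def Bb)
    finally show ?thesis by (simp add: less_complex_def)
  qed
  obtain x d where x: "x \<in> symplectic_rows N"
    and D: "\<And>p q. p < N \<Longrightarrow> q < N \<Longrightarrow> bil N b (x p) (x q) = (if p = q then d (p div 2) else 0)"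
    and dpos: "\<And>r. r < m \<Longrightarrow> 0 < d r" and dsort: "\<And>r s. r \<le> s \<Longrightarrow> s < m \<Longrightarrow> d r \<le> d s"
    using williamson_exists[OF N_def _ bsym bpd] m by (auto simp: N_def)
  define M where "M = mat N N (\<lambda>(i, j). complex_of_real (x i j))"
  define ds where "ds = map d [0..<m]"
  have M: "M \<in> carrier_mat N N" by (simp add: M_def)
  \<comment> \<open>Congruence by M evaluates a form on pairs of rows; the fact is used once for J
    and once for \<open>B\<close>.\<close>
  have cong: "(M * C * transpose_mat M) $$ (p, q) = of_real (bil N c (x p) (x q))"
    if C: "C \<in> carrier_mat N N" "\<And>i j. i < N \<Longrightarrow> j < N \<Longrightarrow> C $$ (i, j) = of_real (c i j)"
      and pq: "p < N" "q < N" for C c p q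
  proof -
    have "(M * C * transpose_mat M) $$ (p, q) = (\<Sum>l<N. (\<Sum>k<N. M $$ (p, k) * C $$ (k, l)) * M $$ (q, l))"
      using C(1) M pq by (subst mult_mat_index[of _ N N _ N]) (auto simp: mult_mat_index[of _ N N _ N] simp del: index_mult_mat(1))
    also have "\<dots> = (\<Sum>l<N. \<Sum>k<N. of_real (x p k * c k l * x q l))"
      using pq by (simp add: M_def C(2) sum_distrib_right)
    also have "\<dots> = (\<Sum>k<N. \<Sum>l<N. of_real (x p k * c k l * x q l))" by (rule sum.swap)
    finally show ?thesis by (simp add: bil_def)
  qed
  have J: "J_mat m \<in> carrier_mat N N" using J_mat_carrier[of m] by (simp add: N_def)
  have "M * J_mat m * transpose_mat M = J_mat m"
  proof (rule eq_matI)
    fix i j assume "i < dim_row (J_mat m)" "j < dim_col (J_mat m)"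
    then have ij: "i < N" "j < N" using J by auto
    have Jr: "J_mat m $$ (p, q) = of_real (Jf p q)" if "p < N" "q < N" for p q
      using that J_mat_index[of p m q] by (simp add: N_def Jf_def mode_sign_def)
    show "(M * J_mat m * transpose_mat M) $$ (i, j) = J_mat m $$ (i, j)"
      using cong[OF J Jr ij] x ij by (simp add: symplectic_rows_def Jr)
  qed (use J M in auto)
  then have "transpose_mat M * J_mat m * M = J_mat m"
    using symplectic_transpose[of M m] M by (simp add: N_def)
  moreover have "real_mat M" by (rule real_matI) (auto simp: M_def)
  ultimately have "symplectic m M" using M by (simp add: symplectic_def N_def)
  moreover have "M * B * transpose_mat M = williamson_diag ds"
  proof (rule eq_matI)
    fix i j assume "i < dim_row (williamson_diag ds)" "j < dim_col (williamson_diag ds)"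
    then have ij: "i < N" "j < N" using williamson_diag_carrier[of ds] by (auto simp: ds_def N_def)
    then have "i div 2 < m" by (auto simp: N_def)
    then have "ds ! (i div 2) = d (i div 2)" by (simp add: ds_def)
    moreover have "williamson_diag ds $$ (i, j) = (if i = j then of_real (ds ! (i div 2)) else 0)"
      by (rule williamson_diag_index) (use ij in \<open>simp_all add: ds_def N_def\<close>)
    ultimately show "(M * B * transpose_mat M) $$ (i, j) = williamson_diag ds $$ (i, j)"
      using cong[OF B Bb ij] D[OF ij] by (cases "i = j") simp_all
  qed (use williamson_diag_carrier[of ds] M in \<open>auto simp: ds_def N_def\<close>)
  moreover have "sorted ds" "length ds = m" "\<forall>x\<in>set ds. 0 < x"
    using dpos dsort by (auto simp: ds_def sorted_iff_nth_mono)
  ultimately show ?thesis unfolding williamson_form_def by blast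
qed

lemma symplectic_eigenvalues_williamson:
  assumes "m \<ge> 1" "real_mat B" "pos_def (2 * m) B"
  shows "williamson_form m B (symplectic_eigenvalues m B)"
  unfolding symplectic_eigenvalues_def
proof (rule theI')
  have "B \<in> carrier_mat (2 * m) (2 * m)" using assms by (simp add: pos_def_def)
  then show "\<exists>!d. williamson_form m B d"
    using williamson_form_exists[OF assms] williamson_form_unique by blast
qed

section \<open>Entropy and traces of powers\<close>

definition mode_entropy :: "real \<Rightarrow> real" where
  "mode_entropy d = (2 * d + 1) / 2 * shannon_H ((2 * d - 1) / (2 * d + 1))"

text \<open>For X = J B this is the sum over the modes of the polynomial with coefficients
  \<open>a\<close> at d_j^2: the factor \<open>(-1) ^ i / 2\<close> undoes the sign and the double
  count of each mode in the trace.\<close>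

definition trace_poly :: "(nat \<Rightarrow> real) \<Rightarrow> nat \<Rightarrow> nat \<Rightarrow> (nat \<Rightarrow> nat \<Rightarrow> complex) \<Rightarrow> real" where
  "trace_poly a n N X = (\<Sum>i\<le>n. a i * ((-1) ^ i / 2) * Re (fmat_trace N (fmat_pow N X (2 * i))))"

lemma continuous_on_xlnx: "continuous_on {0..} (\<lambda>t::real. t * ln t)"
  unfolding continuous_on_eq_continuous_within
proof
  fix x :: real assume "x \<in> {0..}"
  then consider "x = 0" | "x > 0" by fastforce
  then show "continuous (at x within {0..}) (\<lambda>t. t * ln t)"
  proof cases
    case 1
    have "((\<lambda>t::real. t * ln t) \<longlongrightarrow> 0) (at_right 0)" by real_asymp
    then show ?thesis using 1 by (simp add: continuous_within at_within_Ici_at_right)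
  qed (auto intro!: continuous_intros)
qed

text \<open>For d < 1/2 the argument (2d - 1)/(2d + 1) is negative and \<open>shannon_H\<close>
  takes its default value 0. Cutting the argument off at 0 merges this range with the rest into one
  continuous formula, so the approximation can run over an interval starting at 0.\<close>

lemma shannon_H_max:
  "t < 1 \<Longrightarrow> shannon_H t = - (max t 0 * ln (max t 0)) - (1 - max t 0) * ln (1 - max t 0)"
  by (auto simp: shannon_H_def max_def)

lemma continuous_on_mode_entropy_sqrt: "continuous_on {0..} (\<lambda>s. mode_entropy (sqrt s))"
proof -
  have x: "continuous_on {0..} g \<Longrightarrow> (\<And>s. s \<in> {0..} \<Longrightarrow> g s \<in> {0..}) \<Longrightarrow>
      continuous_on {0..} (\<lambda>s. g s * ln (g s))" for g :: "real \<Rightarrow> real"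
    using continuous_on_compose2[OF continuous_on_xlnx, of "{0..}" g] by blast
  define u where "u s = max ((2 * sqrt s - 1) / (2 * sqrt s + 1)) 0" for s
  have nz: "2 * sqrt s + 1 \<noteq> 0" if "s \<in> {0..}" for s
  proof -
    have "0 \<le> sqrt s" using that by simp
    then show ?thesis by linarith
  qed
  have u: "continuous_on {0..} u"
    unfolding u_def using nz by (intro continuous_intros) auto
  have lt: "(2 * sqrt s - 1) / (2 * sqrt s + 1) < 1" if "s \<in> {0..}" for s
  proof -
    have "0 \<le> sqrt s" using that by simp
    then have "0 < 2 * sqrt s + 1" by linarith
    then show ?thesis by (simp add: pos_divide_less_eq del: divide_less_eq_1)
  qed
  have u1: "0 \<le> u s" "u s \<le> 1" if "s \<in> {0..}" for s
    using lt[OF that] by (auto simp: u_def)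
  have "continuous_on {0..} (\<lambda>s. (2 * sqrt s + 1) / 2 *
      (- (u s * ln (u s)) - (1 - u s) * ln (1 - u s)))"
  proof (rule continuous_on_mult[OF _ continuous_on_diff[OF continuous_on_minus]])
    show "continuous_on {0..} (\<lambda>s. u s * ln (u s))" by (rule x[OF u]) (use u1 in auto)
    show "continuous_on {0..} (\<lambda>s. (1 - u s) * ln (1 - u s))"
      by (rule x) (use u1 u in \<open>auto intro: continuous_on_diff\<close>)
  qed (intro continuous_intros, auto)
  then show ?thesis
    by (rule continuous_on_eq) (simp only: mode_entropy_def shannon_H_max[OF lt] u_def)
qed

lemma gaussian_entropy_eq:
  "gaussian_entropy m B = (\<Sum>j<m. mode_entropy (symplectic_eigenvalues m B ! j))"
  unfolding gaussian_entropy_def mode_entropy_def Let_def ..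

text \<open>A spectral radius argument: 2 d_j^(2l) is at most the modulus of the trace of the power
  2l, hence at most c R^(2l), for every l. If d_j exceeded R, geometric growth would beat the
  constant, whatever its size.\<close>

lemma symplectic_eigenvalues_le:
  assumes W: "williamson_form m B d" and B: "B \<in> carrier_mat (2 * m) (2 * m)" and R: "R > 0"
    and bound: "\<And>l. cmod (fmat_trace (2 * m) (fmat_pow (2 * m) (fmat_mult (2 * m) Jf (\<lambda>i j. B $$ (i, j))) l)) \<le> c * R ^ l"
    and j: "j < m"
  shows "d ! j \<le> R"
proof (rule ccontr)
  assume "\<not> d ! j \<le> R"
  then have gt: "(d ! j / R)\<^sup>2 > 1" using R by (intro one_less_power) auto
  have dj: "d ! j > 0" using W j by (auto simp: williamson_form_def)
  have "2 * ((d ! j / R)\<^sup>2) ^ l \<le> c" for l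
  proof -
    have nn: "0 \<le> (\<Sum>i<m. (d ! i) ^ (2 * l))" by (intro sum_nonneg) (simp add: power_mult)
    have "2 * (d ! j) ^ (2 * l) \<le> 2 * (\<Sum>i<m. (d ! i) ^ (2 * l))"
      using j by (intro mult_left_mono member_le_sum) (auto simp: power_mult)
    also have "\<dots> = cmod (of_real ((-1) ^ l * 2 * (\<Sum>i<m. (d ! i) ^ (2 * l))))"
      unfolding norm_of_real using nn by (simp add: abs_mult power_abs)
    also have "\<dots> \<le> c * R ^ (2 * l)"
      using bound[of "2 * l"] unfolding williamson_trace[OF W B] .
    finally show ?thesis using R by (simp add: power_divide power_mult[symmetric] field_simps)
  qed
  moreover obtain l where "((d ! j / R)\<^sup>2) ^ l > c" using real_arch_pow[OF gt] by blast
  moreover have "((d ! j / R)\<^sup>2) ^ l \<ge> 0" by simp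
  ultimately show False by (smt (verit))
qed

text \<open>Once the symplectic eigenvalues are confined to (0, R], a uniform approximation of the
  entropy of one mode in s = d^2 costs at most \<open>e\<close> per mode. The lemma is applied both
  to truncations and to values of the symbol, with the same \<open>R\<close>.\<close>

lemma gaussian_entropy_approx:
  assumes m: "m \<ge> 1" and re: "real_mat B" and pd: "pos_def (2 * m) B" and R: "R > 0"
    and bound: "\<And>l. cmod (fmat_trace (2 * m) (fmat_pow (2 * m) (fmat_mult (2 * m) Jf (\<lambda>i j. B $$ (i, j))) l)) \<le> c * R ^ l"
    and approx: "\<And>s. s \<in> {0..R\<^sup>2} \<Longrightarrow> \<bar>mode_entropy (sqrt s) - (\<Sum>i\<le>n. a i * s ^ i)\<bar> \<le> e"
  shows "\<bar>gaussian_entropy m B - trace_poly a n (2 * m) (fmat_mult (2 * m) Jf (\<lambda>i j. B $$ (i, j)))\<bar> \<le> real m * e"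
proof -
  define d where "d = symplectic_eigenvalues m B"
  have W: "williamson_form m B d" unfolding d_def by (rule symplectic_eigenvalues_williamson[OF m re pd])
  have B: "B \<in> carrier_mat (2 * m) (2 * m)" using pd by (simp add: pos_def_def)
  have dj: "0 < d ! j" "d ! j \<le> R" if "j < m" for j
    using symplectic_eigenvalues_le[OF W B R bound that] W that by (auto simp: williamson_form_def)
  have "trace_poly a n (2 * m) (fmat_mult (2 * m) Jf (\<lambda>i j. B $$ (i, j)))
      = (\<Sum>i\<le>n. a i * (\<Sum>j<m. (d ! j) ^ (2 * i)))"
    unfolding trace_poly_def williamson_trace[OF W B] Re_complex_of_real
  proof (rule sum.cong[OF refl])
    fix i
    have "(-1::real) ^ i * (-1) ^ i = 1" by (simp add: power_mult_distrib[symmetric])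
    then show "a i * ((-1) ^ i / 2) * ((-1) ^ i * 2 * (\<Sum>j<m. d ! j ^ (2 * i))) = a i * (\<Sum>j<m. d ! j ^ (2 * i))"
      by (simp add: algebra_simps) 
  qed
  also have "\<dots> = (\<Sum>j<m. \<Sum>i\<le>n. a i * ((d ! j)\<^sup>2) ^ i)"
    unfolding sum_distrib_left power_mult by (rule sum.swap)
  finally have T: "trace_poly a n (2 * m) (fmat_mult (2 * m) Jf (\<lambda>i j. B $$ (i, j)))
      = (\<Sum>j<m. \<Sum>i\<le>n. a i * ((d ! j)\<^sup>2) ^ i)" .
  have "\<bar>gaussian_entropy m B - trace_poly a n (2 * m) (fmat_mult (2 * m) Jf (\<lambda>i j. B $$ (i, j)))\<bar>
      = \<bar>\<Sum>j<m. mode_entropy (d ! j) - (\<Sum>i\<le>n. a i * ((d ! j)\<^sup>2) ^ i)\<bar>"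
    unfolding T gaussian_entropy_eq d_def by (simp add: sum_subtractf)
  also have "\<dots> \<le> (\<Sum>j<m. \<bar>mode_entropy (d ! j) - (\<Sum>i\<le>n. a i * ((d ! j)\<^sup>2) ^ i)\<bar>)"
    by (rule sum_abs)
  also have "\<dots> \<le> (\<Sum>j<m. e)"
  proof (rule sum_mono)
    fix j assume "j \<in> {..<m}"
    then have j: "0 < d ! j" "d ! j \<le> R" using dj by auto
    then have "(d ! j)\<^sup>2 \<in> {0..R\<^sup>2}" by (auto intro!: power_mono)
    from approx[OF this] show "\<bar>mode_entropy (d ! j) - (\<Sum>i\<le>n. a i * ((d ! j)\<^sup>2) ^ i)\<bar> \<le> e"
      using j by simp
  qed
  finally show ?thesis by simp
qed

lemma mode_entropy_polynomial_approx:
  assumes "e > 0"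
  obtains a n where "\<And>s. s \<in> {0..R\<^sup>2} \<Longrightarrow> \<bar>mode_entropy (sqrt s) - (\<Sum>i\<le>n. a i * s ^ i)\<bar> \<le> e"
proof -
  have "continuous_on {0..R\<^sup>2} (\<lambda>s. mode_entropy (sqrt s))"
    by (rule continuous_on_subset[OF continuous_on_mode_entropy_sqrt]) auto
  from Stone_Weierstrass_real_polynomial_function[OF _ this assms] obtain g where
    g: "real_polynomial_function g" "\<And>s. s \<in> {0..R\<^sup>2} \<Longrightarrow> \<bar>mode_entropy (sqrt s) - g s\<bar> < e"
    by auto
  from g(1) obtain a n where "g = (\<lambda>x. \<Sum>i\<le>n. a i * x ^ i)"
    unfolding real_polynomial_function_iff_sum by blast
  with g(2) show ?thesis by (intro that[of a n]) (auto intro: less_imp_le)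
qed

section \<open>Block Toeplitz matrices\<close>

lemma toeplitz_asym_cong:
  assumes "toeplitz_asym X f" "\<And>n i j. i < n \<Longrightarrow> j < n \<Longrightarrow> X n i j = Y n i j"
  shows "toeplitz_asym Y f"
proof -
  have "frob_sq n (\<lambda>i j. X n i j - toeplitz f i j) = frob_sq n (\<lambda>i j. Y n i j - toeplitz f i j)" for n
    by (rule frob_sq_cong) (simp add: assms(2))
  then show ?thesis using assms(1) by (simp add: toeplitz_asym_def)
qed

lemma toeplitz_const: "toeplitz (\<lambda>t. c) i j = (if i = j then c else 0)"
  using fourier_cmult[of c "character 0"] by (simp add: toeplitz_def fourier_character)

lemma sum_blocks: "(\<Sum>s<n * N. h s) = (\<Sum>u<n. \<Sum>r<N. h (u * N + r))" for h :: "nat \<Rightarrow> 'a::comm_monoid_add"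
proof -
  have "(\<Sum>s<n * N. h s) = (\<Sum>u<n. sum h {u * N..<u * N + N})" by (rule sum.nat_group[symmetric])
  also have "\<dots> = (\<Sum>u<n. \<Sum>r<N. h (u * N + r))"
    by (subst sum.atLeastLessThan_shift_0) (simp add: lessThan_atLeast0 o_def)
  finally show ?thesis .
qed

lemma block_index_less: "i < n \<Longrightarrow> p < N \<Longrightarrow> i * N + p < n * (N :: nat)"
proof -
  assume "i < n" "p < N"
  then have "i * N + p < Suc i * N" by simp
  also have "\<dots> \<le> n * N" using \<open>i < n\<close> by (intro mult_le_mono1) simp
  finally show ?thesis .
qed

lemma fmat_pow_cong:
  assumes "\<And>i j. i < n \<Longrightarrow> j < n \<Longrightarrow> X i j = Y i j"
  shows "i < n \<Longrightarrow> j < n \<Longrightarrow> fmat_pow n X l i j = fmat_pow n Y l i j"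
proof (induction l arbitrary: i j)
  case (Suc l) then show ?case using assms by (simp add: fmat_mult_def)
qed simp

text \<open>The \<open>(i, j)\<close> block is the matrix of the Fourier coefficients of index \<open>i - j\<close> of the entries of \<open>b\<close>.\<close>

definition block_symbol :: "nat \<Rightarrow> (real \<Rightarrow> nat \<Rightarrow> nat \<Rightarrow> complex) \<Rightarrow> nat \<Rightarrow> nat \<Rightarrow> complex" where
  "block_symbol N b s r = toeplitz (\<lambda>t. b t (s mod N) (r mod N)) (s div N) (r div N)"

lemma block_symbol_index:
  "p < N \<Longrightarrow> q < N \<Longrightarrow> block_symbol N b (i * N + p) (j * N + q) = toeplitz (\<lambda>t. b t p q) i j"
  by (simp add: block_symbol_def)

text \<open>For fixed positions p, q inside the blocks, the matrix indexed by the block numbers i, j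
  is a sum of products whose right factors are scalar Toeplitz matrices. This is the shape that the
  scalar product lemma accepts.\<close>

lemma fmat_pow_block_symbol_Suc:
  assumes "p < N" "q < N"
  shows "fmat_pow (n * N) (block_symbol N b) (Suc l) (i * N + p) (j * N + q)
    = (\<Sum>r<N. fmat_mult n (\<lambda>i j. fmat_pow (n * N) (block_symbol N b) l (i * N + p) (j * N + r)) (toeplitz (\<lambda>t. b t r q)) i j)"
proof -
  have "fmat_pow (n * N) (block_symbol N b) (Suc l) (i * N + p) (j * N + q)
    = (\<Sum>u<n. \<Sum>r<N. fmat_pow (n * N) (block_symbol N b) l (i * N + p) (u * N + r) * toeplitz (\<lambda>t. b t r q) u j)"
    unfolding fmat_pow.simps fmat_mult_def sum_blocks by (intro sum.cong refl) (simp add: block_symbol_index assms)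
  also have "\<dots> = (\<Sum>r<N. \<Sum>u<n. fmat_pow (n * N) (block_symbol N b) l (i * N + p) (u * N + r) * toeplitz (\<lambda>t. b t r q) u j)"
    by (rule sum.swap)
  finally show ?thesis by (simp add: fmat_mult_def)
qed

lemma ess_bounded_fmat_pow:
  assumes "\<And>p q. p < N \<Longrightarrow> q < N \<Longrightarrow> ess_bounded (\<lambda>t. b t p q)" "p < N" "q < N"
  shows "ess_bounded (\<lambda>t. fmat_pow N (b t) l p q)"
  using assms(2,3)
proof (induction l arbitrary: p q)
  case (Suc l)
  then show ?case unfolding fmat_pow.simps fmat_mult_def by (intro ess_bounded_sum ess_bounded_mult Suc.IH assms(1)) auto
qed simp

lemma toeplitz_asym_fmat_pow:
  assumes b: "\<And>p q. p < N \<Longrightarrow> q < N \<Longrightarrow> ess_bounded (\<lambda>t. b t p q)" and pq: "p < N" "q < N"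
  shows "toeplitz_asym (\<lambda>n i j. fmat_pow (n * N) (block_symbol N b) l (i * N + p) (j * N + q)) (\<lambda>t. fmat_pow N (b t) l p q)"
  using pq
proof (induction l arbitrary: p q)
  case 0
  have "i * N + p = j * N + q \<longleftrightarrow> i = j \<and> p = q" for i j
  proof
    assume eq: "i * N + p = j * N + q"
    have "(i * N + p) div N = i" "(i * N + p) mod N = p" "(j * N + q) div N = j" "(j * N + q) mod N = q"
      using 0 by auto
    with eq show "i = j \<and> p = q" by metis
  qed simp
  then show ?case
    by (intro toeplitz_asym_cong[OF toeplitz_asym_self]) (auto simp: toeplitz_const)
next
  case (Suc l)
  show ?case
    unfolding fmat_pow_block_symbol_Suc[OF Suc.prems]
    by (simp only: fmat_pow.simps fmat_mult_def[of N], intro toeplitz_asym_sum toeplitz_asym_mult Suc.IH ess_bounded_mult ess_bounded_fmat_pow b)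
       (use Suc.prems in auto)
qed

lemma fmat_trace_fmat_pow_block_symbol_limit:
  assumes b: "\<And>p q. p < N \<Longrightarrow> q < N \<Longrightarrow> ess_bounded (\<lambda>t. b t p q)"
  shows "(\<lambda>n. fmat_trace (n * N) (fmat_pow (n * N) (block_symbol N b) l) / of_nat n)
    \<longlonglongrightarrow> mean (\<lambda>t. fmat_trace N (fmat_pow N (b t) l))"
proof -
  have "(\<lambda>n. \<Sum>p<N. (\<Sum>i<n. fmat_pow (n * N) (block_symbol N b) l (i * N + p) (i * N + p)) / of_nat n)
      \<longlonglongrightarrow> (\<Sum>p<N. mean (\<lambda>t. fmat_pow N (b t) l p p))"
    using toeplitz_asym_trace[OF toeplitz_asym_fmat_pow[OF b]] by (intro tendsto_sum) auto
  moreover have "fmat_trace (n * N) (fmat_pow (n * N) (block_symbol N b) l) / of_nat n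
      = (\<Sum>p<N. (\<Sum>i<n. fmat_pow (n * N) (block_symbol N b) l (i * N + p) (i * N + p)) / of_nat n)" for n
    unfolding fmat_trace_def sum_blocks sum_divide_distrib[symmetric] by (subst sum.swap) simp
  moreover have "mean (\<lambda>t. fmat_trace N (fmat_pow N (b t) l)) = (\<Sum>p<N. mean (\<lambda>t. fmat_pow N (b t) l p p))"
    unfolding fmat_trace_def by (rule mean_sum) (auto intro: ess_bounded_fmat_pow b)
  ultimately show ?thesis by simp
qed

section \<open>Geometric bounds for traces of powers\<close>

lemma norm_sum_sq_le:
  fixes z :: "nat \<Rightarrow> complex"
  shows "(cmod (\<Sum>r<N. z r))\<^sup>2 \<le> real N * (\<Sum>r<N. (cmod (z r))\<^sup>2)"
proof -
  have "(cmod (\<Sum>r<N. z r))\<^sup>2 \<le> (\<Sum>r<N. 1 * cmod (z r))\<^sup>2"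
    using norm_sum by (intro power_mono) auto
  also have "\<dots> \<le> (\<Sum>r<N. 1\<^sup>2) * (\<Sum>r<N. (cmod (z r))\<^sup>2)" by (rule Cauchy_Schwarz_ineq_sum)
  finally show ?thesis by simp
qed

lemma frob_sq_sum_le: "frob_sq n (\<lambda>i j. \<Sum>r<N. X r i j) \<le> real N * (\<Sum>r<N. frob_sq n (X r))"
proof -
  have "frob_sq n (\<lambda>i j. \<Sum>r<N. X r i j) \<le> (\<Sum>i<n. \<Sum>j<n. real N * (\<Sum>r<N. (cmod (X r i j))\<^sup>2))"
    unfolding frob_sq_def by (intro sum_mono norm_sum_sq_le)
  also have "\<dots> = real N * (\<Sum>i<n. \<Sum>j<n. \<Sum>r<N. (cmod (X r i j))\<^sup>2)"
    by (simp add: sum_distrib_left)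
  also have "(\<Sum>i<n. \<Sum>j<n. \<Sum>r<N. (cmod (X r i j))\<^sup>2) = (\<Sum>i<n. \<Sum>r<N. \<Sum>j<n. (cmod (X r i j))\<^sup>2)"
    by (intro sum.cong refl sum.swap)
  also have "\<dots> = (\<Sum>r<N. frob_sq n (X r))" unfolding frob_sq_def by (rule sum.swap)
  finally show ?thesis .
qed

text \<open>Each further factor costs (N C)^2: one N from the squared norm of a sum of N terms, one
  from adding up N summands, and C^2 from multiplication by a scalar Toeplitz matrix. The zeroth
  power contributes at most n.\<close>

lemma frob_sq_fmat_pow_block_symbol:
  assumes b: "\<And>p q. p < N \<Longrightarrow> q < N \<Longrightarrow> ess_bounded (\<lambda>t. b t p q)"
    and C: "\<And>p q. p < N \<Longrightarrow> q < N \<Longrightarrow> AE t in circ. cmod (b t p q) \<le> C"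
    and pq: "p < N" "q < N"
  shows "frob_sq n (\<lambda>i j. fmat_pow (n * N) (block_symbol N b) l (i * N + p) (j * N + q)) \<le> real n * ((real N * C)\<^sup>2) ^ l"
  using pq
proof (induction l arbitrary: p q)
  case 0
  have "frob_sq n (\<lambda>i j. fmat_pow (n * N) (block_symbol N b) 0 (i * N + p) (j * N + q)) \<le> (\<Sum>i<n. \<Sum>j<n. if i = j then 1 else 0)"
    unfolding frob_sq_def
  proof (intro sum_mono)
    fix i j
    show "(cmod (fmat_pow (n * N) (block_symbol N b) 0 (i * N + p) (j * N + q)))\<^sup>2 \<le> (if i = j then 1 else 0)"
    proof (cases "i = j")
      case False
      have "i * N + p \<noteq> j * N + q"
      proof
        assume "i * N + p = j * N + q"
        moreover have "(i * N + p) div N = i" "(j * N + q) div N = j" using 0 by auto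
        ultimately show False using False by metis
      qed
      then show ?thesis by simp
    qed simp
  qed
  then show ?case by simp
next
  case (Suc l)
  define Y where "Y r = (\<lambda>i j. fmat_pow (n * N) (block_symbol N b) l (i * N + p) (j * N + r))" for r
  have "frob_sq n (\<lambda>i j. fmat_pow (n * N) (block_symbol N b) (Suc l) (i * N + p) (j * N + q))
      = frob_sq n (\<lambda>i j. \<Sum>r<N. fmat_mult n (Y r) (toeplitz (\<lambda>t. b t r q)) i j)"
    unfolding fmat_pow_block_symbol_Suc[OF Suc.prems] Y_def ..
  also have "\<dots> \<le> real N * (\<Sum>r<N. frob_sq n (fmat_mult n (Y r) (toeplitz (\<lambda>t. b t r q))))"
    by (rule frob_sq_sum_le)
  also have "\<dots> \<le> real N * (\<Sum>r<N. C\<^sup>2 * (real n * ((real N * C)\<^sup>2) ^ l))"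
  proof (intro mult_left_mono sum_mono)
    fix r assume "r \<in> {..<N}"
    then have r: "r < N" by simp
    have "frob_sq n (fmat_mult n (Y r) (toeplitz (\<lambda>t. b t r q))) \<le> C\<^sup>2 * frob_sq n (Y r)"
      using Suc.prems r by (intro frob_sq_fmat_mult_toeplitz_right b C)
    also have "\<dots> \<le> C\<^sup>2 * (real n * ((real N * C)\<^sup>2) ^ l)"
      unfolding Y_def using Suc.prems r by (intro mult_left_mono Suc.IH) auto
    finally show "frob_sq n (fmat_mult n (Y r) (toeplitz (\<lambda>t. b t r q))) \<le> C\<^sup>2 * (real n * ((real N * C)\<^sup>2) ^ l)" .
  qed simp
  also have "\<dots> = real n * ((real N * C)\<^sup>2) ^ Suc l"
    by (simp add: power_mult_distrib power2_eq_square mult_ac)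
  finally show ?case .
qed

text \<open>Each diagonal entry is estimated by the whole Hilbert-Schmidt norm. The wasteful
  prefactor depends on n but not on l, which is all that the bound on symplectic eigenvalues
  requires; the base N C is the same for all n.\<close>

lemma fmat_trace_fmat_pow_block_symbol_bound:
  assumes b: "\<And>p q. p < N \<Longrightarrow> q < N \<Longrightarrow> ess_bounded (\<lambda>t. b t p q)"
    and C: "\<And>p q. p < N \<Longrightarrow> q < N \<Longrightarrow> AE t in circ. cmod (b t p q) \<le> C" and C0: "C > 0"
  shows "cmod (fmat_trace (n * N) (fmat_pow (n * N) (block_symbol N b) l)) \<le> (real n * real N * sqrt (real n)) * (real N * C) ^ l"
proof -
  have e: "cmod (fmat_pow (n * N) (block_symbol N b) l (i * N + p) (i * N + p)) \<le> sqrt (real n) * (real N * C) ^ l"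
    if i: "i < n" and p: "p < N" for i p
  proof -
    define Y where "Y = (\<lambda>i j. fmat_pow (n * N) (block_symbol N b) l (i * N + p) (j * N + p))"
    have "(cmod (Y i i))\<^sup>2 \<le> (\<Sum>j<n. (cmod (Y i j))\<^sup>2)"
      using i by (intro member_le_sum) auto
    also have "\<dots> \<le> frob_sq n Y"
      unfolding frob_sq_def using i
      by (intro member_le_sum[of i "{..<n}" "\<lambda>i. \<Sum>j<n. (cmod (Y i j))\<^sup>2"] sum_nonneg) auto
    also have "\<dots> \<le> real n * ((real N * C)\<^sup>2) ^ l"
      unfolding Y_def by (rule frob_sq_fmat_pow_block_symbol[OF b C p p])
    also have "\<dots> = (sqrt (real n) * (real N * C) ^ l)\<^sup>2"
      by (simp add: power_mult_distrib power_mult[symmetric] mult.commute)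
    finally show ?thesis unfolding Y_def by (rule power2_le_imp_le) (use C0 in simp)
  qed
  have "cmod (fmat_trace (n * N) (fmat_pow (n * N) (block_symbol N b) l))
      \<le> (\<Sum>i<n. \<Sum>p<N. sqrt (real n) * (real N * C) ^ l)"
    unfolding fmat_trace_def sum_blocks by (intro sum_norm_le e) auto
  then show ?thesis by (simp add: mult_ac)
qed

lemma fmat_pow_bound:
  assumes C: "\<And>p q. p < N \<Longrightarrow> q < N \<Longrightarrow> cmod (X p q) \<le> C"
  shows "p < N \<Longrightarrow> q < N \<Longrightarrow> cmod (fmat_pow N X l p q) \<le> (real N * C) ^ l"
proof (induction l arbitrary: p q)
  case (Suc l)
  have "cmod (fmat_pow N X (Suc l) p q) \<le> (\<Sum>r<N. (real N * C) ^ l * C)"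
    unfolding fmat_pow.simps fmat_mult_def
  proof (rule sum_norm_le)
    fix r assume "r \<in> {..<N}"
    then have r: "r < N" by simp
    have "0 \<le> (real N * C) ^ l" using Suc.IH[OF Suc.prems(1) r] norm_ge_zero order_trans by blast
    then show "cmod (fmat_pow N X l p r * X r q) \<le> (real N * C) ^ l * C"
      unfolding norm_mult using Suc r by (intro mult_mono C Suc.IH) auto
  qed
  then show ?case by (simp add: mult_ac)
qed simp

text \<open>The pointwise counterpart, with the same base N C, so that values of the symbol and
  truncations share one interval for their symplectic eigenvalues.\<close>

lemma fmat_trace_fmat_pow_bound:
  assumes C: "\<And>p q. p < N \<Longrightarrow> q < N \<Longrightarrow> cmod (X p q) \<le> C"
  shows "cmod (fmat_trace N (fmat_pow N X l)) \<le> real N * (real N * C) ^ l"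
proof -
  have "cmod (fmat_trace N (fmat_pow N X l)) \<le> (\<Sum>i<N. (real N * C) ^ l)"
    unfolding fmat_trace_def using fmat_pow_bound[OF C] by (intro sum_norm_le) auto
  then show ?thesis by simp
qed

section \<open>Bounded partially symmetric G-chains\<close>

lemma fmat_mult_Jf: "s < 2 * m \<Longrightarrow> fmat_mult (2 * m) Jf X s r = mode_sign s * X (partner s) r"
proof -
  assume s: "s < 2 * m"
  have "fmat_mult (2 * m) Jf X s r = (\<Sum>l<2 * m. if l = partner s then mode_sign s * X l r else 0)"
    unfolding fmat_mult_def by (rule sum.cong) (auto simp: Jf_def)
  then show ?thesis using s by simp
qed

lemma partner_block: "partner (i * (2 * k) + p) = i * (2 * k) + partner p"
  by (auto simp: partner_def elim!: oddE)

lemma mode_sign_block: "mode_sign (i * (2 * k) + p) = mode_sign p"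
  by (simp add: mode_sign_def)

lemma Jf_block:
  assumes "p < 2 * k" "q < 2 * k"
  shows "Jf (i * (2 * k) + p) (j * (2 * k) + q) = (if i = j then Jf p q else 0)"
proof -
  have "j * (2 * k) + q = i * (2 * k) + partner p \<longleftrightarrow> i = j \<and> q = partner p"
  proof
    assume eq: "j * (2 * k) + q = i * (2 * k) + partner p"
    have "partner p < 2 * k" using assms by simp
    then have "(i * (2 * k) + partner p) div (2 * k) = i" "(j * (2 * k) + q) div (2 * k) = j"
      using assms by auto
    with eq show "i = j \<and> q = partner p" by (metis add_left_cancel)
  qed simp
  then show ?thesis by (simp add: Jf_def partner_block mode_sign_block)
qed

lemma toeplitz_sum: "(\<And>i. i \<in> I \<Longrightarrow> ess_bounded (f i)) \<Longrightarrow> toeplitz (\<lambda>t. \<Sum>i\<in>I. f i t) r s = (\<Sum>i\<in>I. toeplitz (f i) r s)"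
  unfolding toeplitz_def by (rule fourier_sum)

text \<open>Testing \<open>A + (\<i>/2) J \<ge> 0\<close> on \<open>u + \<i> \<sigma> J u\<close> with a small \<open>\<sigma> < 0\<close> gives a lower bound for \<open>A\<close> by a positive
  multiple of the identity. Such a bound passes from integer vectors to all vectors, so that countably
  many exceptional null sets suffice.\<close>

lemma Re_hermitian_form:
  fixes A :: "nat \<Rightarrow> nat \<Rightarrow> real" and u :: "nat \<Rightarrow> real" and \<sigma> :: real
  defines "w \<equiv> \<lambda>p. mode_sign p * u (partner p)"
  defines "v \<equiv> \<lambda>p. complex_of_real (u p) + \<i> * of_real (\<sigma> * w p)"
  shows "Re (\<Sum>p<2 * k. \<Sum>q<2 * k. cnj (v p) * (of_real (A p q) + \<i> / 2 * Jf p q) * v q)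
    = bil (2 * k) A u u + \<sigma>\<^sup>2 * bil (2 * k) A w w + \<sigma> * (\<Sum>p<2 * k. (u p)\<^sup>2)"
proof -
  have J: "Jf p q = complex_of_real (Jf p q)" for p q by (simp add: Jf_def mode_sign_def)
  have "Re (cnj (v p) * (of_real (A p q) + \<i> / 2 * Jf p q) * v q)
     = u p * A p q * u q + \<sigma>\<^sup>2 * (w p * A p q * w q)
       - \<sigma> / 2 * (u p * Jf p q * w q) + \<sigma> / 2 * (w p * Jf p q * u q)" for p q
    unfolding J v_def by (simp add: algebra_simps power2_eq_square)
  then have "Re (\<Sum>p<2 * k. \<Sum>q<2 * k. cnj (v p) * (of_real (A p q) + \<i> / 2 * Jf p q) * v q)
    = bil (2 * k) A u u + \<sigma>\<^sup>2 * bil (2 * k) A w w - \<sigma> / 2 * bil (2 * k) Jf u w + \<sigma> / 2 * bil (2 * k) Jf w u"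
    by (simp only: Re_sum bil_def sum.distrib sum_subtractf sum_distrib_left)
  moreover have "bil (2 * k) Jf u w = - (\<Sum>p<2 * k. (u p)\<^sup>2)"
  proof -
    have "u p * mode_sign p * w (partner p) = - (u p)\<^sup>2" for p
      by (simp add: w_def, simp add: mode_sign_def power2_eq_square)
    then show ?thesis by (simp add: bil_J sum_negf)
  qed
  moreover have "bil (2 * k) Jf w u = (\<Sum>p<2 * k. (u p)\<^sup>2)"
    using bil_J_antisym[of k w u] calculation(2) by simp
  ultimately show ?thesis by simp
qed

lemma bil_le:
  fixes A :: "nat \<Rightarrow> nat \<Rightarrow> real"
  assumes "\<And>p q. p < N \<Longrightarrow> q < N \<Longrightarrow> \<bar>A p q\<bar> \<le> C" "C \<ge> 0"
  shows "bil N A w w \<le> C * real N * (\<Sum>p<N. (w p)\<^sup>2)"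
proof -
  have "bil N A w w \<le> (\<Sum>p<N. \<Sum>q<N. C * (\<bar>w p\<bar> * \<bar>w q\<bar>))"
    unfolding bil_def
  proof (intro sum_mono)
    fix p q assume "p \<in> {..<N}" "q \<in> {..<N}"
    have "w p * A p q * w q \<le> \<bar>A p q\<bar> * (\<bar>w p\<bar> * \<bar>w q\<bar>)"
      using abs_ge_self[of "w p * A p q * w q"] by (simp add: abs_mult mult_ac)
    also have "\<dots> \<le> C * (\<bar>w p\<bar> * \<bar>w q\<bar>)"
      using assms(1) \<open>p \<in> {..<N}\<close> \<open>q \<in> {..<N}\<close> by (intro mult_right_mono) auto
    finally show "w p * A p q * w q \<le> C * (\<bar>w p\<bar> * \<bar>w q\<bar>)" .
  qed
  also have "\<dots> = C * (\<Sum>p<N. 1 * \<bar>w p\<bar>)\<^sup>2"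
  proof -
    have "(\<Sum>p<N. 1 * \<bar>w p\<bar>)\<^sup>2 = (\<Sum>p<N. \<Sum>q<N. \<bar>w p\<bar> * \<bar>w q\<bar>)"
      by (simp only: power2_eq_square sum_product) simp
    then show ?thesis by (simp only: sum_distrib_left)
  qed
  also have "\<dots> \<le> C * ((\<Sum>p<N. 1\<^sup>2) * (\<Sum>p<N. \<bar>w p\<bar>\<^sup>2))"
    using assms(2) by (intro mult_left_mono Cauchy_Schwarz_ineq_sum)
  finally show ?thesis by (simp add: mult_ac)
qed

text \<open>Both sides are homogeneous of degree two, so the bound extends to z / n; with z the
  floor of n u these vectors converge to u. The term n = 0 is harmless because 1 / 0 is 0.\<close>

lemma bil_lower_bound_from_integers:
  fixes A :: "nat \<Rightarrow> nat \<Rightarrow> real" and u :: "nat \<Rightarrow> real"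
  assumes "\<And>z :: nat \<Rightarrow> int. c * (\<Sum>p<N. (real_of_int (z p))\<^sup>2) \<le> bil N A (\<lambda>p. real_of_int (z p)) (\<lambda>p. real_of_int (z p))"
  shows "c * (\<Sum>p<N. (u p)\<^sup>2) \<le> bil N A u u"
proof (rule LIMSEQ_le)
  define x where "x n p = real_of_int \<lfloor>real n * u p\<rfloor> / real n" for n p
  have x: "(\<lambda>n. x n p) \<longlonglongrightarrow> u p" for p
    unfolding x_def by real_asymp
  show "(\<lambda>n. c * (\<Sum>p<N. (x n p)\<^sup>2)) \<longlonglongrightarrow> c * (\<Sum>p<N. (u p)\<^sup>2)"
    by (intro tendsto_intros x)
  show "(\<lambda>n. bil N A (x n) (x n)) \<longlonglongrightarrow> bil N A u u"
    unfolding bil_def by (intro tendsto_intros x)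
  show "\<exists>n0. \<forall>n\<ge>n0. c * (\<Sum>p<N. (x n p)\<^sup>2) \<le> bil N A (x n) (x n)"
  proof (intro exI allI impI)
    fix n
    define z where "z p = \<lfloor>real n * u p\<rfloor>" for p
    have xz: "x n = (\<lambda>p. (1 / real n) * real_of_int (z p))" by (auto simp: x_def z_def)
    have "c * (\<Sum>p<N. (x n p)\<^sup>2) = (1 / real n)\<^sup>2 * (c * (\<Sum>p<N. (real_of_int (z p))\<^sup>2))"
      unfolding xz power_mult_distrib sum_distrib_left[symmetric] by simp
    also have "\<dots> \<le> (1 / real n)\<^sup>2 * bil N A (\<lambda>p. real_of_int (z p)) (\<lambda>p. real_of_int (z p))"
      by (intro mult_left_mono assms) simp
    also have "\<dots> = bil N A (x n) (x n)"
      unfolding xz bil_cmult_left bil_cmult_right by (simp add: power2_eq_square)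
    finally show "c * (\<Sum>p<N. (x n p)\<^sup>2) \<le> bil N A (x n) (x n)" .
  qed
qed

text \<open>For a real symmetric matrix the cross terms of the complex form at x + i y cancel,
  leaving the sum of the real forms at x and at y.\<close>

lemma pos_def_realI:
  fixes B :: "complex mat"
  assumes B: "B \<in> carrier_mat N N" and re: "\<And>p q. p < N \<Longrightarrow> q < N \<Longrightarrow> B $$ (p, q) = of_real (A p q)"
    and sym: "\<And>p q. p < N \<Longrightarrow> q < N \<Longrightarrow> A p q = A q p"
    and pd: "\<And>u. (\<exists>p<N. u p \<noteq> 0) \<Longrightarrow> 0 < bil N A u u"
  shows "real_mat B" "pos_def N B"
proof -
  show "real_mat B" using B re by (intro real_matI) auto
  have "mat_adjoint B = B"
  proof (rule eq_matI)
    fix i j assume "i < dim_row B" "j < dim_col B"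
    then show "mat_adjoint B $$ (i, j) = B $$ (i, j)"
      using B re sym by (simp add: mat_adjoint_index)
  qed (use B in \<open>auto simp: mat_adjoint_def\<close>)
  moreover have "0 < (B *\<^sub>v v) \<bullet>c v" if v: "v \<in> carrier_vec N" "v \<noteq> 0\<^sub>v N" for v
  proof -
    define x y where "x p = Re (v $ p)" and "y p = Im (v $ p)" for p
    have "(B *\<^sub>v v) \<bullet>c v = (\<Sum>p<N. \<Sum>q<N. cnj (v $ p) * of_real (A p q) * v $ q)"
      unfolding quadratic_form_vec[OF B v(1)] by (simp add: re)
    also have "\<dots> = (\<Sum>p<N. \<Sum>q<N. of_real (x p * A p q * x q + y p * A p q * y q)
        + \<i> * of_real (x p * A p q * y q - y p * A p q * x q))"
      by (intro sum.cong refl) (simp add: complex_eq_iff x_def y_def algebra_simps)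
    also have "\<dots> = of_real (bil N A x x + bil N A y y) + \<i> * of_real (bil N A x y - bil N A y x)"
      by (simp add: bil_def sum.distrib sum_subtractf sum_distrib_left right_diff_distrib)
    also have "bil N A x y = bil N A y x" by (rule bil_sym) (rule sym)
    finally have eq: "(B *\<^sub>v v) \<bullet>c v = of_real (bil N A x x + bil N A y y)" by simp
    have nn: "0 \<le> bil N A u u" for u
    proof (cases "\<exists>p<N. u p \<noteq> 0")
      case False then show ?thesis by (simp add: bil_def)
    qed (use pd in \<open>simp add: less_imp_le\<close>)
    have "\<exists>p<N. v $ p \<noteq> 0"
    proof (rule ccontr)
      assume "\<not> (\<exists>p<N. v $ p \<noteq> 0)"
      then have "v = 0\<^sub>v N" using v(1) by (intro eq_vecI) auto
      then show False using v(2) by simp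
    qed
    then have "(\<exists>p<N. x p \<noteq> 0) \<or> (\<exists>p<N. y p \<noteq> 0)" by (auto simp: x_def y_def complex_eq_iff)
    then have "0 < bil N A x x + bil N A y y"
      using pd[of x] pd[of y] nn[of x] nn[of y] by (metis add_pos_nonneg add_nonneg_pos)
    then show ?thesis unfolding eq by (simp add: less_complex_def)
  qed
  ultimately show "pos_def N B" using B by (simp add: pos_def_def)
qed

text \<open>Completeness of Lebesgue measure, transferred to the interval through extension by
  0.\<close>

lemma borel_measurable_circ_AE:
  fixes f g :: "real \<Rightarrow> real"
  assumes "f \<in> borel_measurable circ" "AE t in circ. f t = g t"
  shows "g \<in> borel_measurable circ"
proof -
  have "(\<lambda>t. if t \<in> {-pi..pi} then f t else 0) \<in> borel_measurable lebesgue"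
    using assms(1) by (subst borel_measurable_if) auto
  moreover have "AE t in lebesgue. t \<in> {-pi..pi} \<longrightarrow> f t = g t"
    using assms(2) by (subst (asm) AE_restrict_space_iff) auto
  then have "AE t in lebesgue. (if t \<in> {-pi..pi} then f t else 0) = (if t \<in> {-pi..pi} then g t else 0)"
    by (rule eventually_mono) auto
  ultimately have "(\<lambda>t. if t \<in> {-pi..pi} then g t else 0) \<in> borel_measurable lebesgue"
    by (rule borel_measurable_AE)
  then show ?thesis by (subst (asm) borel_measurable_if) auto
qed

section \<open>Almost everywhere properties of the symbol\<close>

locale G_chain =
  fixes k :: nat and a :: "real \<Rightarrow> complex mat"
  assumes k: "k \<ge> 1"
    and Linfty: "Linfty_mat (2 * k) a"
    and chain: "stationary_G_chain k (toeplitz_of_symbol (2 * k) a)"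
    and symmetric: "partially_symmetric (fourier_coeff (2 * k) a)"
begin

abbreviation Bn :: "nat \<Rightarrow> complex mat" where
  "Bn n \<equiv> block_trunc (2 * k) (toeplitz_of_symbol (2 * k) a) n"

lemma ess_bounded_symbol: "p < 2 * k \<Longrightarrow> q < 2 * k \<Longrightarrow> ess_bounded (\<lambda>t. a t $$ (p, q))"
  using Linfty unfolding Linfty_mat_def ess_bounded_def by blast

lemma fourier_coeff_index:
  "p < 2 * k \<Longrightarrow> q < 2 * k \<Longrightarrow> fourier_coeff (2 * k) a n $$ (p, q) = fourier (\<lambda>t. a t $$ (p, q)) n"
  by (simp add: fourier_coeff_def fourier_def mean_def character_def)

lemma Bn_carrier: "Bn n \<in> carrier_mat (n * (2 * k)) (n * (2 * k))"
  by (simp add: block_trunc_def)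

lemma Bn_index:
  assumes "s < n * (2 * k)" "r < n * (2 * k)"
  shows "Bn n $$ (s, r) = toeplitz (\<lambda>t. a t $$ (s mod (2 * k), r mod (2 * k))) (s div (2 * k)) (r div (2 * k))"
  using assms k by (simp add: block_trunc_def toeplitz_of_symbol_def block_toeplitz_def toeplitz_def fourier_coeff_index)

lemma Bn_block:
  assumes "i < n" "j < n" "p < 2 * k" "q < 2 * k"
  shows "Bn n $$ (i * (2 * k) + p, j * (2 * k) + q) = toeplitz (\<lambda>t. a t $$ (p, q)) i j"
  using Bn_index[OF block_index_less[OF assms(1,3)] block_index_less[OF assms(2,4)]] assms by simp

lemma G_matrix_Bn: "n \<ge> 1 \<Longrightarrow> G_matrix (n * k) (Bn n)"
  using chain unfolding stationary_G_chain_def by blast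

lemma fourier_even: "p < 2 * k \<Longrightarrow> q < 2 * k \<Longrightarrow> fourier (\<lambda>t. a t $$ (p, q)) (- n) = fourier (\<lambda>t. a t $$ (p, q)) n"
proof -
  assume pq: "p < 2 * k" "q < 2 * k"
  have *: "fourier (\<lambda>t. a t $$ (p, q)) (- int m) = fourier (\<lambda>t. a t $$ (p, q)) (int m)" for m
    using symmetric pq unfolding partially_symmetric_def by (metis fourier_coeff_index)
  show ?thesis using *[of "nat n"] *[of "nat (- n)"] by (cases "n \<ge> 0") auto
qed

lemma fourier_real: "p < 2 * k \<Longrightarrow> q < 2 * k \<Longrightarrow> cnj (fourier (\<lambda>t. a t $$ (p, q)) n) = fourier (\<lambda>t. a t $$ (p, q)) n"
proof -
  assume pq: "p < 2 * k" "q < 2 * k"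
  have "real_mat (fourier_coeff (2 * k) a n)" using symmetric by (simp add: partially_symmetric_def)
  from real_mat_index[OF this, of p q] show ?thesis
    using pq fourier_coeff_index[OF pq, of n] by (simp add: fourier_coeff_def complex_is_Real_iff complex_eq_iff)
qed

text \<open>The conjugate function has the coefficients cnj (A_(-n)), which equal A_n because the
  coefficients are real and even in n. Equal coefficients mean equality almost everywhere.\<close>

lemma AE_symbol_real:
  assumes "p < 2 * k" "q < 2 * k"
  shows "AE t in circ. Im (a t $$ (p, q)) = 0"
proof -
  have "AE t in circ. cnj (a t $$ (p, q)) = a t $$ (p, q)"
    by (rule fourier_eq_imp_AE_eq) (use assms in \<open>auto intro!: ess_bounded_symbol ess_bounded_cnj simp: fourier_cnj fourier_real fourier_even\<close>)
  then show ?thesis by eventually_elim (auto simp: complex_eq_iff)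
qed

text \<open>The truncation to m + 1 blocks is Hermitian; comparing its corner blocks (m, 0) and (0,
  m) relates A_m to the adjoint of A_(-m), which is the transpose of A_m as the coefficients are
  real and even.\<close>

lemma AE_symbol_symmetric:
  assumes pq: "p < 2 * k" "q < 2 * k"
  shows "AE t in circ. a t $$ (p, q) = a t $$ (q, p)"
proof (rule fourier_eq_imp_AE_eq)
  have *: "fourier (\<lambda>t. a t $$ (p, q)) (int m) = fourier (\<lambda>t. a t $$ (q, p)) (int m)" for m
  proof -
    have "mat_adjoint (Bn (Suc m)) = Bn (Suc m)"
      using G_matrix_Bn[of "Suc m"] by (simp add: G_matrix_def pos_def_def)
    moreover have lt: "m * (2 * k) + p < Suc m * (2 * k)" "0 * (2 * k) + q < Suc m * (2 * k)"
      using pq by (intro block_index_less; simp)+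
    ultimately have "Bn (Suc m) $$ (m * (2 * k) + p, 0 * (2 * k) + q) = cnj (Bn (Suc m) $$ (0 * (2 * k) + q, m * (2 * k) + p))"
      using mat_adjoint_index[of "m * (2 * k) + p" "Bn (Suc m)" "0 * (2 * k) + q"] Bn_carrier[of "Suc m"] by simp
    then have "toeplitz (\<lambda>t. a t $$ (p, q)) m 0 = cnj (toeplitz (\<lambda>t. a t $$ (q, p)) 0 m)"
      using Bn_block[of m "Suc m" 0 p q] Bn_block[of 0 "Suc m" m q p] pq by simp
    then show ?thesis using pq by (simp add: toeplitz_def fourier_real fourier_even)
  qed
  show "fourier (\<lambda>t. a t $$ (p, q)) n = fourier (\<lambda>t. a t $$ (q, p)) n" for n
    using *[of "nat n"] *[of "nat (- n)"] fourier_even[OF pq, of n] fourier_even[OF pq(2,1), of n]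
    by (cases "n \<ge> 0") auto
qed (use pq in \<open>auto intro!: ess_bounded_symbol\<close>)

lemma symbol_bounded:
  obtains C where "C > 0" "AE t in circ. \<forall>p<2 * k. \<forall>q<2 * k. cmod (a t $$ (p, q)) \<le> C"
proof -
  have "\<exists>C. C > 0 \<and> (AE t in circ. cmod (a t $$ (p, q)) \<le> C)" if "p < 2 * k" "q < 2 * k" for p q
    using ess_boundedE[OF ess_bounded_symbol[OF that]] by metis
  then obtain D where D: "\<And>p q. p < 2 * k \<Longrightarrow> q < 2 * k \<Longrightarrow> D p q > 0"
    "\<And>p q. p < 2 * k \<Longrightarrow> q < 2 * k \<Longrightarrow> AE t in circ. cmod (a t $$ (p, q)) \<le> D p q" by metis
  define C where "C = 1 + (\<Sum>p<2 * k. \<Sum>q<2 * k. D p q)"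
  have nn: "0 \<le> (\<Sum>p<2 * k. \<Sum>q<2 * k. D p q)" using D(1) by (intro sum_nonneg) (auto intro: less_imp_le)
  have DC: "D p q \<le> C" if pq: "p < 2 * k" "q < 2 * k" for p q
  proof -
    have "D p q \<le> (\<Sum>q<2 * k. D p q)"
      using pq D(1) by (intro member_le_sum) (auto intro: less_imp_le)
    also have "\<dots> \<le> (\<Sum>p<2 * k. \<Sum>q<2 * k. D p q)"
      using pq D(1) by (intro member_le_sum[of p "{..<2 * k}" "\<lambda>p. \<Sum>q<2 * k. D p q"] sum_nonneg) (auto intro: less_imp_le)
    finally show ?thesis by (simp add: C_def)
  qed
  have "AE t in circ. \<forall>p\<in>{..<2 * k}. \<forall>q\<in>{..<2 * k}. cmod (a t $$ (p, q)) \<le> C"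
  proof (intro AE_finite_allI)
    fix p q assume "p \<in> {..<2 * k}" "q \<in> {..<2 * k}"
    then have pq: "p < 2 * k" "q < 2 * k" by auto
    show "AE t in circ. cmod (a t $$ (p, q)) \<le> C"
      using D(2)[OF pq] by eventually_elim (use DC[OF pq] in linarith)
  qed auto
  then show ?thesis using nn by (intro that[of C]) (auto simp: C_def)
qed

text \<open>The scalar function in question has Toeplitz forms obtained by testing the G-matrix
  inequality of the truncations on product vectors, whose i-th block is \<open>x i\<close> times
  \<open>v\<close>. The exceptional null set depends on \<open>v\<close>.\<close>

lemma AE_hermitian_form_nonneg:
  fixes v :: "nat \<Rightarrow> complex"
  shows "AE t in circ. 0 \<le> Re (\<Sum>p<2 * k. \<Sum>q<2 * k. cnj (v p) * (a t $$ (p, q) + \<i> / 2 * Jf p q) * v q)"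
proof (rule toeplitz_nonneg_imp_AE_nonneg)
  define g where "g t = (\<Sum>p<2 * k. \<Sum>q<2 * k. cnj (v p) * (a t $$ (p, q) + \<i> / 2 * Jf p q) * v q)" for t
  have b: "ess_bounded (\<lambda>t. cnj (v p) * (a t $$ (p, q) + \<i> / 2 * Jf p q) * v q)" if "p < 2 * k" "q < 2 * k" for p q
    using that by (intro ess_bounded_mult ess_bounded_add ess_bounded_symbol) auto
  then show "ess_bounded (\<lambda>t. \<Sum>p<2 * k. \<Sum>q<2 * k. cnj (v p) * (a t $$ (p, q) + \<i> / 2 * Jf p q) * v q)"
    by (intro ess_bounded_sum) auto
  have tg: "toeplitz g i j = (\<Sum>p<2 * k. \<Sum>q<2 * k. cnj (v p) *
      (toeplitz (\<lambda>t. a t $$ (p, q)) i j + (if i = j then \<i> / 2 * Jf p q else 0)) * v q)" for i j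
  proof -
    have "toeplitz g i j = (\<Sum>p<2 * k. \<Sum>q<2 * k. toeplitz (\<lambda>t. cnj (v p) * (a t $$ (p, q) + \<i> / 2 * Jf p q) * v q) i j)"
      unfolding g_def by (subst toeplitz_sum, use b in \<open>auto intro!: ess_bounded_sum\<close>, intro sum.cong refl toeplitz_sum, auto)
    also have "\<dots> = (\<Sum>p<2 * k. \<Sum>q<2 * k. cnj (v p) *
      (toeplitz (\<lambda>t. a t $$ (p, q)) i j + (if i = j then \<i> / 2 * Jf p q else 0)) * v q)"
    proof (intro sum.cong refl)
      fix p q assume "p \<in> {..<2 * k}" "q \<in> {..<2 * k}"
      then have pq: "p < 2 * k" "q < 2 * k" by auto
      have "toeplitz (\<lambda>t. cnj (v p) * (a t $$ (p, q) + \<i> / 2 * Jf p q) * v q) i j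
          = toeplitz (\<lambda>t. (cnj (v p) * v q) * (a t $$ (p, q) + \<i> / 2 * Jf p q)) i j"
        by (simp add: mult_ac)
      also have "\<dots> = (cnj (v p) * v q) * (toeplitz (\<lambda>t. a t $$ (p, q)) i j + toeplitz (\<lambda>t. \<i> / 2 * Jf p q) i j)"
        by (subst toeplitz_cmult, subst toeplitz_add) (auto intro: ess_bounded_symbol pq)
      finally show "toeplitz (\<lambda>t. cnj (v p) * (a t $$ (p, q) + \<i> / 2 * Jf p q) * v q) i j
        = cnj (v p) * (toeplitz (\<lambda>t. a t $$ (p, q)) i j + (if i = j then \<i> / 2 * Jf p q else 0)) * v q"
        by (simp only: toeplitz_const) (simp add: mult_ac)
    qed
    finally show ?thesis .
  qed
  show "0 \<le> Re (\<Sum>i<n. \<Sum>j<n. cnj (x i) * toeplitz (\<lambda>t. \<Sum>p<2 * k. \<Sum>q<2 * k. cnj (v p) * (a t $$ (p, q) + \<i> / 2 * Jf p q) * v q) i j * x j)"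
    for n and x :: "nat \<Rightarrow> complex"
  proof (cases "n = 0")
    case False
    define w where "w = Matrix.vec (n * (2 * k)) (\<lambda>s. x (s div (2 * k)) * v (s mod (2 * k)))"
    define H where "H = Bn n + (\<i> / 2) \<cdot>\<^sub>m J_mat (n * k)"
    have dim: "2 * (n * k) = n * (2 * k)" by simp
    have J: "J_mat (n * k) \<in> carrier_mat (n * (2 * k)) (n * (2 * k))" using J_mat_carrier[of "n * k"] by (simp only: dim)
    have H: "H \<in> carrier_mat (n * (2 * k)) (n * (2 * k))" using Bn_carrier J by (simp add: H_def)
    have w: "w \<in> carrier_vec (n * (2 * k))" by (simp add: w_def)
    have wi: "w $ (i * (2 * k) + p) = x i * v p" if "i < n" "p < 2 * k" for i p
      using block_index_less[OF that] that by (simp add: w_def)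
    have Hi: "H $$ (i * (2 * k) + p, j * (2 * k) + q) = toeplitz (\<lambda>t. a t $$ (p, q)) i j + (if i = j then \<i> / 2 * Jf p q else 0)"
      if "i < n" "j < n" "p < 2 * k" "q < 2 * k" for i j p q
    proof -
      note lt = block_index_less[OF that(1,3)] block_index_less[OF that(2,4)]
      have "H $$ (i * (2 * k) + p, j * (2 * k) + q) = Bn n $$ (i * (2 * k) + p, j * (2 * k) + q)
          + \<i> / 2 * J_mat (n * k) $$ (i * (2 * k) + p, j * (2 * k) + q)"
        unfolding H_def using lt J Bn_carrier[of n] by simp
      then show ?thesis
        using J_mat_index[of "i * (2 * k) + p" "n * k" "j * (2 * k) + q"] lt that
        by (simp only: dim Bn_block Jf_block) auto
    qed
    have "pos_semidef (n * (2 * k)) H"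
      using G_matrix_Bn[of n] False unfolding G_matrix_def H_def dim by simp
    then have "0 \<le> (H *\<^sub>v w) \<bullet>c w" using w unfolding pos_semidef_def by blast
    also have "\<dots> = (\<Sum>i<n. \<Sum>p<2 * k. \<Sum>j<n. \<Sum>q<2 * k. cnj (x i) * cnj (v p) *
        (toeplitz (\<lambda>t. a t $$ (p, q)) i j + (if i = j then \<i> / 2 * Jf p q else 0)) * (x j * v q))"
      unfolding quadratic_form_vec[OF H w] sum_blocks[where n = n and N = "2 * k"]
      by (intro sum.cong refl) (simp add: wi Hi)
    also have "\<dots> = (\<Sum>i<n. \<Sum>j<n. \<Sum>p<2 * k. \<Sum>q<2 * k. cnj (x i) * cnj (v p) *
        (toeplitz (\<lambda>t. a t $$ (p, q)) i j + (if i = j then \<i> / 2 * Jf p q else 0)) * (x j * v q))"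
      by (intro sum.cong refl sum.swap)
    also have "\<dots> = (\<Sum>i<n. \<Sum>j<n. cnj (x i) * toeplitz g i j * x j)"
      unfolding tg sum_distrib_left sum_distrib_right by (intro sum.cong refl) (simp add: mult_ac)
    finally show ?thesis unfolding g_def by (simp add: less_eq_complex_def)
  qed simp
qed


definition good :: "real \<Rightarrow> real \<Rightarrow> bool" where
  "good C t \<longleftrightarrow> t \<in> {-pi..pi} \<and> real_mat (a t) \<and> pos_def (2 * k) (a t) \<and>
     (\<forall>p<2 * k. \<forall>q<2 * k. cmod (a t $$ (p, q)) \<le> C)"

lemma symbol_pos_def:
  fixes C :: real
  assumes C: "C > 0" and t: "t \<in> {-pi..pi}"
    and real: "\<And>p q. p < 2 * k \<Longrightarrow> q < 2 * k \<Longrightarrow> Im (a t $$ (p, q)) = 0"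
    and sym: "\<And>p q. p < 2 * k \<Longrightarrow> q < 2 * k \<Longrightarrow> a t $$ (p, q) = a t $$ (q, p)"
    and bound: "\<And>p q. p < 2 * k \<Longrightarrow> q < 2 * k \<Longrightarrow> cmod (a t $$ (p, q)) \<le> C"
    and pos: "\<And>u \<sigma>. (\<And>p. u p \<in> \<int>) \<Longrightarrow> \<sigma> = - 1 / (2 * C * real (2 * k)) \<Longrightarrow>
      0 \<le> Re (\<Sum>p<2 * k. \<Sum>q<2 * k.
        cnj (complex_of_real (u p) + \<i> * of_real (\<sigma> * (mode_sign p * u (partner p)))) *
        (a t $$ (p, q) + \<i> / 2 * Jf p q) * (complex_of_real (u q) + \<i> * of_real (\<sigma> * (mode_sign q * u (partner q)))))"
  shows "good C t"
proof -
  define A where "A p q = Re (a t $$ (p, q))" for p q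
  have aA: "a t $$ (p, q) = of_real (A p q)" if "p < 2 * k" "q < 2 * k" for p q
    using real[OF that] by (simp add: A_def complex_eq_iff)
  have Ab: "\<bar>A p q\<bar> \<le> C" if "p < 2 * k" "q < 2 * k" for p q
    using bound[OF that] aA[OF that] by simp
  define N where "N = real (2 * k)"
  have N: "N > 0" using k by (simp add: N_def)
  \<comment> \<open>This value minimises \<sigma>^2 C N + \<sigma>, the coefficient of the squared
    norm of \<open>u\<close> after the form at \<open>w\<close> has been bounded by C N; the minimum
    is -1 / (4 C N), which is -c.\<close>
  define \<sigma> where "\<sigma> = - 1 / (2 * C * N)"
  define c where "c = 1 / (4 * C * N)"
  have c: "c > 0" using C N by (simp add: c_def)
  have int: "c * (\<Sum>p<2 * k. (u p)\<^sup>2) \<le> bil (2 * k) A u u" if u: "\<And>p. u p \<in> \<int>" for u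
  proof -
    define w where "w p = mode_sign p * u (partner p)" for p
    define S where "S = (\<Sum>p<2 * k. (u p)\<^sup>2)"
    have eq: "(\<Sum>p<2 * k. \<Sum>q<2 * k.
        cnj (complex_of_real (u p) + \<i> * of_real (\<sigma> * (mode_sign p * u (partner p)))) *
        (a t $$ (p, q) + \<i> / 2 * Jf p q) * (complex_of_real (u q) + \<i> * of_real (\<sigma> * (mode_sign q * u (partner q)))))
      = (\<Sum>p<2 * k. \<Sum>q<2 * k.
        cnj (complex_of_real (u p) + \<i> * of_real (\<sigma> * (mode_sign p * u (partner p)))) *
        (of_real (A p q) + \<i> / 2 * Jf p q) * (complex_of_real (u q) + \<i> * of_real (\<sigma> * (mode_sign q * u (partner q)))))"
      by (intro sum.cong refl) (simp only: aA lessThan_iff)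
    have "0 \<le> bil (2 * k) A u u + \<sigma>\<^sup>2 * bil (2 * k) A w w + \<sigma> * S"
      using pos[of u \<sigma>, OF u] unfolding eq Re_hermitian_form w_def S_def by (simp add: \<sigma>_def N_def)
    also have "bil (2 * k) A w w \<le> C * N * (\<Sum>p<2 * k. (w p)\<^sup>2)"
      unfolding N_def by (rule bil_le) (use Ab C in auto)
    also have "(\<Sum>p<2 * k. (w p)\<^sup>2) = (\<Sum>p<2 * k. (u (partner p))\<^sup>2)"
      by (intro sum.cong refl) (simp add: w_def mode_sign_def power_mult_distrib)
    also have "\<dots> = S" unfolding S_def by (rule sum_partner)
    finally have "0 \<le> bil (2 * k) A u u + \<sigma>\<^sup>2 * (C * N * S) + \<sigma> * S"
      by (simp add: mult_left_mono)
    moreover have "\<sigma>\<^sup>2 * (C * N * S) + \<sigma> * S = - (c * S)"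
      using C N by (simp add: \<sigma>_def c_def field_simps power2_eq_square)
    ultimately show ?thesis by (simp add: S_def)
  qed
  have low: "c * (\<Sum>p<2 * k. (u p)\<^sup>2) \<le> bil (2 * k) A u u" for u
    by (rule bil_lower_bound_from_integers) (rule int, simp)
  have pd: "0 < bil (2 * k) A u u" if nz: "\<exists>p<2 * k. u p \<noteq> 0" for u
  proof -
    from nz obtain p where p: "p < 2 * k" "u p \<noteq> 0" by blast
    have "0 < (u p)\<^sup>2" using p by simp
    also have "\<dots> \<le> (\<Sum>p<2 * k. (u p)\<^sup>2)" using p by (intro member_le_sum) auto
    finally have "0 < c * (\<Sum>p<2 * k. (u p)\<^sup>2)" using c by simp
    then show ?thesis using low[of u] by linarith
  qed
  have "a t \<in> carrier_mat (2 * k) (2 * k)" using Linfty t by (simp add: Linfty_mat_def)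
  from pos_def_realI[OF this aA _ pd] sym show ?thesis
    using t bound by (simp add: good_def A_def)
qed

lemma AE_good:
  obtains C where "C > 0" "AE t in circ. good C t"
proof -
  obtain C where C: "C > 0" "AE t in circ. \<forall>p<2 * k. \<forall>q<2 * k. cmod (a t $$ (p, q)) \<le> C"
    using symbol_bounded .
  have 1: "AE t in circ. \<forall>p\<in>{..<2 * k}. \<forall>q\<in>{..<2 * k}. Im (a t $$ (p, q)) = 0"
    by (intro AE_finite_allI) (auto intro: AE_symbol_real)
  have 2: "AE t in circ. \<forall>p\<in>{..<2 * k}. \<forall>q\<in>{..<2 * k}. a t $$ (p, q) = a t $$ (q, p)"
    by (intro AE_finite_allI) (auto intro: AE_symbol_symmetric)
  define \<sigma> where "\<sigma> = - 1 / (2 * C * real (2 * k))"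
  \<comment> \<open>Integer vectors are coded by lists of integers, a countable type, so that the
    null sets can be united. The form reads only coordinates below 2k, since \<open>partner\<close>
    stays in that range.\<close>
  define vec_of :: "int list \<Rightarrow> nat \<Rightarrow> real" where
    "vec_of z p = (if p < length z then real_of_int (z ! p) else 0)" for z p
  define form where "form u t = Re (\<Sum>p<2 * k. \<Sum>q<2 * k.
        cnj (complex_of_real (u p) + \<i> * of_real (\<sigma> * (mode_sign p * u (partner p)))) *
        (a t $$ (p, q) + \<i> / 2 * Jf p q) * (complex_of_real (u q) + \<i> * of_real (\<sigma> * (mode_sign q * u (partner q)))))"
    for u t
  have "AE t in circ. \<forall>z. 0 \<le> form (vec_of z) t"
    unfolding AE_all_countable form_def by (intro allI AE_hermitian_form_nonneg)
  with C(2) 1 2 AE_space have "AE t in circ. good C t"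
  proof eventually_elim
    fix t assume t: "\<forall>p<2 * k. \<forall>q<2 * k. cmod (a t $$ (p, q)) \<le> C"
      "\<forall>p\<in>{..<2 * k}. \<forall>q\<in>{..<2 * k}. Im (a t $$ (p, q)) = 0"
      "\<forall>p\<in>{..<2 * k}. \<forall>q\<in>{..<2 * k}. a t $$ (p, q) = a t $$ (q, p)"
      "t \<in> space circ" "\<forall>z. 0 \<le> form (vec_of z) t"
    have "0 \<le> form u t" if u: "\<And>p. u p \<in> \<int>" for u
    proof -
      define z where "z = map (\<lambda>p. \<lfloor>u p\<rfloor>) [0..<2 * k]"
      have zu: "vec_of z p = u p" if "p < 2 * k" for p
        using u[of p] that by (auto simp: vec_of_def z_def elim: Ints_cases)
      have "form (vec_of z) t = form u t"
        unfolding form_def by (intro arg_cong[of _ _ Re] sum.cong refl) (simp add: zu)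
      then show ?thesis using t(5) by metis
    qed
    then show "good C t"
      using t(1-4) unfolding form_def \<sigma>_def by (intro symbol_pos_def C(1)) auto
  qed
  with C(1) show ?thesis by (rule that)
qed

section \<open>The block symbol of J times a truncation\<close>

definition JA :: "real \<Rightarrow> nat \<Rightarrow> nat \<Rightarrow> complex" where
  "JA t = fmat_mult (2 * k) Jf (\<lambda>i j. a t $$ (i, j))"

lemma JA_index: "p < 2 * k \<Longrightarrow> JA t p q = mode_sign p * a t $$ (partner p, q)"
  by (simp add: JA_def fmat_mult_Jf)

lemma ess_bounded_JA:
  assumes "p < 2 * k" "q < 2 * k" shows "ess_bounded (\<lambda>t. JA t p q)"
proof -
  have "ess_bounded (\<lambda>t. mode_sign p * a t $$ (partner p, q))" using assms by (intro ess_bounded_mult ess_bounded_symbol) auto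
  then show ?thesis using assms by (simp add: JA_index)
qed

lemma JA_le: "good C t \<Longrightarrow> p < 2 * k \<Longrightarrow> q < 2 * k \<Longrightarrow> cmod (JA t p q) \<le> C"
  by (simp add: JA_index good_def norm_mult) (simp add: mode_sign_def)

text \<open>\<open>partner\<close> never leaves a block, so multiplication by J permutes rows within
  blocks and acts on the symbol alone: the product is again block Toeplitz, without any error
  term.\<close>

lemma fmat_trace_Bn:
  "fmat_trace (2 * (n * k)) (fmat_pow (2 * (n * k)) (fmat_mult (2 * (n * k)) Jf (\<lambda>i j. Bn n $$ (i, j))) l)
    = fmat_trace (n * (2 * k)) (fmat_pow (n * (2 * k)) (block_symbol (2 * k) JA) l)"
proof -
  have dim: "2 * (n * k) = n * (2 * k)" by simp
  have "fmat_mult (2 * (n * k)) Jf (\<lambda>i j. Bn n $$ (i, j)) s r = block_symbol (2 * k) JA s r"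
    if s: "s < n * (2 * k)" and r: "r < n * (2 * k)" for s r
  proof -
    define i p where "i = s div (2 * k)" and "p = s mod (2 * k)"
    have s_eq: "s = i * (2 * k) + p" by (simp only: i_def p_def div_mult_mod_eq)
    have p: "p < 2 * k" using k by (simp add: p_def)
    have i: "i < n" using s by (simp add: i_def less_mult_imp_div_less)
    have q: "r mod (2 * k) < 2 * k" using k by simp
    have pp: "partner p < 2 * k" using p by simp
    have ps: "partner s < n * (2 * k)" using s partner_less[of s "n * k"] by (simp only: dim)
    have "partner s div (2 * k) = i" "partner s mod (2 * k) = partner p"
      unfolding s_eq partner_block using pp by auto
    then have "fmat_mult (2 * (n * k)) Jf (\<lambda>i j. Bn n $$ (i, j)) s r
        = mode_sign p * toeplitz (\<lambda>t. a t $$ (partner p, r mod (2 * k))) i (r div (2 * k))"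
      using s Bn_index[OF ps r] fmat_mult_Jf[of s "n * k" "\<lambda>i j. Bn n $$ (i, j)" r]
      by (simp only: dim) (simp add: s_eq mode_sign_block)
    also have "\<dots> = toeplitz (\<lambda>t. JA t p (r mod (2 * k))) i (r div (2 * k))"
      using p by (simp add: JA_index toeplitz_cmult)
    finally show ?thesis by (simp add: block_symbol_def i_def p_def)
  qed
  from fmat_pow_cong[OF this] show ?thesis
    unfolding fmat_trace_def dim by (intro sum.cong refl) auto
qed

lemma real_mat_Bn: "n \<ge> 1 \<Longrightarrow> real_mat (Bn n)" and pos_def_Bn: "n \<ge> 1 \<Longrightarrow> pos_def (2 * (n * k)) (Bn n)"
  using G_matrix_Bn[of n] by (simp_all add: G_matrix_def)

section \<open>Approximation by trace polynomials and the limit\<close>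

context
  fixes C R :: real
  assumes C: "C > 0" and AE_C: "AE t in circ. good C t"
  defines "R \<equiv> real (2 * k) * C"
begin

lemma R_pos: "R > 0"
  using C k by (simp add: R_def)

lemma AE_JA_le:
  assumes "p < 2 * k" "q < 2 * k" shows "AE t in circ. cmod (JA t p q) \<le> C"
  using AE_C by eventually_elim (use assms in \<open>simp add: JA_le\<close>)

lemma entropy_Bn_approx:
  assumes n: "n \<ge> 1"
    and approx: "\<And>s. s \<in> {0..R\<^sup>2} \<Longrightarrow> \<bar>mode_entropy (sqrt s) - (\<Sum>i\<le>d. c i * s ^ i)\<bar> \<le> e"
  shows "\<bar>gaussian_entropy (n * k) (Bn n) - trace_poly c d (n * (2 * k)) (block_symbol (2 * k) JA)\<bar> \<le> real (n * k) * e"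
proof -
  have nk: "n * k \<ge> 1" using n k by simp
  have "\<bar>gaussian_entropy (n * k) (Bn n)
      - trace_poly c d (2 * (n * k)) (fmat_mult (2 * (n * k)) Jf (\<lambda>i j. Bn n $$ (i, j)))\<bar> \<le> real (n * k) * e"
  proof (rule gaussian_entropy_approx[OF nk real_mat_Bn[OF n] pos_def_Bn[OF n] R_pos _ approx])
    fix l
    show "cmod (fmat_trace (2 * (n * k)) (fmat_pow (2 * (n * k)) (fmat_mult (2 * (n * k)) Jf (\<lambda>i j. Bn n $$ (i, j))) l))
        \<le> (real n * real (2 * k) * sqrt (real n)) * R ^ l"
      unfolding fmat_trace_Bn R_def by (rule fmat_trace_fmat_pow_block_symbol_bound[OF ess_bounded_JA AE_JA_le C])
  qed
  then show ?thesis unfolding trace_poly_def fmat_trace_Bn .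
qed

lemma entropy_symbol_approx:
  assumes t: "good C t"
    and approx: "\<And>s. s \<in> {0..R\<^sup>2} \<Longrightarrow> \<bar>mode_entropy (sqrt s) - (\<Sum>i\<le>d. c i * s ^ i)\<bar> \<le> e"
  shows "\<bar>gaussian_entropy k (a t) - trace_poly c d (2 * k) (JA t)\<bar> \<le> real k * e"
  unfolding JA_def
proof (rule gaussian_entropy_approx[OF k _ _ R_pos _ approx])
  show "real_mat (a t)" "pos_def (2 * k) (a t)" using t by (auto simp: good_def)
  show "cmod (fmat_trace (2 * k) (fmat_pow (2 * k) (fmat_mult (2 * k) Jf (\<lambda>i j. a t $$ (i, j))) l)) \<le> real (2 * k) * R ^ l" for l
    unfolding R_def JA_def[symmetric] by (rule fmat_trace_fmat_pow_bound[OF JA_le[OF t]])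
qed

lemma ess_bounded_fmat_trace_JA: "ess_bounded (\<lambda>t. fmat_trace (2 * k) (fmat_pow (2 * k) (JA t) l))"
  unfolding fmat_trace_def by (intro ess_bounded_sum ess_bounded_fmat_pow ess_bounded_JA) auto

lemma integrable_trace_poly: "integrable circ (\<lambda>t. trace_poly c d (2 * k) (JA t))"
  unfolding trace_poly_def
  by (intro Bochner_Integration.integrable_sum integrable_mult_right integrable_Re ess_bounded_integrable ess_bounded_fmat_trace_JA)

lemma trace_poly_limit:
  "(\<lambda>n. trace_poly c d (n * (2 * k)) (block_symbol (2 * k) JA) / real n)
    \<longlonglongrightarrow> 1 / (2 * pi) * (LINT t|circ. trace_poly c d (2 * k) (JA t))"
proof -
  have 1: "Re (mean f) = 1 / (2 * pi) * (LINT t|circ. Re (f t))" if "ess_bounded f" for f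
  proof -
    have "Re (mean f) = Re (LINT t|circ. f t) / (2 * pi)"
      using Re_divide_of_real[of "LINT t|circ. f t" "2 * pi"] by (simp add: mean_def)
    then show ?thesis using integral_Re[OF ess_bounded_integrable[OF that]] by simp
  qed
  have "(\<lambda>n. \<Sum>i\<le>d. c i * ((-1) ^ i / 2) *
        Re (fmat_trace (n * (2 * k)) (fmat_pow (n * (2 * k)) (block_symbol (2 * k) JA) (2 * i)) / of_nat n))
      \<longlonglongrightarrow> (\<Sum>i\<le>d. c i * ((-1) ^ i / 2) * Re (mean (\<lambda>t. fmat_trace (2 * k) (fmat_pow (2 * k) (JA t) (2 * i)))))"
    by (intro tendsto_sum tendsto_mult tendsto_const tendsto_Re fmat_trace_fmat_pow_block_symbol_limit ess_bounded_JA)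
  moreover have "(\<Sum>i\<le>d. c i * ((-1) ^ i / 2) *
        Re (fmat_trace (n * (2 * k)) (fmat_pow (n * (2 * k)) (block_symbol (2 * k) JA) (2 * i)) / of_nat n))
      = trace_poly c d (n * (2 * k)) (block_symbol (2 * k) JA) / real n" for n
    unfolding trace_poly_def sum_divide_distrib by (simp add: Re_divide_of_nat)
  moreover have "(\<Sum>i\<le>d. c i * ((-1) ^ i / 2) * Re (mean (\<lambda>t. fmat_trace (2 * k) (fmat_pow (2 * k) (JA t) (2 * i)))))
      = 1 / (2 * pi) * (LINT t|circ. trace_poly c d (2 * k) (JA t))"
  proof -
    have "(LINT t|circ. trace_poly c d (2 * k) (JA t))
        = (\<Sum>i\<le>d. c i * ((-1) ^ i / 2) * (LINT t|circ. Re (fmat_trace (2 * k) (fmat_pow (2 * k) (JA t) (2 * i)))))"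
      unfolding trace_poly_def
      by (subst Bochner_Integration.integral_sum)
         (intro integrable_mult_right integrable_Re ess_bounded_integrable ess_bounded_fmat_trace_JA, simp only: integral_mult_right_zero)
    then show ?thesis
      unfolding 1[OF ess_bounded_fmat_trace_JA] by (simp only: sum_distrib_left mult_ac)
  qed
  ultimately show ?thesis by simp
qed

text \<open>The symplectic eigenvalues are given by a definite description, which offers no direct
  access to measurability. At good points, however, the entropy is the limit of trace polynomials of
  the symbol, which are integrable.\<close>

lemma entropy_symbol_measurable: "(\<lambda>t. gaussian_entropy k (a t)) \<in> borel_measurable circ"
proof -
  have "\<exists>c d. \<forall>s\<in>{0..R\<^sup>2}. \<bar>mode_entropy (sqrt s) - (\<Sum>i\<le>d. c i * s ^ i)\<bar> \<le> 1 / real (Suc m)" for m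
    using mode_entropy_polynomial_approx[of "1 / real (Suc m)" R] by (metis of_nat_0_less_iff zero_less_Suc zero_less_divide_1_iff)
  then obtain c d where cd: "\<And>m s. s \<in> {0..R\<^sup>2} \<Longrightarrow>
      \<bar>mode_entropy (sqrt s) - (\<Sum>i\<le>d m. c m i * s ^ i)\<bar> \<le> 1 / real (Suc m)"
    by metis
  define Q where "Q m t = trace_poly (c m) (d m) (2 * k) (JA t)" for m t
  have "(\<lambda>t. lim (\<lambda>m. Q m t)) \<in> borel_measurable circ"
    by (rule borel_measurable_lim_metric)
       (unfold Q_def, rule borel_measurable_integrable[OF integrable_trace_poly])
  moreover have "AE t in circ. lim (\<lambda>m. Q m t) = gaussian_entropy k (a t)"
    using AE_C
  proof eventually_elim
    fix t assume t: "good C t"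
    have "(\<lambda>m. Q m t - gaussian_entropy k (a t)) \<longlonglongrightarrow> 0"
    proof (rule Lim_null_comparison)
      show "\<forall>\<^sub>F m in sequentially. norm (Q m t - gaussian_entropy k (a t)) \<le> real k * (1 / real (Suc m))"
        using entropy_symbol_approx[OF t cd] unfolding Q_def
        by (intro always_eventually allI) (simp only: real_norm_def abs_minus_commute)
      show "(\<lambda>m. real k * (1 / real (Suc m))) \<longlonglongrightarrow> 0" by real_asymp
    qed
    then have "(\<lambda>m. Q m t) \<longlonglongrightarrow> gaussian_entropy k (a t)" by (rule LIM_zero_cancel)
    then show "lim (\<lambda>m. Q m t) = gaussian_entropy k (a t)" by (rule limI)
  qed
  ultimately show ?thesis by (rule borel_measurable_circ_AE)
qed

lemma integrable_entropy_diff: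
  assumes "\<And>s. s \<in> {0..R\<^sup>2} \<Longrightarrow> \<bar>mode_entropy (sqrt s) - (\<Sum>i\<le>d. c i * s ^ i)\<bar> \<le> e"
  shows "integrable circ (\<lambda>t. gaussian_entropy k (a t) - trace_poly c d (2 * k) (JA t))"
proof (rule finite_measure.integrable_const_bound[OF finite_measure_circ])
  show "AE t in circ. norm (gaussian_entropy k (a t) - trace_poly c d (2 * k) (JA t)) \<le> real k * e"
    using AE_C by eventually_elim (use entropy_symbol_approx assms in simp)
  show "(\<lambda>t. gaussian_entropy k (a t) - trace_poly c d (2 * k) (JA t)) \<in> borel_measurable circ"
    using entropy_symbol_measurable borel_measurable_integrable[OF integrable_trace_poly[of c d]]
    by (rule borel_measurable_diff)
qed

text \<open>The entropy differs from an integrable trace polynomial by a function bounded almost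
  everywhere, on a space of finite measure; the accuracy 1 is arbitrary.\<close>

lemma entropy_symbol_integrable: "integrable circ (\<lambda>t. gaussian_entropy k (a t))"
proof -
  obtain c d where "\<And>s. s \<in> {0..R\<^sup>2} \<Longrightarrow> \<bar>mode_entropy (sqrt s) - (\<Sum>i\<le>d. c i * s ^ i)\<bar> \<le> 1"
    using mode_entropy_polynomial_approx[of 1 R] by auto
  from Bochner_Integration.integrable_add[OF integrable_entropy_diff[OF this] integrable_trace_poly[of c d]]
  show ?thesis by simp
qed

lemma entropy_integral_approx:
  assumes approx: "\<And>s. s \<in> {0..R\<^sup>2} \<Longrightarrow> \<bar>mode_entropy (sqrt s) - (\<Sum>i\<le>d. c i * s ^ i)\<bar> \<le> e"
  shows "\<bar>1 / (2 * pi) * (LINT t|circ. gaussian_entropy k (a t))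
    - 1 / (2 * pi) * (LINT t|circ. trace_poly c d (2 * k) (JA t))\<bar> \<le> real k * e"
proof -
  have "\<bar>LINT t|circ. gaussian_entropy k (a t) - trace_poly c d (2 * k) (JA t)\<bar>
      \<le> (LINT t|circ. \<bar>gaussian_entropy k (a t) - trace_poly c d (2 * k) (JA t)\<bar>)"
    by (rule integral_abs_bound)
  also have "\<dots> \<le> (LINT t|circ. real k * e)"
  proof (rule integral_mono_AE)
    show "AE t in circ. \<bar>gaussian_entropy k (a t) - trace_poly c d (2 * k) (JA t)\<bar> \<le> real k * e"
      using AE_C by eventually_elim (use entropy_symbol_approx approx in simp)
  qed (use integrable_entropy_diff[OF approx] finite_measure.integrable_const[OF finite_measure_circ] in auto)
  also have "\<dots> = 2 * pi * (real k * e)" using measure_circ by simp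
  finally have "\<bar>(LINT t|circ. gaussian_entropy k (a t)) - (LINT t|circ. trace_poly c d (2 * k) (JA t))\<bar>
      \<le> 2 * pi * (real k * e)"
    using entropy_symbol_integrable integrable_trace_poly[of c d] by simp
  moreover have "\<bar>1 / (2 * pi) * (LINT t|circ. gaussian_entropy k (a t))
    - 1 / (2 * pi) * (LINT t|circ. trace_poly c d (2 * k) (JA t))\<bar>
    = \<bar>(LINT t|circ. gaussian_entropy k (a t)) - (LINT t|circ. trace_poly c d (2 * k) (JA t))\<bar> / (2 * pi)"
    by (simp add: diff_divide_distrib[symmetric] abs_divide)
  ultimately show ?thesis by (simp add: field_simps)
qed

lemma entropy_seq_tendsto:
  "entropy_seq k (toeplitz_of_symbol (2 * k) a) \<longlonglongrightarrow> 1 / (2 * pi) * (LINT t|circ. gaussian_entropy k (a t))"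
    (is "?s \<longlonglongrightarrow> ?I")
proof (rule LIMSEQ_I)
  fix r :: real assume r: "r > 0"
  \<comment> \<open>A truncation to n blocks has n k modes, so after division by n its error is k e;
    the averaged error of the symbol is also at most k e. Both are r / 3, which leaves r / 3 for the
    convergence of the traces.\<close>
  define e where "e = r / (3 * real k)"
  have e: "e > 0" "real k * e = r / 3" using r k by (auto simp: e_def)
  obtain c d where approx: "\<And>s. s \<in> {0..R\<^sup>2} \<Longrightarrow> \<bar>mode_entropy (sqrt s) - (\<Sum>i\<le>d. c i * s ^ i)\<bar> \<le> e"
    using mode_entropy_polynomial_approx[OF e(1), of R] by auto
  define P where "P = 1 / (2 * pi) * (LINT t|circ. trace_poly c d (2 * k) (JA t))"
  define T where "T n = trace_poly c d (n * (2 * k)) (block_symbol (2 * k) JA) / real n" for n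
  have "T \<longlonglongrightarrow> P" unfolding T_def P_def by (rule trace_poly_limit)
  from LIMSEQ_D[OF this, of "r / 3"] r obtain n0 where n0: "\<And>n. n \<ge> n0 \<Longrightarrow> \<bar>T n - P\<bar> < r / 3" by auto
  have I: "\<bar>?I - P\<bar> \<le> r / 3" using entropy_integral_approx[OF approx] unfolding P_def e(2) .
  show "\<exists>n0. \<forall>n\<ge>n0. norm (?s n - ?I) < r"
  proof (intro exI[of _ "max 1 n0"] allI impI)
    fix n assume n: "n \<ge> max 1 n0"
    have "\<bar>?s n - T n\<bar> = \<bar>gaussian_entropy (n * k) (Bn n) - trace_poly c d (n * (2 * k)) (block_symbol (2 * k) JA)\<bar> / real n"
      unfolding entropy_seq_def T_def by (simp add: diff_divide_distrib[symmetric] abs_divide)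
    also have "\<dots> \<le> real (n * k) * e / real n"
      using entropy_Bn_approx[OF _ approx, of n] n by (intro divide_right_mono) auto
    also have "\<dots> = r / 3" using n e(2) by simp
    finally have "\<bar>?s n - T n\<bar> \<le> r / 3" .
    moreover have "\<bar>T n - P\<bar> < r / 3" using n0 n by simp
    ultimately show "norm (?s n - ?I) < r" using I unfolding real_norm_def by linarith
  qed
qed

end

end

theorem corollary4p2:
  fixes k :: nat and a :: "real \<Rightarrow> complex mat"
  assumes "k \<ge> 1"
    and "Linfty_mat (2 * k) a"
    and "stationary_G_chain k (toeplitz_of_symbol (2 * k) a)"
    and "block_bounded (2 * k) (toeplitz_of_symbol (2 * k) a)"
    and "partially_symmetric (fourier_coeff (2 * k) a)"
  shows "convergent (entropy_seq k (toeplitz_of_symbol (2 * k) a)) \<and>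
    integrable (lebesgue_on {-pi..pi}) (\<lambda>\<theta>. gaussian_entropy k (a \<theta>)) \<and>
    entropy_rate k (toeplitz_of_symbol (2 * k) a) =
      1 / (2 * pi) * (LINT \<theta>|lebesgue_on {-pi..pi}. gaussian_entropy k (a \<theta>))"
proof -
  interpret G_chain k a by unfold_locales (fact assms)+
  obtain C where C: "C > 0" "AE t in circ. good C t" using AE_good .
  note lim = entropy_seq_tendsto[OF C]
  show ?thesis
    unfolding entropy_rate_def limI[OF lim]
    using convergentI[OF lim] entropy_symbol_integrable[OF C] by simp
qed

end
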